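(* Let $m,n\ge1$ and let $\mathfrak g=\mathfrak{osp}(2m|2n)$ or $\mathfrak g=\mathfrak{osp}(2m+1|2n)$ over $\mathbb C$. Let $\beta=\delta_s-\epsilon_t$ with $1\le s\le n$, $1\le t\le m$. If a weight $\lambda=(a_n,\ldots,a_1\,|\,b_1,\ldots,b_m)\in\mathfrak h^*$ is $\beta$-atypical (i.e. $(\lambda+\rho,\beta)=0$, equivalently $a_s+b_t+s-t=0$), then $S_{-\beta}v_\lambda^+$, where $S_{-\beta}=\sum_{J\in\mathcal A}d_Je_J\in U(\mathfrak n^-)$, is the unique (up to a nonzero scalar multiple) singular vector in the Verma module $M(\lambda)$ of weight $\lambda-\beta$.
   Context: Realization. Let $V$ be the superspace with even basis $v_1,\ldots,v_{2m}$ (and in addition an even vector $v_{2m+1}$ in the case of $\mathfrak{osp}(2m+1|2n)$) and odd basis $v_{\overline 1},\ldots,v_{\overline{2n}}$, with the even supersymmetric form whose only nonzero values on basis vectors are $(v_k,v_{k+m})=(v_{k+m},v_k)=1$ for $1\le k\le m$, $(v_{\overline{i+n}},v_{\overline i})=1=-(v_{\overline i},v_{\overline{i+n}})$ for $1\le i\le n$ (and $(v_{2m+1},v_{2m+1})=1$). $\mathfrak g$ is the Lie superalgebra of endomorphisms of $V$ preserving this form. Let $E_{x,y}$ be matrix units. The Cartan subalgebra $\mathfrak h$ has basis $E_{\overline i,\overline i}-E_{\overline{i+n},\overline{i+n}}$ $(1\le i\le n)$, $E_{k,k}-E_{k+m,k+m}$ $(1\le k\le m)$, with dual basis $\delta_1,\dots,\delta_n,\epsilon_1,\ldots,\epsilon_m$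 of $\mathfrak h^*$. A weight $\lambda=\sum_{i=1}^n a_i\delta_i+\sum_{k=1}^m b_k\epsilon_k$ is written $(a_n,\ldots,a_1\,|\,b_1,\ldots,b_m)$. Up to a nonzero scalar, the invariant form on $\mathfrak h^*$ is $(\delta_i,\epsilon_k)=0$ and $(\delta_i,\delta_j)=-(\epsilon_i,\epsilon_j)=1$ if $i=j$, $0$ otherwise. Positive roots. For $\mathfrak{osp}(2m|2n)$: $\Phi^+=\{\delta_i\pm\delta_j\ (i>j),\ 2\delta_i,\ \delta_i\pm\epsilon_k,\ \epsilon_k\pm\epsilon_l\ (k<l)\}$, with odd positive roots $\delta_i\pm\epsilon_k$. For $\mathfrak{osp}(2m+1|2n)$: the same together with the even roots $\epsilon_k$ and the odd roots $\delta_i$. $\mathfrak n^{\pm}$ is the sum of the root spaces for roots in $\pm\Phi^+$, so $\mathfrak g=\mathfrak n^-\oplus\mathfrak h\oplus\mathfrak n^+$; $\rho$ is half the sum of the positive even roots minus half the sum of the positive odd roots. The Verma module is $M(\lambda)=\mathrm{Ind}_{\mathfrak h\oplus\mathfrak n^+}^{\mathfrak g}\mathbb C1_\lambda$ with $h\cdot1_\lambda=\lambda(h)1_\lambda$, $\mathfrak n^+\cdot1_\lambda=0$, and $v_\lambda^+=1\otimes1_\lambda$. A nonzero vector $v$ is singular if $\mathfrak n^+\cdot v=0$. Root vectors: $e_{\delta_i-\delta_j}=E_{\overline i,\overline j}-E_{\overline{j+n},\overline{i+n}}$, $e_{\epsilon_k-\epsilon_l}=E_{k,l}-E_{l+m,k+m}$,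 $e_{-\delta_i+\epsilon_k}=E_{k,\overline i}-E_{\overline{i+n},k+m}$. The element $S_{-\beta}$. Order indices by $\overline n<\cdots<\overline 1<1<\cdots<m$ and write $\epsilon_{\overline i}:=\delta_i$. Let $\mathcal A$ be the set of all subsets $J=\{j_1<\cdots<j_p\}$ (including $\emptyset$) of the set of indices $k$ with $\overline s<k<t$, i.e. of $\{\overline{s-1},\ldots,\overline1,1,\ldots,t-1\}$. Put $e_J=e_{\epsilon_t-\epsilon_{j_p}}e_{\epsilon_{j_p}-\epsilon_{j_{p-1}}}\cdots e_{\epsilon_{j_1}-\epsilon_{\overline s}}$, with $e_\emptyset=e_{\epsilon_t-\delta_s}$. Define $c_{\overline k}=a_s-a_k+s-1-k$ for $1\le k\le s-1$, $c_k=b_t-b_k-(t-k)$ for $1\le k\le t-1$, and $d_J=\prod_{\overline s<k<t,\;k\notin J}c_k$ (empty product $=1$). *)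

theory Defs
  imports
    Complex_Main
    "HOL-Library.Poly_Mapping"
    "HOL-Library.Function_Algebras"
    "HOL-Algebra.QuotRing"
    "HOL-Algebra.Generated_Rings"
    "HOL-Algebra.Generated_Groups"
    "HOL-Algebra.Free_Abelian_Groups"
begin

section \<open>Free associative algebras\<close>

text \<open>
  Words form the free monoid, written additively so that the convolution product of finitely
  supported functions on words is the product of the free associative algebra.
\<close>

datatype 'x fword = Word (letters: "'x list")

instantiation fword :: (type) monoid_add
begin

definition "0 = Word []"
definition "v + w = Word (letters v @ letters w)"

instance
  by standard (simp_all add: zero_fword_def plus_fword_def)

end

type_synonym 'x free_alg = "'x fword \<Rightarrow>\<^sub>0 complex"

definition gen :: "'x \<Rightarrow> 'x free_alg" where
  "gen x = Poly_Mapping.single (Word [x]) 1"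

definition const :: "complex \<Rightarrow> 'x free_alg" where
  "const c = Poly_Mapping.single 0 c"

definition free_algebra :: "'x set \<Rightarrow> 'x free_alg ring" where
  "free_algebra X =
    \<lparr>carrier = {p. \<forall>w \<in> Poly_Mapping.keys p. set (letters w) \<subseteq> X},
     monoid.mult = (*), one = 1, ring.zero = 0, add = (+)\<rparr>"


section \<open>The orthosymplectic Lie superalgebras\<close>

text \<open>
  The basis vector \<open>v\<^sub>k\<close> is indexed by the integer \<open>k > 0\<close> and the vector with barred index
  \<open>i\<close> by the integer \<open>- i < 0\<close>, so that the order of the indices
  \<open>bar n < ... < bar 1 < 1 < ... < m\<close> is the order of the integers.
  An endomorphism of the superspace is given by its matrix \<open>A\<close>, with
  \<open>A v\<^sub>y = (\<Sum>x. A x y \<cdot> v\<^sub>x)\<close>.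

  An element of the dual of the Cartan subalgebra is given by its coordinates in the basis
  \<open>\<delta>\<^sub>i\<close>, \<open>\<epsilon>\<^sub>k\<close>: \<open>\<mu> (- i)\<close> is the coefficient of \<open>\<delta>\<^sub>i\<close> for \<open>1 \<le> i \<le> n\<close>, and \<open>\<mu> k\<close> is
  the coefficient of \<open>\<epsilon>\<^sub>k\<close> for \<open>1 \<le> k \<le> m\<close>. The values of \<open>\<mu>\<close> at other integers are irrelevant.
\<close>

type_synonym endo = "int \<Rightarrow> int \<Rightarrow> complex"
type_synonym weight = "int \<Rightarrow> complex"

definition par :: "int \<Rightarrow> nat" where
  "par x = (if x < 0 then 1 else 0)"

definition E :: "int \<Rightarrow> int \<Rightarrow> endo" where
  "E x y = (\<lambda>x' y'. of_bool (x' = x \<and> y' = y))"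

definition scale :: "complex \<Rightarrow> endo \<Rightarrow> endo" where
  "scale c A = (\<lambda>x y. c * A x y)"

text \<open>The component of parity \<open>p \<in> {0, 1}\<close>.\<close>

definition part :: "nat \<Rightarrow> endo \<Rightarrow> endo" where
  "part p A = (\<lambda>x y. if even (par x + par y + p) then A x y else 0)"

definition eps :: "int \<Rightarrow> weight" where
  "eps x = (\<lambda>y. of_bool (y = x))"

abbreviation delta :: "int \<Rightarrow> weight" where
  "delta i \<equiv> eps (- i)"

text \<open>
  With \<open>ex = False\<close> the superalgebra is \<open>osp(2m|2n)\<close>, with \<open>ex = True\<close> it is \<open>osp(2m+1|2n)\<close>.
\<close>

locale osp =
  fixes m n :: nat and ex :: bool
begin

definition inds :: "int set" where
  "inds = {- int (2 * n) .. -1} \<union> {1 .. int (2 * m) + of_bool ex}"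

text \<open>\<open>form x y\<close> is the value of the form on the pair of basis vectors \<open>(v\<^sub>x, v\<^sub>y)\<close>.\<close>

definition form :: "int \<Rightarrow> int \<Rightarrow> complex" where
  "form x y =
    (if x \<in> {1..int m} \<and> y = x + int m \<or> y \<in> {1..int m} \<and> x = y + int m then 1
     else if y \<in> {- int n .. -1} \<and> x = y - int n then 1
     else if x \<in> {- int n .. -1} \<and> y = x - int n then -1
     else if ex \<and> x = 2 * int m + 1 \<and> y = 2 * int m + 1 then 1
     else 0)"

text \<open>
  The homogeneous elements of parity \<open>p\<close>: those \<open>A\<close> with
  \<open>(A v, w) + (- 1)\<^sup>p\<^sup>q (v, A w) = 0\<close> for \<open>v\<close> homogeneous of parity \<open>q\<close>.
\<close>

definition osp_part :: "nat \<Rightarrow> endo set" where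
  "osp_part p =
    {A. (\<forall>x y. A x y \<noteq> 0 \<longrightarrow> x \<in> inds \<and> y \<in> inds \<and> even (par x + par y + p)) \<and>
        (\<forall>x\<in>inds. \<forall>y\<in>inds.
          (\<Sum>z\<in>inds. A z x * form z y) + (-1) ^ (p * par x) * (\<Sum>z\<in>inds. form x z * A z y) = 0)}"

definition g :: "endo set" where
  "g = {A + B | A B. A \<in> osp_part 0 \<and> B \<in> osp_part 1}"

definition mmult :: "endo \<Rightarrow> endo \<Rightarrow> endo" where
  "mmult A B = (\<lambda>x y. \<Sum>z\<in>inds. A x z * B z y)"

definition bracket :: "endo \<Rightarrow> endo \<Rightarrow> endo" where
  "bracket A B =
    (\<Sum>p<2. \<Sum>q<2. mmult (part p A) (part q B) - scale ((-1) ^ (p * q)) (mmult (part q B) (part p A)))"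

definition cartan :: "endo set" where
  "cartan = range (\<lambda>c :: weight.
     (\<Sum>i=1..int n. scale (c (- i)) (E (- i) (- i) - E (- (i + int n)) (- (i + int n)))) +
     (\<Sum>k=1..int m. scale (c k) (E k k - E (k + int m) (k + int m))))"

text \<open>
  The value \<open>\<mu>(h)\<close> for \<open>h\<close> in the Cartan subalgebra: the dual basis \<open>\<delta>\<^sub>i\<close>, \<open>\<epsilon>\<^sub>k\<close> reads off the
  diagonal entries of \<open>h\<close> at \<open>- i\<close> and \<open>k\<close>.
\<close>

definition ev :: "weight \<Rightarrow> endo \<Rightarrow> complex" where
  "ev \<mu> h = (\<Sum>i=1..int n. \<mu> (- i) * h (- i) (- i)) + (\<Sum>k=1..int m. \<mu> k * h k k)"

definition dual_form :: "weight \<Rightarrow> weight \<Rightarrow> complex" where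
  "dual_form \<mu> \<nu> = (\<Sum>i=1..int n. \<mu> (- i) * \<nu> (- i)) - (\<Sum>k=1..int m. \<mu> k * \<nu> k)"


subsection \<open>Roots\<close>

definition even_pos_roots :: "weight set" where
  "even_pos_roots =
    {delta i - delta j | i j. 1 \<le> j \<and> j < i \<and> i \<le> int n} \<union>
    {delta i + delta j | i j. 1 \<le> j \<and> j < i \<and> i \<le> int n} \<union>
    {delta i + delta i | i. 1 \<le> i \<and> i \<le> int n} \<union>
    {eps k - eps l | k l. 1 \<le> k \<and> k < l \<and> l \<le> int m} \<union>
    {eps k + eps l | k l. 1 \<le> k \<and> k < l \<and> l \<le> int m} \<union>
    {eps k | k. ex \<and> 1 \<le> k \<and> k \<le> int m}"

definition odd_pos_roots :: "weight set" where
  "odd_pos_roots =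
    {delta i - eps k | i k. 1 \<le> i \<and> i \<le> int n \<and> 1 \<le> k \<and> k \<le> int m} \<union>
    {delta i + eps k | i k. 1 \<le> i \<and> i \<le> int n \<and> 1 \<le> k \<and> k \<le> int m} \<union>
    {delta i | i. ex \<and> 1 \<le> i \<and> i \<le> int n}"

definition pos_roots :: "weight set" where
  "pos_roots = even_pos_roots \<union> odd_pos_roots"

definition rho :: weight where
  "rho = (\<lambda>x. (\<Sum>\<alpha>\<in>even_pos_roots. \<alpha> x) / 2 - (\<Sum>\<alpha>\<in>odd_pos_roots. \<alpha> x) / 2)"

definition root_space :: "weight \<Rightarrow> endo set" where
  "root_space \<alpha> = {x \<in> g. \<forall>h\<in>cartan. bracket h x = scale (ev \<alpha> h) x}"

definition root_spaces_sum :: "weight set \<Rightarrow> endo set" where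
  "root_spaces_sum R = {(\<Sum>\<alpha>\<in>R. x \<alpha>) | x. \<forall>\<alpha>\<in>R. x \<alpha> \<in> root_space \<alpha>}"

definition n_pos :: "endo set" where
  "n_pos = root_spaces_sum pos_roots"

definition n_neg :: "endo set" where
  "n_neg = root_spaces_sum (uminus ` pos_roots)"

definition atypical :: "weight \<Rightarrow> weight \<Rightarrow> bool" where
  "atypical lam \<beta> \<longleftrightarrow> dual_form (lam + rho) \<beta> = 0"


subsection \<open>The universal enveloping superalgebra\<close>

text \<open>
  The first two families of relations are linearity of \<open>gen\<close>: modulo these the free algebra on
  the underlying set of \<open>g\<close> is the tensor algebra of \<open>g\<close>.
\<close>

definition U_rels :: "endo free_alg set" where
  "U_rels =
    {gen (x + y) - gen x - gen y | x y. x \<in> g \<and> y \<in> g} \<union>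
    {gen (scale c x) - const c * gen x | c x. x \<in> g} \<union>
    {gen x * gen y - const ((-1) ^ (p * q)) * gen y * gen x - gen (bracket x y) | p q x y.
       p < 2 \<and> q < 2 \<and> x \<in> osp_part p \<and> y \<in> osp_part q}"

definition U_ideal :: "endo free_alg set" where
  "U_ideal = Idl\<^bsub>free_algebra g\<^esub> U_rels"

definition U :: "endo free_alg set ring" where
  "U = free_algebra g Quot U_ideal"

definition inU :: "endo \<Rightarrow> endo free_alg set" where
  "inU x = U_ideal +>\<^bsub>free_algebra g\<^esub> gen x"

definition scalU :: "complex \<Rightarrow> endo free_alg set" where
  "scalU c = U_ideal +>\<^bsub>free_algebra g\<^esub> const c"

definition U_neg :: "endo free_alg set set" where
  "U_neg = generate_ring U (range scalU \<union> inU ` n_neg)"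


subsection \<open>Verma modules\<close>

text \<open>
  The Verma module is the tensor product over \<open>U(b)\<close>, for \<open>b\<close> the sum of the Cartan subalgebra
  and \<open>n_pos\<close>, of the right module \<open>U(g)\<close> and the one-dimensional left module on \<open>complex\<close>: the
  free abelian group on pairs modulo biadditivity and balancing. A pair \<open>(y, c)\<close> in
  \<open>borel_action lam\<close> says that \<open>y\<close> acts on \<open>complex\<close> as multiplication by \<open>c\<close>. The first components
  of these pairs generate \<open>U(b)\<close> as a ring, so balancing need only be imposed for them.
\<close>

definition borel_action :: "weight \<Rightarrow> (endo free_alg set \<times> complex) set" where
  "borel_action lam =
    {(scalU c, c) | c. True} \<union>
    {(inU h, ev lam h) | h. h \<in> cartan} \<union>
    {(inU x, 0) | x. x \<in> n_pos}"

abbreviation pairs :: "((endo free_alg set \<times> complex) \<Rightarrow>\<^sub>0 int) monoid" where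
  "pairs \<equiv> free_Abelian_group (carrier U \<times> UNIV)"

definition tensor_rels :: "weight \<Rightarrow> ((endo free_alg set \<times> complex) \<Rightarrow>\<^sub>0 int) set" where
  "tensor_rels lam =
    {frag_of (u \<oplus>\<^bsub>U\<^esub> u', w) - frag_of (u, w) - frag_of (u', w) | u u' w.
       u \<in> carrier U \<and> u' \<in> carrier U} \<union>
    {frag_of (u, w + w') - frag_of (u, w) - frag_of (u, w') | u w w'. u \<in> carrier U} \<union>
    {frag_of (u \<otimes>\<^bsub>U\<^esub> y, w) - frag_of (u, c * w) | u y c w.
       u \<in> carrier U \<and> (y, c) \<in> borel_action lam}"

definition tensor_kernel :: "weight \<Rightarrow> ((endo free_alg set \<times> complex) \<Rightarrow>\<^sub>0 int) set" where
  "tensor_kernel lam = generate pairs (tensor_rels lam)"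

definition verma :: "weight \<Rightarrow> ((endo free_alg set \<times> complex) \<Rightarrow>\<^sub>0 int) set monoid" where
  "verma lam = pairs Mod tensor_kernel lam"

definition tensor ::
    "weight \<Rightarrow> endo free_alg set \<Rightarrow> complex \<Rightarrow> ((endo free_alg set \<times> complex) \<Rightarrow>\<^sub>0 int) set" where
  "tensor lam u w = tensor_kernel lam #>\<^bsub>pairs\<^esub> frag_of (u, w)"

definition highest_weight_vector ::
    "weight \<Rightarrow> ((endo free_alg set \<times> complex) \<Rightarrow>\<^sub>0 int) set" where
  "highest_weight_vector lam = tensor lam \<one>\<^bsub>U\<^esub> 1"

text \<open>
  The additive map induced by \<open>u \<otimes> w \<mapsto> z u \<otimes> w\<close>; it is constant on the cosets.
\<close>

definition act ::
    "weight \<Rightarrow> endo free_alg set \<Rightarrow> ((endo free_alg set \<times> complex) \<Rightarrow>\<^sub>0 int) set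
      \<Rightarrow> ((endo free_alg set \<times> complex) \<Rightarrow>\<^sub>0 int) set" where
  "act lam z v = the_elem
    ((\<lambda>p. tensor_kernel lam #>\<^bsub>pairs\<^esub> frag_extend (\<lambda>(u, w). frag_of (z \<otimes>\<^bsub>U\<^esub> u, w)) p) ` v)"

definition singular :: "weight \<Rightarrow> ((endo free_alg set \<times> complex) \<Rightarrow>\<^sub>0 int) set \<Rightarrow> bool" where
  "singular lam v \<longleftrightarrow> v \<in> carrier (verma lam) \<and> v \<noteq> \<one>\<^bsub>verma lam\<^esub> \<and>
     (\<forall>x\<in>n_pos. act lam (inU x) v = \<one>\<^bsub>verma lam\<^esub>)"

definition weight_vector ::
    "weight \<Rightarrow> weight \<Rightarrow> ((endo free_alg set \<times> complex) \<Rightarrow>\<^sub>0 int) set \<Rightarrow> bool" where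
  "weight_vector lam \<mu> v \<longleftrightarrow> v \<in> carrier (verma lam) \<and>
     (\<forall>h\<in>cartan. act lam (inU h) v = act lam (scalU (ev \<mu> h)) v)"


subsection \<open>The element \<open>S\<close>\<close>

definition dual_ind :: "int \<Rightarrow> int" where
  "dual_ind x = (if x < 0 then x - int n else x + int m)"

text \<open>
  \<open>root_vec x y\<close> is the root vector for the root \<open>eps x - eps y\<close>, where \<open>x\<close> and \<open>y\<close> have the same
  sign or \<open>x > 0 > y\<close>; for \<open>x < 0 < y\<close> the sign would have to be the opposite one.
\<close>

definition root_vec :: "int \<Rightarrow> int \<Rightarrow> endo" where
  "root_vec x y = E x y - E (dual_ind y) (dual_ind x)"

definition between :: "nat \<Rightarrow> nat \<Rightarrow> int set" where
  "between s t = {- int s <..< int t} - {0}"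

text \<open>\<open>chain y [j\<^sub>1, ..., j\<^sub>p] = [root_vec j\<^sub>p j\<^sub>p\<^sub>-\<^sub>1, ..., root_vec j\<^sub>1 y]\<close>\<close>

fun chain :: "int \<Rightarrow> int list \<Rightarrow> endo list" where
  "chain y [] = []"
| "chain y (j # js) = chain j js @ [root_vec j y]"

definition e_elem :: "nat \<Rightarrow> nat \<Rightarrow> int set \<Rightarrow> endo free_alg set" where
  "e_elem s t J =
    foldr (\<lambda>x u. inU x \<otimes>\<^bsub>U\<^esub> u) (chain (- int s) (sorted_list_of_set J @ [int t])) \<one>\<^bsub>U\<^esub>"

text \<open>For \<open>j = - k < 0\<close> the first case is \<open>a\<^sub>s - a\<^sub>k + s - 1 - k\<close>.\<close>

definition c_coeff :: "nat \<Rightarrow> nat \<Rightarrow> weight \<Rightarrow> int \<Rightarrow> complex" where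
  "c_coeff s t lam j =
    (if j < 0 then lam (- int s) - lam j + of_int (int s - 1 + j)
     else lam (int t) - lam j - of_int (int t - j))"

definition d_coeff :: "nat \<Rightarrow> nat \<Rightarrow> weight \<Rightarrow> int set \<Rightarrow> complex" where
  "d_coeff s t lam J = (\<Prod>k\<in>between s t - J. c_coeff s t lam k)"

definition S_elem :: "nat \<Rightarrow> nat \<Rightarrow> weight \<Rightarrow> endo free_alg set" where
  "S_elem s t lam =
    (\<Oplus>\<^bsub>U\<^esub>J\<in>Pow (between s t). scalU (d_coeff s t lam J) \<otimes>\<^bsub>U\<^esub> e_elem s t J)"

end

end

theory Submission
  imports Defs "HOL-Library.Product_Lexorder" "HOL-Library.Multiset"
begin

text \<open>
  The root \<open>\<beta>\<close> is the sum of the simple roots joining the indices \<open>- s\<close> and \<open>t\<close>, each taken once.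
  Hence the weight space of \<open>M(\<lambda>)\<close> for \<open>\<lambda> - \<beta>\<close> has the products \<open>e\<^sub>J v\<close> as a basis, where
  \<open>J\<close> is the set of inner vertices of a path from \<open>- s\<close> to \<open>t\<close>. The raising operator that joins the
  neighbouring indices \<open>k\<close> and \<open>k'\<close> kills \<open>\<Sum>\<^sub>J x\<^sub>J e\<^sub>J v\<close> iff
  \<open>h\<^sub>k x(J \<union> {k, k'}) + x(J \<union> {k'}) \<plusminus> x(J \<union> {k}) = 0\<close> for all \<open>J\<close> avoiding \<open>k\<close> and \<open>k'\<close>.
  Going from \<open>- s\<close> towards \<open>t\<close>, these equations say \<open>x(J) = c\<^sub>k x(J \<union> {k})\<close> for \<open>k\<close> not in \<open>J\<close>, with
  \<open>h\<^sub>k + c\<^sub>k \<plusminus> c\<^sub>k\<^sub>' = 0\<close>, and the equation at the last step, \<open>c\<^sub>t = 0\<close>, is the atypicality condition.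
  The remaining positive root vectors either are commutators of these raising operators or lead to
  a weight that does not occur in \<open>M(\<lambda>)\<close>.

  Independence of ordered monomials in \<open>U(g)\<close> is read off from the action of \<open>g\<close> on tensor powers of
  \<open>End V\<close>: a linear functional on \<open>End V\<close> that vanishes at the identity, applied to the first factor
  of \<open>x\<^sub>1 \<cdots> x\<^sub>r (1 \<otimes> \<cdots> \<otimes> 1)\<close>, acts on the word \<open>x\<^sub>1 \<cdots> x\<^sub>r\<close> as a superderivation up to words
  with fewer than \<open>r - 1\<close> letters.
\<close>

section \<open>Free algebras\<close>

text \<open>The modules are given by generators and relations, so the obstacle is to see that a
  vector is nonzero; existence and uniqueness both rest on the independence of the words
  \<open>pw I\<close> applied to the highest weight vector. Functions on lists of all lengths hold
  all tensor powers at once, so pairing off the first factor stays inside one space and lowers word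
  length; in this induction the multiplicity of a letter must be nonzero, which is where
  characteristic 0 enters. Letters are shifted by \<open>lam\<close> beforehand, so that the kernel
  \<open>K\<close> of the map onto the Verma module lies, modulo relations, in the span of the
  normal words with a letter outside \<open>negl\<close>, and the other normal words survive. Words
  are sorted by descending first coordinate, so a product along a path from \<open>t\<close> down to
  \<open>- s\<close> is already normal and the computation with \<open>S\<close> needs no
  straightening. The coefficients have two normalisations, at \<open>s\<close> for negative and at
  \<open>t\<close> for positive indices; atypicality says that they fit together at the odd simple
  root between \<open>-1\<close> and \<open>1\<close>.\<close>

lemma letters_zero [simp]: "letters 0 = []"
  by (simp add: zero_fword_def)

lemma letters_plus [simp]: "letters (v + w) = letters v @ letters w"
  by (simp add: plus_fword_def)

lemma const_0 [simp]: "const 0 = 0" and const_1 [simp]: "const 1 = 1"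
  by (simp_all add: const_def)

lemma const_add: "const (a + b) = const a + const b"
  and const_mult: "const (a * b) = const a * const b"
  and const_diff: "const (a - b) = const a - const b"
  and const_uminus: "const (- a) = - const a"
  by (simp_all add: const_def single_add mult_single single_diff single_uminus)

lemma free_alg_sum_monomials: "(\<Sum>k\<in>Poly_Mapping.keys p. Poly_Mapping.single k (Poly_Mapping.lookup p k)) = p"
proof (rule poly_mapping_eqI)
  fix k
  have "Poly_Mapping.lookup (\<Sum>k\<in>Poly_Mapping.keys p. Poly_Mapping.single k (Poly_Mapping.lookup p k)) k =
    (\<Sum>l\<in>Poly_Mapping.keys p. if l = k then Poly_Mapping.lookup p k else 0)"
    by (auto simp: lookup_sum lookup_single when_def intro!: sum.cong)
  also have "\<dots> = Poly_Mapping.lookup p k"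
    by (simp add: in_keys_iff)
  finally show "Poly_Mapping.lookup (\<Sum>k\<in>Poly_Mapping.keys p. Poly_Mapping.single k (Poly_Mapping.lookup p k)) k
    = Poly_Mapping.lookup p k" .
qed

lemma free_alg_induct [case_names single add]:
  assumes "\<And>k c. P (Poly_Mapping.single k c)" and "\<And>p q. P p \<Longrightarrow> P q \<Longrightarrow> P (p + q)"
  shows "P (p :: 'x free_alg)"
proof -
  have "P (\<Sum>k\<in>K. Poly_Mapping.single k (Poly_Mapping.lookup p k))" if "finite K" for K
    using that
  proof (induction K rule: finite_induct)
    case empty
    then show ?case using assms(1)[of 0 0] by simp
  next
    case (insert x F)
    then show ?case using assms by simp
  qed
  then show ?thesis by (metis free_alg_sum_monomials finite_keys)
qed

lemma const_commute: "const c * p = p * const c"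
proof (induction p rule: free_alg_induct)
  case (single k d)
  then show ?case by (simp add: const_def mult_single mult.commute)
next
  case (add p q)
  then show ?case by (simp add: algebra_simps)
qed

lemma const_left_commute: "p * (const c * q) = const c * (p * q)"
  by (metis const_commute mult.assoc)

text \<open>Scalars act through the central elements \<open>const c\<close>, which makes the theory
  of spans and subspaces available for the free algebra.\<close>

global_interpretation FA: vector_space "\<lambda>c (p :: 'x free_alg). const c * p"
  by standard (simp_all add: algebra_simps const_add const_mult)

definition mon :: "'x list \<Rightarrow> 'x free_alg" where
  "mon w = Poly_Mapping.single (Word w) 1"

lemma mon_Nil [simp]: "mon [] = 1"
  by (metis mon_def single_one zero_fword_def)

lemma mon_append: "mon (v @ w) = mon v * mon w"
  by (simp add: mon_def mult_single plus_fword_def)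

lemma mon_Cons: "mon (x # w) = gen x * mon w"
  using mon_append[of "[x]" w] by (simp add: mon_def gen_def)

lemma single_eq_mon: "Poly_Mapping.single k c = const c * mon (letters k)"
  by (cases k) (simp add: const_def mon_def mult_single)

abbreviation fa :: "'x set \<Rightarrow> 'x free_alg set" where
  "fa X \<equiv> carrier (free_algebra X)"

lemma fa_iff: "p \<in> fa X \<longleftrightarrow> (\<forall>w \<in> Poly_Mapping.keys p. set (letters w) \<subseteq> X)"
  by (simp add: free_algebra_def)

lemma fa_add: "p \<in> fa X \<Longrightarrow> q \<in> fa X \<Longrightarrow> p + q \<in> fa X"
  using keys_add[of p q] by (fastforce simp: fa_iff)

lemma fa_uminus: "p \<in> fa X \<Longrightarrow> - p \<in> fa X"
  by (simp add: fa_iff)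

lemma fa_diff: "p \<in> fa X \<Longrightarrow> q \<in> fa X \<Longrightarrow> p - q \<in> fa X"
  using fa_add[of p X "- q"] fa_uminus[of q X] by simp

lemma fa_0 [simp]: "0 \<in> fa X" and fa_1 [simp]: "1 \<in> fa X"
  and fa_const [simp]: "const c \<in> fa X"
  by (simp_all add: fa_iff const_def)

lemma fa_gen: "x \<in> X \<Longrightarrow> gen x \<in> fa X"
  by (simp add: fa_iff gen_def)

lemma fa_mult: "p \<in> fa X \<Longrightarrow> q \<in> fa X \<Longrightarrow> p * q \<in> fa X"
  using keys_mult[of p q] by (fastforce simp: fa_iff)

lemma fa_sum: "(\<And>i. i \<in> I \<Longrightarrow> f i \<in> fa X) \<Longrightarrow> sum f I \<in> fa X"
  by (induction I rule: infinite_finite_induct) (auto intro: fa_add)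

lemma fa_mon: "set w \<subseteq> X \<Longrightarrow> mon w \<in> fa X"
  by (simp add: mon_def fa_iff)

lemma fa_subspace: "FA.subspace (fa X)"
  by (simp add: FA.subspace_def fa_add fa_mult)

text \<open>Reduces claims about \<open>fa X\<close> to words: a subspace that contains all of them
  contains \<open>fa X\<close>.\<close>

lemma fa_eq_span: "fa X = FA.span (mon ` lists X)"
proof
  show "FA.span (mon ` lists X) \<subseteq> fa X"
    by (rule FA.span_minimal) (auto simp: fa_subspace fa_mon in_lists_conv_set subsetD intro!: fa_mon)
  show "fa X \<subseteq> FA.span (mon ` lists X)"
  proof
    fix p assume p: "p \<in> fa X"
    have "(\<Sum>k\<in>Poly_Mapping.keys p. const (Poly_Mapping.lookup p k) * mon (letters k)) \<in> FA.span (mon ` lists X)"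
      using p by (intro FA.span_sum FA.span_scale FA.span_base) (auto simp: fa_iff in_lists_conv_set)
    then show "p \<in> FA.span (mon ` lists X)"
      by (simp add: free_alg_sum_monomials flip: single_eq_mon)
  qed
qed

lemma free_algebra_simps [simp]:
  "p \<otimes>\<^bsub>free_algebra X\<^esub> q = p * q" "p \<oplus>\<^bsub>free_algebra X\<^esub> q = p + q"
  "\<one>\<^bsub>free_algebra X\<^esub> = 1" "\<zero>\<^bsub>free_algebra X\<^esub> = 0"
  by (simp_all add: free_algebra_def)

lemma ring_free_algebra: "ring (free_algebra X)"
proof (rule ringI)
  show "abelian_group (free_algebra X)"
  proof (rule abelian_groupI)
    fix p assume "p \<in> fa X"
    then show "\<exists>q\<in>fa X. q \<oplus>\<^bsub>free_algebra X\<^esub> p = \<zero>\<^bsub>free_algebra X\<^esub>"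
      by (intro bexI[of _ "- p"]) (auto intro: fa_uminus)
  qed (auto intro: fa_add simp: algebra_simps)
  show "monoid (free_algebra X)"
    by (rule monoidI) (auto intro: fa_mult simp: algebra_simps)
qed (auto simp: algebra_simps)

lemma a_inv_free_algebra [simp]:
  assumes "p \<in> fa X"
  shows "\<ominus>\<^bsub>free_algebra X\<^esub> p = - p"
proof -
  interpret ring "free_algebra X" by (rule ring_free_algebra)
  show ?thesis
    using assms minus_equality[of "- p" p] by (simp add: fa_uminus)
qed

lemma span_mult_left:
  assumes "p \<in> FA.span X" and "\<And>x. x \<in> X \<Longrightarrow> q * x \<in> FA.span Y"
  shows "q * p \<in> FA.span Y"
  using assms(1)
proof (induction rule: FA.span_induct_alt)
  case base
  then show ?case by (simp add: FA.span_zero)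
next
  case (step c x y)
  have "q * (const c * x + y) = const c * (q * x) + q * y"
    by (simp add: algebra_simps const_left_commute)
  then show ?case using step assms(2) by (simp add: FA.span_add FA.span_scale)
qed

lemma span_mult_right:
  assumes "p \<in> FA.span X" and "\<And>x. x \<in> X \<Longrightarrow> x * q \<in> FA.span Y"
  shows "p * q \<in> FA.span Y"
  using assms(1)
proof (induction rule: FA.span_induct_alt)
  case base
  then show ?case by (simp add: FA.span_zero)
next
  case (step c x y)
  have "(const c * x + y) * q = const c * (x * q) + y * q"
    by (simp add: algebra_simps)
  then show ?case using step assms(2) by (simp add: FA.span_add FA.span_scale)
qed

section \<open>The matrices of the Lie superalgebra\<close>

lemma sum_fun_apply2: "(\<Sum>i\<in>I. f i) x y = (\<Sum>i\<in>I. f i x y)"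
  for f :: "'i \<Rightarrow> endo"
  by (induction I rule: infinite_finite_induct) auto

lemma par_less_2: "par x = 0 \<or> par x = 1"
  by (simp add: par_def)

lemma scale_apply: "scale c A x y = c * A x y"
  by (simp add: scale_def)

context osp
begin

text \<open>
  The basis vector dual to \<open>v\<^sub>x\<close> with respect to the form is \<open>v\<close> with index \<open>st x\<close>, up to a sign;
  \<open>wt x\<close> is the weight of \<open>v\<^sub>x\<close>, and \<open>ht x\<close> is the value at \<open>wt x\<close> of a functional that is positive
  on the positive roots.
\<close>

definition st :: "int \<Rightarrow> int" where
  "st x = (if - int n \<le> x \<and> x \<le> -1 then x - int n
    else if x < 0 then x + int n
    else if x \<le> int m then x + int m
    else if x \<le> 2 * int m then x - int m
    else x)"

definition ht :: "int \<Rightarrow> int" where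
  "ht x = (if - int n \<le> x \<and> x \<le> -1 then int m - x
    else if x < 0 then x + int n - int m
    else if x \<le> int m then int m + 1 - x
    else if x \<le> 2 * int m then x - 2 * int m - 1
    else 0)"

definition wt :: "int \<Rightarrow> weight" where
  "wt x = (if - int n \<le> x \<and> x \<le> -1 then eps x
    else if x < 0 then - eps (x + int n)
    else if x \<le> int m then eps x
    else if x \<le> 2 * int m then - eps (x - int m)
    else 0)"

text \<open>The indices of positive height. Their basis vectors span an isotropic subspace, and the
  \<open>F (x, y)\<close> with both indices in \<open>W\<close> behave like the matrix units of a
  general linear superalgebra; the products along paths use only these.\<close>

definition W :: "int set" where
  "W = {- int n .. int m} - {0}"

text \<open>The value of the form on \<open>(v\<^sub>x, v\<^sub>y)\<close> for \<open>y = st x\<close>.\<close>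

definition kap :: "int \<Rightarrow> complex" where
  "kap x = (if - int n \<le> x \<and> x \<le> -1 then -1 else 1)"

text \<open>The form is preserved by \<open>A\<close> iff \<open>A (st y) (st x) = sig x y * A x y\<close>.\<close>

definition sig :: "int \<Rightarrow> int \<Rightarrow> complex" where
  "sig x y = - ((-1) ^ (par x * (1 + par y)) * kap (st x) * kap (st y))"

lemma finite_inds [simp]: "finite inds"
  by (simp add: inds_def)

lemma finite_W [simp]: "finite W"
  by (simp add: W_def)

lemma W_subset_inds: "W \<subseteq> inds"
  by (auto simp: W_def inds_def)

lemma st_inds [simp]: "x \<in> inds \<Longrightarrow> st x \<in> inds"
  by (auto simp: st_def inds_def of_bool_def split: if_splits)

lemma st_st [simp]: "x \<in> inds \<Longrightarrow> st (st x) = x"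
  by (auto simp: st_def inds_def of_bool_def split: if_splits)

lemma par_st [simp]: "x \<in> inds \<Longrightarrow> par (st x) = par x"
  by (auto simp: st_def inds_def par_def of_bool_def split: if_splits)

lemma ht_st [simp]: "x \<in> inds \<Longrightarrow> ht (st x) = - ht x"
  by (auto simp: st_def ht_def inds_def of_bool_def split: if_splits)

lemma wt_st [simp]: "x \<in> inds \<Longrightarrow> wt (st x) = - wt x"
  by (auto simp: st_def wt_def inds_def of_bool_def split: if_splits)

lemma ht_inj: "x \<in> inds \<Longrightarrow> y \<in> inds \<Longrightarrow> ht x = ht y \<longleftrightarrow> x = y"
  by (auto simp: ht_def inds_def of_bool_def split: if_splits)

lemma ht_eq_0: "x \<in> inds \<Longrightarrow> ht x = 0 \<Longrightarrow> x = 2 * int m + 1"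
  by (auto simp: ht_def inds_def of_bool_def split: if_splits)

lemma ht_pos_iff: "x \<in> inds \<Longrightarrow> ht x > 0 \<longleftrightarrow> x \<in> W"
  by (auto simp: ht_def inds_def W_def of_bool_def split: if_splits)

lemma kap_st: "x \<in> inds \<Longrightarrow> kap x * kap (st x) = (-1) ^ par x"
  by (auto simp: kap_def st_def inds_def par_def of_bool_def split: if_splits)

lemma kap_sq: "kap x * kap x = 1"
  by (simp add: kap_def)

lemma sig_sq: "sig x y * sig x y = 1"
proof -
  have "((-1::complex) ^ k) * (-1) ^ k = 1" for k
    by (simp flip: power_add mult_2)
  then show ?thesis
    using kap_sq[of "st x"] kap_sq[of "st y"] by (simp add: sig_def algebra_simps)
qed

lemma st_eq_iff: "x \<in> inds \<Longrightarrow> y \<in> inds \<Longrightarrow> st x = st y \<longleftrightarrow> x = y"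
  using st_st by metis

lemma st_inject: "x \<in> inds \<Longrightarrow> y \<in> inds \<Longrightarrow> st x = y \<longleftrightarrow> x = st y"
  using st_st by metis

lemma ball_st: "(\<forall>x\<in>inds. P (st x)) \<longleftrightarrow> (\<forall>x\<in>inds. P x)"
  using st_inds st_st by metis

lemma sum_inds_st: "(\<Sum>z\<in>inds. f (st z)) = (\<Sum>z\<in>inds. f z)"
  by (rule sum.reindex_bij_witness[of _ st st]) auto

lemma form_eq:
  assumes "x \<in> inds" "y \<in> inds"
  shows "form x y = (if y = st x then kap x else 0)"
  using assms by (auto simp: form_def st_def kap_def inds_def of_bool_def split: if_splits)

lemma sum_form_right: 
  assumes "y \<in> inds"
  shows "(\<Sum>z\<in>inds. f z * form z y) = f (st y) * kap (st y)"
proof -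
  have "(\<Sum>z\<in>inds. f z * form z y) = (\<Sum>z\<in>inds. if z = st y then f z * kap z else 0)"
    using assms by (intro sum.cong) (auto simp: form_eq)
  also have "\<dots> = f (st y) * kap (st y)"
    using assms by (simp add: sum.delta)
  finally show ?thesis .
qed

lemma sum_form_left: 
  assumes "x \<in> inds"
  shows "(\<Sum>z\<in>inds. form x z * f z) = kap x * f (st x)"
proof -
  have "(\<Sum>z\<in>inds. form x z * f z) = (\<Sum>z\<in>inds. if z = st x then kap x * f z else 0)"
    using assms by (intro sum.cong) (auto simp: form_eq)
  also have "\<dots> = kap x * f (st x)"
    using assms by (simp add: sum.delta)
  finally show ?thesis .
qed

text \<open>On the support of a homogeneous matrix the sign in the invariance condition depends only
  on the parities of the two indices. Hence one condition, with the sign \<open>sig\<close>, covers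
  both parities and their sums.\<close>

definition G :: "endo set" where
  "G = {A. (\<forall>x y. A x y \<noteq> 0 \<longrightarrow> x \<in> inds \<and> y \<in> inds) \<and>
     (\<forall>x\<in>inds. \<forall>y\<in>inds. A (st y) (st x) = sig x y * A x y)}"

definition homog :: "nat \<Rightarrow> endo \<Rightarrow> bool" where
  "homog p A \<longleftrightarrow> (\<forall>x y. A x y \<noteq> 0 \<longrightarrow> even (par x + par y + p))"

lemma G_inds: "A \<in> G \<Longrightarrow> A x y \<noteq> 0 \<Longrightarrow> x \<in> inds \<and> y \<in> inds"
  by (auto simp: G_def)

lemma G_st: "A \<in> G \<Longrightarrow> x \<in> inds \<Longrightarrow> y \<in> inds \<Longrightarrow> A (st y) (st x) = sig x y * A x y"
  by (auto simp: G_def)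

text \<open>The form pairs each basis vector with exactly one basis vector, so each of the two sums
  has a single term. Evaluating at \<open>st x\<close> makes one of these terms the entry at
  \<open>(x, y)\<close>.\<close>

lemma osp_cond_iff:
  assumes x: "x \<in> inds" and y: "y \<in> inds" and h: "homog p A"
  shows "(\<Sum>z\<in>inds. A z (st x) * form z y) + (-1) ^ (p * par (st x)) * (\<Sum>z\<in>inds. form (st x) z * A z y) = 0
    \<longleftrightarrow> A (st y) (st x) = sig x y * A x y"
proof -
  \<comment> \<open>Where \<open>A x y\<close> is nonzero, \<open>p\<close> has the parity of
    \<open>par x + par y\<close>; this removes \<open>p\<close> from the sign.\<close>
  have p: "(-1) ^ (p * par x) * A x y = (-1) ^ (par x * (1 + par y)) * A x y"
  proof (cases "A x y = 0")
    case False
    then have "even (par x + par y + p)" using h by (auto simp: homog_def)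
    then show ?thesis using par_less_2[of x] par_less_2[of y] by auto
  qed simp
  have "(\<Sum>z\<in>inds. A z (st x) * form z y) + (-1) ^ (p * par (st x)) * (\<Sum>z\<in>inds. form (st x) z * A z y)
    = A (st y) (st x) * kap (st y) + kap (st x) * ((-1) ^ (p * par x) * A x y)"
    using x y sum_form_right[OF y, of "\<lambda>z. A z (st x)"] sum_form_left[of "st x" "\<lambda>z. A z y"]
    by (simp add: algebra_simps)
  also have "\<dots> = (A (st y) (st x) - sig x y * A x y) * kap (st y)"
    using kap_sq[of "st y"] unfolding p by (simp add: sig_def algebra_simps)
  finally show ?thesis using kap_sq[of "st y"] by auto
qed

lemma osp_part_iff: "A \<in> osp_part p \<longleftrightarrow> A \<in> G \<and> homog p A"
proof -
  have 1: "(\<forall>x\<in>inds. \<forall>y\<in>inds. (\<Sum>z\<in>inds. A z x * form z y) + (-1) ^ (p * par x) * (\<Sum>z\<in>inds. form x z * A z y) = 0)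
    \<longleftrightarrow> (\<forall>x\<in>inds. \<forall>y\<in>inds. (\<Sum>z\<in>inds. A z (st x) * form z y) + (-1) ^ (p * par (st x)) * (\<Sum>z\<in>inds. form (st x) z * A z y) = 0)"
    by (rule ball_st[symmetric])
  show ?thesis
  proof (cases "homog p A")
    case True
    then show ?thesis
      using osp_cond_iff[OF _ _ True] unfolding osp_part_def mem_Collect_eq 1 G_def
      by (auto simp: homog_def)
  next
    case False
    then show ?thesis by (auto simp: osp_part_def homog_def)
  qed
qed

lemma G_add: "A \<in> G \<Longrightarrow> B \<in> G \<Longrightarrow> A + B \<in> G"
  unfolding G_def by (auto simp: algebra_simps) (metis add.right_neutral)+

lemma G_scale: "A \<in> G \<Longrightarrow> scale c A \<in> G"
  unfolding G_def scale_def by auto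

lemma G_0 [simp]: "0 \<in> G"
  by (simp add: G_def)

lemma G_sum: "(\<And>i. i \<in> I \<Longrightarrow> f i \<in> G) \<Longrightarrow> sum f I \<in> G"
  by (induction I rule: infinite_finite_induct) (auto intro: G_add)

lemma part_G:
  assumes "A \<in> G"
  shows "part p A \<in> G"
  unfolding G_def
proof (intro CollectI conjI allI impI ballI)
  fix x y assume "part p A x y \<noteq> 0"
  then have "A x y \<noteq> 0" by (auto simp: Defs.part_def split: if_splits)
  then show "x \<in> inds" "y \<in> inds" using G_inds[OF assms] by blast+
next
  fix x y assume xy: "x \<in> inds" "y \<in> inds"
  have "even (par y + par x + p) \<longleftrightarrow> even (par x + par y + p)" by presburger
  then show "part p A (st y) (st x) = sig x y * part p A x y"
    using G_st[OF assms xy] xy by (simp add: Defs.part_def)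
qed

lemma homog_part: "homog p (part p A)"
  by (simp add: homog_def Defs.part_def)

lemma part_sum: "A = part 0 A + part 1 A"
  by (rule ext)+ (auto simp: Defs.part_def)


lemma g_eq_G: "g = G"
proof
  show "g \<subseteq> G" by (auto simp: g_def osp_part_iff G_add)
  show "G \<subseteq> g"
    unfolding g_def osp_part_iff using part_G homog_part part_sum by blast
qed

text \<open>The parity of a matrix unit is read off its indices, so the superbracket has an
  entrywise formula that avoids the splitting into homogeneous parts.\<close>

lemma bracket_apply:
  "bracket A B x y = (\<Sum>z\<in>inds. A x z * B z y - (-1) ^ ((par x + par z) * (par z + par y)) * (B x z * A z y))"
proof -
  have e: "(\<Sum>p<2. \<Sum>q<2. part p A x z * part q B z y - (-1) ^ (p * q) * (part q B x z * part p A z y))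
     = A x z * B z y - (-1) ^ ((par x + par z) * (par z + par y)) * (B x z * A z y)" for z
    using par_less_2[of x] par_less_2[of z] par_less_2[of y]
    by (auto simp: Defs.part_def lessThan_nat_numeral)
  have "bracket A B x y = (\<Sum>p<2. \<Sum>q<2. \<Sum>z\<in>inds. part p A x z * part q B z y - (-1) ^ (p * q) * (part q B x z * part p A z y))"
    by (simp add: bracket_def sum_fun_apply2 mmult_def scale_def sum_distrib_left sum_subtractf)
  also have "\<dots> = (\<Sum>p<2. \<Sum>z\<in>inds. \<Sum>q<2. part p A x z * part q B z y - (-1) ^ (p * q) * (part q B x z * part p A z y))"
    by (intro sum.cong refl sum.swap)
  also have "\<dots> = (\<Sum>z\<in>inds. \<Sum>p<2. \<Sum>q<2. part p A x z * part q B z y - (-1) ^ (p * q) * (part q B x z * part p A z y))"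
    by (rule sum.swap)
  finally show ?thesis unfolding e .
qed

lemma bracket_nz:
  assumes "bracket A B x y \<noteq> 0"
  obtains z where "z \<in> inds" "A x z \<noteq> 0 \<and> B z y \<noteq> 0 \<or> B x z \<noteq> 0 \<and> A z y \<noteq> 0"
proof (rule ccontr)
  assume "\<not> thesis"
  then have *: "A x z * B z y = 0 \<and> B x z * A z y = 0" if "z \<in> inds" for z
    using that \<open>\<And>z. z \<in> inds \<Longrightarrow> _ \<Longrightarrow> thesis\<close> by auto
  have "bracket A B x y = 0"
    unfolding bracket_apply
  proof (intro sum.neutral ballI)
    fix z assume "z \<in> inds"
    then have 0: "A x z * B z y = 0" "B x z * A z y = 0" using * by blast+
    show "A x z * B z y - (-1) ^ ((par x + par z) * (par z + par y)) * (B x z * A z y) = 0"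
      unfolding 0 by simp
  qed
  then show False using assms by simp
qed

lemma bracket_G:
  assumes A: "A \<in> G" and B: "B \<in> G"
  shows "bracket A B \<in> G"
  unfolding G_def
proof (intro CollectI conjI allI impI ballI)
  fix x y assume "bracket A B x y \<noteq> 0"
  then obtain z where "z \<in> inds" "A x z \<noteq> 0 \<and> B z y \<noteq> 0 \<or> B x z \<noteq> 0 \<and> A z y \<noteq> 0"
    by (rule bracket_nz)
  then show "x \<in> inds" "y \<in> inds" using G_inds A B by blast+
next
  fix x y assume xy: "x \<in> inds" "y \<in> inds"
  \<comment> \<open>Mirroring the indices exchanges the two terms of the bracket. The signs picked
    up by the two factors differ from \<open>- sig x y\<close> exactly by the super sign.\<close>
  have ss: "sig z y * sig x z = - (sig x y * (-1) ^ ((par x + par z) * (par z + par y)))" if "z \<in> inds" for z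
  proof -
    have "sig z y * sig x z = (-1) ^ (par z * (1 + par y)) * (-1) ^ (par x * (1 + par z)) * (kap (st z) * kap (st z))
        * kap (st x) * kap (st y)"
      by (simp add: sig_def algebra_simps)
    also have "\<dots> = (-1) ^ (par x * (1 + par y)) * (-1) ^ ((par x + par z) * (par z + par y)) * kap (st x) * kap (st y)"
      unfolding kap_sq using par_less_2[of x] par_less_2[of z] par_less_2[of y] by auto
    finally show ?thesis by (simp add: sig_def algebra_simps)
  qed
  have "bracket A B (st y) (st x) = (\<Sum>z\<in>inds. A (st y) (st z) * B (st z) (st x) -
      (-1) ^ ((par (st y) + par (st z)) * (par (st z) + par (st x))) * (B (st y) (st z) * A (st z) (st x)))"
    unfolding bracket_apply by (rule sum_inds_st[symmetric])
  also have "\<dots> = (\<Sum>z\<in>inds. sig x y * (A x z * B z y - (-1) ^ ((par x + par z) * (par z + par y)) * (B x z * A z y)))"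
  proof (intro sum.cong refl)
    fix z assume z: "z \<in> inds"
    let ?s = "(-1) ^ ((par x + par z) * (par z + par y)) :: complex"
    have s: "?s * ?s = 1" by (simp flip: power_add mult_2)
    have "A (st y) (st z) * B (st z) (st x) = sig z y * sig x z * (B x z * A z y)"
      "B (st y) (st z) * A (st z) (st x) = sig z y * sig x z * (A x z * B z y)"
      using G_st[OF A] G_st[OF B] xy z by simp_all
    moreover have "(-1) ^ ((par (st y) + par (st z)) * (par (st z) + par (st x))) = ?s"
      using xy z by (simp add: mult.commute add.commute)
    ultimately show "A (st y) (st z) * B (st z) (st x) -
      (-1) ^ ((par (st y) + par (st z)) * (par (st z) + par (st x))) * (B (st y) (st z) * A (st z) (st x))
      = sig x y * (A x z * B z y - ?s * (B x z * A z y))"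
      using s unfolding ss[OF z] by (simp add: algebra_simps)
  qed
  also have "\<dots> = sig x y * bracket A B x y"
    by (simp add: bracket_apply sum_distrib_left)
  finally show "bracket A B (st y) (st x) = sig x y * bracket A B x y" .
qed

lemma homog_bracket:
  assumes "homog p A" "homog q B"
  shows "homog (p + q) (bracket A B)"
  unfolding homog_def
proof (intro allI impI)
  fix x y assume "bracket A B x y \<noteq> 0"
  then obtain z where "A x z \<noteq> 0 \<and> B z y \<noteq> 0 \<or> B x z \<noteq> 0 \<and> A z y \<noteq> 0"
    by (rule bracket_nz)
  then have "even (par x + par z + p) \<and> even (par z + par y + q) \<or> even (par x + par z + q) \<and> even (par z + par y + p)"
    using assms unfolding homog_def by blast
  then show "even (par x + par y + (p + q))" by presburger
qed

text \<open>
  Since \<open>F (st y, st x)\<close> is a multiple of \<open>F (x, y)\<close> and \<open>F (x, st x) = 0\<close> for even \<open>x\<close>, the pairs in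
  \<open>lets\<close> index a basis of the superalgebra.
\<close>

definition F :: "int \<times> int \<Rightarrow> endo" where
  "F b = (case b of (x, y) \<Rightarrow> E x y + scale (sig x y) (E (st y) (st x)))"

definition lets :: "(int \<times> int) set" where
  "lets = {(x, y). x \<in> inds \<and> y \<in> inds \<and> (ht x + ht y > 0 \<or> ht x + ht y = 0 \<and> x < 0)}"

text \<open>For a letter \<open>b\<close> this is the entry of \<open>F b\<close> at
  \<open>b\<close>: at \<open>(x, st x)\<close> the two terms of \<open>F\<close> coincide.\<close>

definition nu :: "int \<times> int \<Rightarrow> complex" where
  "nu b = (if snd b = st (fst b) then 2 else 1)"

definition lpar :: "int \<times> int \<Rightarrow> nat" where
  "lpar b = (if par (fst b) = par (snd b) then 0 else 1)"

lemma lpar_less_2: "lpar b < 2"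
  by (simp add: lpar_def)

lemma lets_inds: "b \<in> lets \<Longrightarrow> fst b \<in> inds \<and> snd b \<in> inds"
  by (auto simp: lets_def)

lemma finite_lets [simp]: "finite lets"
  by (rule finite_subset[of _ "inds \<times> inds"]) (auto simp: lets_def)

lemma F_apply: "F (x, y) u v = of_bool (u = x \<and> v = y) + sig x y * of_bool (u = st y \<and> v = st x)"
  by (simp add: F_def E_def scale_def)

lemma sig_st:
  assumes "x \<in> inds" "y \<in> inds"
  shows "sig (st y) (st x) = sig x y"
proof -
  have "sig (st y) (st x) * (kap (st y) * kap (st y)) * (kap (st x) * kap (st x)) = 
     - ((-1) ^ (par y * (1 + par x)) * (kap x * kap (st x)) * (kap y * kap (st y)) * (kap (st y) * kap (st x)))"
    using assms by (simp add: sig_def)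
  then have "sig (st y) (st x) = - ((-1) ^ (par y * (1 + par x)) * (-1) ^ par x * (-1) ^ par y * (kap (st y) * kap (st x)))"
    using assms by (simp add: kap_sq kap_st)
  then show ?thesis
    using par_less_2[of x] par_less_2[of y] by (auto simp: sig_def)
qed

lemma sig_self: "x \<in> inds \<Longrightarrow> sig x (st x) = - ((-1) ^ par x)"
  using par_less_2[of x] kap_st[of x] by (auto simp: sig_def mult.commute)

lemma F_G: 
  assumes xy: "x \<in> inds" "y \<in> inds"
  shows "F (x, y) \<in> G"
  unfolding G_def
proof (intro CollectI conjI allI impI ballI)
  fix u v assume "F (x, y) u v \<noteq> 0"
  then have "u = x \<and> v = y \<or> u = st y \<and> v = st x"
    by (auto simp: F_apply)
  then show "u \<in> inds" "v \<in> inds" using xy by auto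
next
  fix u v assume uv: "u \<in> inds" "v \<in> inds"
  have 1: "st v = x \<and> st u = y \<longleftrightarrow> u = st y \<and> v = st x"
    using xy uv by (auto simp: st_inject)
  have 2: "st v = st y \<and> st u = st x \<longleftrightarrow> u = x \<and> v = y"
    using xy uv by (auto simp: st_eq_iff)
  consider "u = x \<and> v = y \<and> u = st y \<and> v = st x" | "u = x \<and> v = y \<and> \<not> (u = st y \<and> v = st x)" 
    | "\<not> (u = x \<and> v = y) \<and> u = st y \<and> v = st x" | "\<not> (u = x \<and> v = y) \<and> \<not> (u = st y \<and> v = st x)"
    by blast
  then show "F (x, y) (st v) (st u) = sig u v * F (x, y) u v"
    unfolding F_apply 1 2
    by cases (use sig_sq[of x y] sig_st[OF xy] in \<open>simp_all add: algebra_simps\<close>)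
qed

lemma F_lets_G: "b \<in> lets \<Longrightarrow> F b \<in> G"
  by (cases b) (auto simp: lets_def F_G)

lemma homog_F_inds: "x \<in> inds \<Longrightarrow> y \<in> inds \<Longrightarrow> homog (lpar (x, y)) (F (x, y))"
proof -
  assume xy: "x \<in> inds" "y \<in> inds"
  have "par u + par v = par x + par y" if nz: "F (x, y) u v \<noteq> 0" for u v
  proof -
    have "u = x \<and> v = y \<or> u = st y \<and> v = st x" using nz by (auto simp: F_apply)
    then show ?thesis using xy by auto
  qed
  moreover have "even (par x + par y + lpar (x, y))"
    using par_less_2[of x] par_less_2[of y] by (auto simp: lpar_def)
  ultimately show ?thesis by (simp add: homog_def)
qed

lemma homog_F: "b \<in> lets \<Longrightarrow> homog (lpar b) (F b)"
  using homog_F_inds[of "fst b" "snd b"] lets_inds[of b] by simp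

lemma lets_st: "x \<in> inds \<Longrightarrow> y \<in> inds \<Longrightarrow> (x, y) \<in> lets \<Longrightarrow> (st y, st x) \<in> lets \<Longrightarrow> y = st x"
proof -
  assume a: "x \<in> inds" "y \<in> inds" "(x, y) \<in> lets" "(st y, st x) \<in> lets"
  then have "ht x + ht y = 0" by (auto simp: lets_def)
  then have "ht y = ht (st x)" using a by simp
  then show ?thesis using a by (metis ht_inj st_inds)
qed

lemma lets_even_self: "(x, st x) \<in> lets \<Longrightarrow> par x = 1"
  by (auto simp: lets_def par_def)

text \<open>A pair and its mirror image \<open>(st y, st x)\<close> are both letters only if they
  are equal. Hence the entries at \<open>lets\<close> are coordinates for the basis
  \<open>F\<close>, up to the factor \<open>nu\<close>.\<close>

lemma F_lets_apply:
  assumes "b \<in> lets" "c \<in> lets"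
  shows "F b (fst c) (snd c) = (if b = c then nu b else 0)"
proof -
  obtain x y where b: "b = (x, y)" by (cases b)
  obtain u v where c: "c = (u, v)" by (cases c)
  have i: "x \<in> inds" "y \<in> inds" "u \<in> inds" "v \<in> inds" using assms by (auto simp: b c lets_def)
  consider "u = st y \<and> v = st x" | "\<not> (u = st y \<and> v = st x)" by blast
  then show ?thesis
  proof cases
    case 1
    then have y: "y = st x" using lets_st[of x y] assms i by (auto simp: b c)
    then have "par x = 1" using assms lets_even_self by (auto simp: b)
    then show ?thesis using y 1 i by (auto simp: b c F_apply nu_def sig_self)
  next
    case 2
    have "v \<noteq> st u \<or> u \<noteq> x \<or> v \<noteq> y" using 2 i by auto
    then show ?thesis using 2 i by (auto simp: b c F_apply nu_def)
  qed
qed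

lemma G_expand:
  assumes A: "A \<in> G"
  shows "A = (\<Sum>b\<in>lets. scale (A (fst b) (snd b) / nu b) (F b))"
proof (intro ext)
  fix u v
  let ?c = "\<lambda>b. A (fst b) (snd b) / nu b"
  show "A u v = (\<Sum>b\<in>lets. scale (?c b) (F b)) u v"
  proof (cases "u \<in> inds \<and> v \<in> inds")
    case False
    then have "A u v = 0" using G_inds[OF A] by blast
    moreover have "(\<Sum>b\<in>lets. scale (?c b) (F b)) u v = 0"
      unfolding sum_fun_apply2 scale_apply
      using False G_inds[OF F_lets_G] by (intro sum.neutral ballI) fastforce
    ultimately show ?thesis by simp
  next
    case True
    have in_lets: "(\<Sum>b\<in>lets. scale (?c b) (F b)) u' v' = A u' v'" if "(u', v') \<in> lets" for u' v'
    proof -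
      have "(\<Sum>b\<in>lets. scale (?c b) (F b)) u' v' = (\<Sum>b\<in>lets. if b = (u', v') then A u' v' else 0)"
        unfolding sum_fun_apply2 scale_apply using F_lets_apply[OF _ that]
        by (intro sum.cong) (auto simp: nu_def)
      then show ?thesis using that by simp
    qed
    have S: "(\<Sum>b\<in>lets. scale (?c b) (F b)) \<in> G"
      by (intro G_sum G_scale F_lets_G)
    have st_case: "(\<Sum>b\<in>lets. scale (?c b) (F b)) u v = A u v" if "(st v, st u) \<in> lets"
    proof -
      have "sig u v * (\<Sum>b\<in>lets. scale (?c b) (F b)) u v = sig u v * A u v"
        using in_lets[OF that] G_st[OF A, of u v] G_st[OF S, of u v] True by simp
      moreover have "sig u v \<noteq> 0" using sig_sq[of u v] by auto
      ultimately show ?thesis by simp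
    qed
    show ?thesis
    proof (cases "(u, v) \<in> lets \<or> (st v, st u) \<in> lets")
      case True
      then show ?thesis using in_lets st_case by auto
    next
      case False
      \<comment> \<open>Neither the entry nor its mirror image is a letter. Then
        \<open>v = st u\<close> with \<open>u\<close> even, and the entry is its own mirror image
        with sign -1.\<close>
      then have h: "ht u + ht v = 0" "\<not> u < 0" using True by (auto simp: lets_def)
      then have v: "v = st u" using True ht_inj[of v "st u"] by simp
      have "B u v = 0" if "B \<in> G" for B
        using G_st[OF that, of u v] True h(2) v by (auto simp: sig_self par_def)
      from this[OF A] this[OF S] show ?thesis by simp
    qed
  qed
qed

lemma G_eqI:
  assumes "A \<in> G" "B \<in> G" "\<And>x y. (x, y) \<in> lets \<Longrightarrow> A x y = B x y"
  shows "A = B"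
proof -
  have "(\<Sum>b\<in>lets. scale (A (fst b) (snd b) / nu b) (F b)) = (\<Sum>b\<in>lets. scale (B (fst b) (snd b) / nu b) (F b))"
    using assms(3) by (intro sum.cong) auto
  then show ?thesis using G_expand[OF assms(1)] G_expand[OF assms(2)] by simp
qed

end

section \<open>Triangular decomposition\<close>

context osp
begin

text \<open>The linear functional with value \<open>ht c\<close> at \<open>eps c\<close>. It is
  positive on positive roots, and so translates conditions on roots into comparisons of heights of
  matrix indices.\<close>

definition H :: "weight \<Rightarrow> complex" where
  "H \<mu> = (\<Sum>c\<in>W. of_int (ht c) * \<mu> c)"

lemma H_diff: "H (\<mu> - \<nu>) = H \<mu> - H \<nu>" and H_add: "H (\<mu> + \<nu>) = H \<mu> + H \<nu>"
  and H_uminus: "H (- \<mu>) = - H \<mu>"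
  by (simp_all add: H_def algebra_simps sum.distrib sum_subtractf sum_negf)

lemma H_double: "H (2 * \<mu>) = 2 * H \<mu>"
  by (simp only: mult_2 H_add)

lemma H_eps: "c \<in> W \<Longrightarrow> H (eps c) = of_int (ht c)"
proof -
  assume "c \<in> W"
  have "H (eps c) = (\<Sum>d\<in>W. if d = c then of_int (ht c) else 0)"
    unfolding H_def by (intro sum.cong) (auto simp: eps_def)
  then show ?thesis using \<open>c \<in> W\<close> by simp
qed

lemma inds_cases:
  assumes "x \<in> inds"
  obtains "x \<in> W" | "st x \<in> W" "x \<notin> W" | "ex" "x = 2 * int m + 1"
  using assms by (force simp: inds_def W_def st_def of_bool_def split: if_splits)

lemma wt_W: "x \<in> W \<Longrightarrow> wt x = eps x"
  by (auto simp: wt_def W_def)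

lemma wt_st_W: "x \<in> inds \<Longrightarrow> st x \<in> W \<Longrightarrow> wt x = - eps (st x)"
  by (metis wt_st wt_W st_st st_inds)

lemma wt_mid: "wt (2 * int m + 1) = 0"
  by (simp add: wt_def)

lemma ht_mid: "ht (2 * int m + 1) = 0"
  by (simp add: ht_def)

lemma H_wt:
  assumes x: "x \<in> inds"
  shows "H (wt x) = of_int (ht x)"
proof (rule inds_cases[OF x])
  show "x \<in> W \<Longrightarrow> ?thesis" by (simp add: wt_W H_eps)
  show "x = 2 * int m + 1 \<Longrightarrow> ?thesis" by (simp add: wt_mid ht_mid H_def)
  assume w: "st x \<in> W"
  then have "H (wt x) = - of_int (ht (st x))" using x by (simp add: H_uminus wt_st_W H_eps)
  then show ?thesis using x by simp
qed

lemma sum_W: "(\<Sum>i=1..int n. f (- i)) + (\<Sum>k=1..int m. f k) = (\<Sum>c\<in>W. f c)"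
proof -
  have "x \<in> uminus ` {1..int n}" if "x < 0" "- int n \<le> x" for x
    using that by (intro image_eqI[of _ _ "- x"]) auto
  then have W: "W = uminus ` {1..int n} \<union> {1..int m}" by (force simp: W_def)
  have "(\<Sum>c\<in>W. f c) = (\<Sum>c\<in>uminus ` {1..int n}. f c) + (\<Sum>c=1..int m. f c)"
    unfolding W by (rule sum.union_disjoint) auto
  also have "(\<Sum>c\<in>uminus ` {1..int n}. f c) = (\<Sum>i=1..int n. f (- i))"
    by (subst sum.reindex) (auto simp: inj_on_def)
  finally show ?thesis by (rule sym)
qed

lemma ev_W: "ev \<mu> h = (\<Sum>c\<in>W. \<mu> c * h c c)"
  unfolding ev_def by (rule sum_W)

lemma ev_diff: "ev (\<mu> - \<nu>) h = ev \<mu> h - ev \<nu> h" and ev_add: "ev (\<mu> + \<nu>) h = ev \<mu> h + ev \<nu> h"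
  and ev_uminus: "ev (- \<mu>) h = - ev \<mu> h"
  by (simp_all add: ev_W algebra_simps sum.distrib sum_subtractf sum_negf)

lemma ev_eps: "c \<in> W \<Longrightarrow> ev (eps c) h = h c c"
proof -
  assume "c \<in> W"
  have "ev (eps c) h = (\<Sum>d\<in>W. if d = c then h c c else 0)"
    unfolding ev_W by (intro sum.cong) (auto simp: eps_def)
  then show ?thesis using \<open>c \<in> W\<close> by simp
qed

lemma ev_0 [simp]: "ev 0 h = 0"
  by (simp add: ev_W)

lemma ev_add_right: "ev \<mu> (h + k) = ev \<mu> h + ev \<mu> k"
  and ev_scale_right: "ev \<mu> (scale c h) = c * ev \<mu> h"
  by (simp_all add: ev_W algebra_simps sum.distrib scale_apply sum_distrib_left)

lemma ev_sum_right: "ev \<mu> (sum f I) = (\<Sum>i\<in>I. ev \<mu> (f i))"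
proof -
  have "ev \<mu> 0 = 0" by (simp add: ev_W)
  then show ?thesis
    by (induction I rule: infinite_finite_induct) (simp_all add: ev_add_right)
qed

lemma sig_diag: "sig x x = -1"
proof -
  have "(-1::complex) ^ (par x * (1 + par x)) = 1"
    using par_less_2[of x] by auto
  then show ?thesis using kap_sq[of "st x"] by (simp add: sig_def)
qed

lemma F_diag: "x \<in> W \<Longrightarrow> F (x, x) = E x x - E (st x) (st x)"
  by (intro ext) (simp add: F_def scale_def sig_diag)

lemma st_neg_W: "1 \<le> i \<Longrightarrow> i \<le> int n \<Longrightarrow> st (- i) = - (i + int n)"
  and st_pos_W: "1 \<le> k \<Longrightarrow> k \<le> int m \<Longrightarrow> st k = k + int m"
  by (auto simp: st_def)

lemma cartan_alt: "cartan = range (\<lambda>c. \<Sum>x\<in>W. scale (c x) (F (x, x)))"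
proof -
  have "(\<Sum>i=1..int n. scale (c (- i)) (E (- i) (- i) - E (- (i + int n)) (- (i + int n)))) +
     (\<Sum>k=1..int m. scale (c k) (E k k - E (k + int m) (k + int m))) = (\<Sum>x\<in>W. scale (c x) (F (x, x)))" for c
  proof -
    have "(\<Sum>i=1..int n. scale (c (- i)) (F (- i, - i))) = (\<Sum>i=1..int n. scale (c (- i)) (E (- i) (- i) - E (- (i + int n)) (- (i + int n))))"
      by (intro sum.cong refl) (simp add: F_diag st_neg_W W_def)
    moreover have "(\<Sum>k=1..int m. scale (c k) (F (k, k))) = (\<Sum>k=1..int m. scale (c k) (E k k - E (k + int m) (k + int m)))"
      by (intro sum.cong refl) (simp add: F_diag st_pos_W W_def)
    ultimately show ?thesis using sum_W[of "\<lambda>x. scale (c x) (F (x, x))"] by simp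
  qed
  then show ?thesis by (simp add: cartan_def)
qed

lemma diag_lets_iff: "(x, x) \<in> lets \<longleftrightarrow> x \<in> W"
  using ht_pos_iff[of x] ht_eq_0[of x] W_subset_inds by (auto simp: lets_def)

lemma F_support: "b \<in> lets \<Longrightarrow> F b u v \<noteq> 0 \<Longrightarrow> (u, v) = b \<or> (u, v) = (st (snd b), st (fst b))"
  by (cases b) (auto simp: F_apply)

lemma cartan_eq: "cartan = {A \<in> G. \<forall>x y. A x y \<noteq> 0 \<longrightarrow> x = y}"
proof
  show "cartan \<subseteq> {A \<in> G. \<forall>x y. A x y \<noteq> 0 \<longrightarrow> x = y}"
  proof
    fix A assume "A \<in> cartan"
    then obtain c where A: "A = (\<Sum>x\<in>W. scale (c x) (F (x, x)))" by (auto simp: cartan_alt)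
    have "A \<in> G" unfolding A by (intro G_sum G_scale F_lets_G) (simp add: diag_lets_iff)
    moreover have "A x y = 0" if "x \<noteq> y" for x y
      unfolding A sum_fun_apply2 scale_apply using that by (intro sum.neutral) (auto simp: F_apply)
    ultimately show "A \<in> {A \<in> G. \<forall>x y. A x y \<noteq> 0 \<longrightarrow> x = y}" by blast
  qed
  show "{A \<in> G. \<forall>x y. A x y \<noteq> 0 \<longrightarrow> x = y} \<subseteq> cartan"
  proof safe
    fix A assume A: "A \<in> G" and d: "\<forall>x y. A x y \<noteq> 0 \<longrightarrow> x = y"
    have "A = (\<Sum>b\<in>lets. scale (A (fst b) (snd b) / nu b) (F b))" by (rule G_expand[OF A])
    also have "\<dots> = (\<Sum>b\<in>(\<lambda>x. (x, x)) ` W. scale (A (fst b) (snd b) / nu b) (F b))"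
    proof (rule sum.mono_neutral_right)
      show "\<forall>b\<in>lets - (\<lambda>x. (x, x)) ` W. scale (A (fst b) (snd b) / nu b) (F b) = 0"
      proof
        fix b assume b: "b \<in> lets - (\<lambda>x. (x, x)) ` W"
        have "fst b \<noteq> snd b"
          using b by (cases b) (auto simp: diag_lets_iff)
        then have "A (fst b) (snd b) = 0" using d by blast
        then show "scale (A (fst b) (snd b) / nu b) (F b) = 0" by (simp add: scale_def fun_eq_iff)
      qed
    qed (auto simp: diag_lets_iff)
    also have "\<dots> = (\<Sum>x\<in>W. scale (A x x / nu (x, x)) (F (x, x)))"
      by (subst sum.reindex) (auto simp: inj_on_def)
    finally show "A \<in> cartan" unfolding cartan_alt by (intro range_eqI[of _ _ "\<lambda>x. A x x / nu (x, x)"]) auto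
  qed
qed

lemma cartan_diag:
  assumes h: "h \<in> cartan" and x: "x \<in> inds"
  shows "h x x = ev (wt x) h"
proof -
  have hG: "h \<in> G" using h by (simp add: cartan_eq)
  have s: "h (st y) (st y) = - h y y" if "y \<in> inds" for y
    using G_st[OF hG that that] by (simp add: sig_diag)
  show ?thesis
  proof (rule inds_cases[OF x])
    show "x \<in> W \<Longrightarrow> ?thesis" by (simp add: wt_W ev_eps)
    \<comment> \<open>\<open>st\<close> fixes the middle index, so this diagonal entry is its own
      negative.\<close>
    show "x = 2 * int m + 1 \<Longrightarrow> ?thesis" using s[OF x] by (simp add: wt_mid st_def)
    assume w: "st x \<in> W"
    then show ?thesis using s[OF x] x by (simp add: ev_uminus wt_st_W ev_eps)
  qed
qed

lemma bracket_cartan: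
  assumes h: "h \<in> cartan" and A: "A \<in> G"
  shows "bracket h A x y = ev (wt x - wt y) h * A x y"
proof (cases "A x y = 0")
  case False
  then have xy: "x \<in> inds" "y \<in> inds" using G_inds[OF A] by auto
  have d: "h u v = (if u = v then h u u else 0)" for u v using h by (auto simp: cartan_eq)
  have "bracket h A x y = (\<Sum>z\<in>inds. (if z = x then h x x * A x y else 0) - (if z = y then h y y * A x y else 0))"
    unfolding bracket_apply
  proof (intro sum.cong refl)
    fix z
    have pw: "(-1::complex) ^ ((k + k) * l) = 1" "(-1::complex) ^ (l * (k + k)) = 1" for k l :: nat
      by (simp_all flip: mult_2)
    show "h x z * A z y - (-1) ^ ((par x + par z) * (par z + par y)) * (A x z * h z y) =
       (if z = x then h x x * A x y else 0) - (if z = y then h y y * A x y else 0)"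
      unfolding d[of x z] d[of z y] using pw by auto
  qed
  also have "\<dots> = (h x x - h y y) * A x y"
    using xy by (simp add: sum_subtractf algebra_simps)
  finally show ?thesis using cartan_diag[OF h] xy by (simp add: ev_diff)
next
  case True
  have d: "h u v = 0" if "u \<noteq> v" for u v using h that by (auto simp: cartan_eq)
  have "bracket h A x y = 0"
    unfolding bracket_apply
  proof (intro sum.neutral ballI)
    fix z 
    have t1: "h x z * A z y = 0" using True d[of x z] by (cases "z = x") auto
    have t2: "A x z * h z y = 0" using True d[of z y] by (cases "z = y") auto
    show "h x z * A z y - (-1) ^ ((par x + par z) * (par z + par y)) * (A x z * h z y) = 0"
      unfolding t1 t2 by simp
  qed
  then show ?thesis using True by simp
qed

lemma F_diag_cartan: "c \<in> W \<Longrightarrow> F (c, c) \<in> cartan"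
  using F_lets_G[of "(c, c)"] by (auto simp: cartan_eq diag_lets_iff F_apply)

lemma F_diag_apply: "c \<in> W \<Longrightarrow> d \<in> W \<Longrightarrow> F (c, c) d d = of_bool (d = c)"
  by (auto simp: F_diag E_def st_def W_def)

lemma ev_F_diag: "c \<in> W \<Longrightarrow> ev \<mu> (F (c, c)) = \<mu> c"
proof -
  assume c: "c \<in> W"
  have "ev \<mu> (F (c, c)) = (\<Sum>d\<in>W. if d = c then \<mu> c else 0)"
    unfolding ev_W by (intro sum.cong) (auto simp: F_diag_apply c)
  then show ?thesis using c by simp
qed

text \<open>\<open>F (c, c)\<close> is the element of the Cartan subalgebra dual to
  \<open>eps c\<close>, and testing with these elements is enough. Weights are compared on
  \<open>W\<close> only, since their values elsewhere carry no meaning.\<close>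

lemma root_space_iff:
  "A \<in> root_space \<alpha> \<longleftrightarrow> A \<in> G \<and> (\<forall>x y. A x y \<noteq> 0 \<longrightarrow> (\<forall>c\<in>W. wt x c - wt y c = \<alpha> c))"
proof safe
  assume A: "A \<in> root_space \<alpha>"
  then show AG: "A \<in> G" by (simp add: root_space_def g_eq_G)
  fix x y c assume nz: "A x y \<noteq> 0" and c: "c \<in> W"
  have "bracket (F (c, c)) A x y = scale (ev \<alpha> (F (c, c))) A x y"
    using A F_diag_cartan[OF c] by (simp add: root_space_def)
  then have "ev (wt x - wt y) (F (c, c)) * A x y = ev \<alpha> (F (c, c)) * A x y"
    using bracket_cartan[OF F_diag_cartan[OF c] AG] by (simp add: scale_apply)
  then show "wt x c - wt y c = \<alpha> c"
    using nz by (simp add: ev_F_diag c)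
next
  assume AG: "A \<in> G" and r: "\<forall>x y. A x y \<noteq> 0 \<longrightarrow> (\<forall>c\<in>W. wt x c - wt y c = \<alpha> c)"
  have "bracket h A = scale (ev \<alpha> h) A" if h: "h \<in> cartan" for h
  proof (intro ext)
    fix x y
    have "ev (wt x - wt y) h = ev \<alpha> h" if "A x y \<noteq> 0"
      unfolding ev_W using r that by (intro sum.cong) auto
    then show "bracket h A x y = scale (ev \<alpha> h) A x y"
      unfolding bracket_cartan[OF h AG] scale_apply by fastforce
  qed
  then show "A \<in> root_space \<alpha>" using AG by (simp add: root_space_def g_eq_G)
qed

text \<open>An abstract support condition \<open>Q\<close> lets \<open>n_pos\<close> and
  \<open>n_neg\<close> be instances of one argument. The exception for \<open>y = st x\<close>
  reflects that twice an \<open>eps k\<close> with \<open>k > 0\<close> is not a root: the entry at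
  \<open>(x, st x)\<close> vanishes for even \<open>x\<close>.\<close>

lemma root_spaces_sum_eq:
  assumes fin: "finite R"
    and R: "\<And>\<alpha> x y. \<alpha> \<in> R \<Longrightarrow> x \<in> inds \<Longrightarrow> y \<in> inds \<Longrightarrow> \<forall>c\<in>W. wt x c - wt y c = \<alpha> c \<Longrightarrow> Q x y"
    and Q: "\<And>x y. x \<in> inds \<Longrightarrow> y \<in> inds \<Longrightarrow> Q x y \<Longrightarrow> (y = st x \<Longrightarrow> par x = 1) \<Longrightarrow> wt x - wt y \<in> R"
  shows "root_spaces_sum R = {A \<in> G. \<forall>x y. A x y \<noteq> 0 \<longrightarrow> Q x y}"
proof
  show "root_spaces_sum R \<subseteq> {A \<in> G. \<forall>x y. A x y \<noteq> 0 \<longrightarrow> Q x y}"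
  proof
    fix A assume "A \<in> root_spaces_sum R"
    then obtain f where f: "A = (\<Sum>\<alpha>\<in>R. f \<alpha>)" "\<And>\<alpha>. \<alpha> \<in> R \<Longrightarrow> f \<alpha> \<in> root_space \<alpha>"
      by (auto simp: root_spaces_sum_def)
    have AG: "A \<in> G" unfolding f(1) using f(2) by (intro G_sum) (auto simp: root_space_iff)
    have "Q x y" if "A x y \<noteq> 0" for x y
    proof -
      have "\<exists>\<alpha>\<in>R. f \<alpha> x y \<noteq> 0" using that unfolding f(1) sum_fun_apply2 by (metis sum.neutral)
      then obtain \<alpha> where \<alpha>: "\<alpha> \<in> R" "f \<alpha> x y \<noteq> 0" by blast
      then show ?thesis using R[OF \<alpha>(1)] f(2)[OF \<alpha>(1)] G_inds[OF AG that] by (auto simp: root_space_iff)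
    qed
    then show "A \<in> {A \<in> G. \<forall>x y. A x y \<noteq> 0 \<longrightarrow> Q x y}" using AG by blast
  qed
  show "{A \<in> G. \<forall>x y. A x y \<noteq> 0 \<longrightarrow> Q x y} \<subseteq> root_spaces_sum R"
  proof safe
    fix A assume AG: "A \<in> G" and AQ: "\<forall>x y. A x y \<noteq> 0 \<longrightarrow> Q x y"
    \<comment> \<open>The part of weight \<alpha>. Mirroring an entry does not change
      \<open>wt x - wt y\<close>, so this part stays in \<open>G\<close>.\<close>
    define f :: "weight \<Rightarrow> endo" where "f \<alpha> = (\<lambda>x y. if wt x - wt y = \<alpha> then A x y else 0)" for \<alpha>
    have fG: "f \<alpha> \<in> G" for \<alpha>
      unfolding G_def
    proof (intro CollectI conjI allI impI ballI)
      fix x y assume "f \<alpha> x y \<noteq> 0"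
      then have "A x y \<noteq> 0" by (auto simp: f_def split: if_splits)
      then show "x \<in> inds" "y \<in> inds" using G_inds[OF AG] by blast+
    next
      fix x y assume "x \<in> inds" "y \<in> inds"
      then show "f \<alpha> (st y) (st x) = sig x y * f \<alpha> x y"
        using G_st[OF AG] by (simp add: f_def)
    qed
    have "f \<alpha> \<in> root_space \<alpha>" for \<alpha>
      using fG by (auto simp: root_space_iff f_def)
    moreover have "A = (\<Sum>\<alpha>\<in>R. f \<alpha>)"
    proof (intro ext)
      fix x y
      have "(\<Sum>\<alpha>\<in>R. f \<alpha>) x y = (if wt x - wt y \<in> R then A x y else 0)"
        unfolding sum_fun_apply2 f_def using fin by (simp add: sum.delta')
      moreover have "wt x - wt y \<in> R" if nz: "A x y \<noteq> 0"
      proof (rule Q)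
        show xy: "x \<in> inds" "y \<in> inds" using G_inds[OF AG nz] by auto
        show "Q x y" using AQ nz by blast
        show "par x = 1" if "y = st x"
        proof (rule ccontr)
          assume "par x \<noteq> 1"
          then have "sig x y = -1" using that xy par_less_2[of x] by (auto simp: sig_self)
          then show False using G_st[OF AG xy] nz that xy by simp
        qed
      qed
      ultimately show "A x y = (\<Sum>\<alpha>\<in>R. f \<alpha>) x y" by auto
    qed
    ultimately show "A \<in> root_spaces_sum R" by (auto simp: root_spaces_sum_def)
  qed
qed

section \<open>Enumeration of the positive roots by pairs of indices\<close>

definition even_pairs :: "(int \<times> int) set" where
  "even_pairs = {(a, b). a \<in> W \<and> b \<in> W \<and> a < b \<and> (b < 0 \<or> 0 < a)}"

definition odd_pairs :: "(int \<times> int) set" where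
  "odd_pairs = {- int n .. -1} \<times> {1 .. int m}"

text \<open>Each pair stands for two roots, a difference and a sum. As \<delta> with index
  \<open>i\<close> is \<open>eps (- i)\<close>, the single condition \<open>a < b\<close> expresses
  \<open>i > j\<close> among the \<delta> and \<open>k < l\<close> among the \<epsilon>.\<close>

lemma even_pos_roots_pairs: "even_pos_roots =
  (\<lambda>(a, b). eps a - eps b) ` even_pairs \<union> (\<lambda>(a, b). eps a + eps b) ` (even_pairs \<union> (\<lambda>a. (a, a)) ` {- int n .. -1})
   \<union> eps ` {k. ex \<and> 1 \<le> k \<and> k \<le> int m}" (is "_ = ?R")
proof
  show "even_pos_roots \<subseteq> ?R"
    unfolding even_pos_roots_def
  proof (intro Un_least subsetI; elim CollectE exE conjE)
    fix \<alpha> i j assume "\<alpha> = delta i - delta j" "1 \<le> j" "j < i" "i \<le> int n"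
    then show "\<alpha> \<in> ?R" by (intro UnI1 image_eqI[of _ _ "(- i, - j)"]) (auto simp: even_pairs_def W_def)
  next
    fix \<alpha> i j assume "\<alpha> = delta i + delta j" "1 \<le> j" "j < i" "i \<le> int n"
    then show "\<alpha> \<in> ?R" by (intro UnI1[OF UnI2] image_eqI[of _ _ "(- i, - j)"]) (auto simp: even_pairs_def W_def)
  next
    fix \<alpha> i assume "\<alpha> = delta i + delta i" "1 \<le> i" "i \<le> int n"
    then show "\<alpha> \<in> ?R" by (intro UnI1[OF UnI2] image_eqI[of _ _ "(- i, - i)"]) auto
  next
    fix \<alpha> k l assume "\<alpha> = eps k - eps l" "1 \<le> k" "k < l" "l \<le> int m"
    then show "\<alpha> \<in> ?R" by (intro UnI1 image_eqI[of _ _ "(k, l)"]) (auto simp: even_pairs_def W_def)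
  next
    fix \<alpha> k l assume "\<alpha> = eps k + eps l" "1 \<le> k" "k < l" "l \<le> int m"
    then show "\<alpha> \<in> ?R" by (intro UnI1[OF UnI2] image_eqI[of _ _ "(k, l)"]) (auto simp: even_pairs_def W_def)
  qed auto
  have D: "eps a - eps b \<in> even_pos_roots" and S: "eps a + eps b \<in> even_pos_roots" if ab: "(a, b) \<in> even_pairs" for a b
  proof -
    consider "1 \<le> - b \<and> - b < - a \<and> - a \<le> int n" | "1 \<le> a \<and> a < b \<and> b \<le> int m"
      using ab by (force simp: even_pairs_def W_def)
    then have "eps a - eps b \<in> even_pos_roots \<and> eps a + eps b \<in> even_pos_roots"
    proof cases
      case 1
      have "eps a - eps b = delta (- a) - delta (- b)" "eps a + eps b = delta (- a) + delta (- b)" by simp_all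
      then show ?thesis using 1 unfolding even_pos_roots_def by blast
    next
      case 2
      then show ?thesis unfolding even_pos_roots_def by blast
    qed
    then show "eps a - eps b \<in> even_pos_roots" "eps a + eps b \<in> even_pos_roots" by auto
  qed
  have T: "eps a + eps a \<in> even_pos_roots" if "a \<in> {- int n .. -1}" for a
  proof -
    have "eps a + eps a = delta (- a) + delta (- a)" "1 \<le> - a \<and> - a \<le> int n" using that by auto
    then show ?thesis unfolding even_pos_roots_def by blast
  qed
  have "eps k \<in> even_pos_roots" if "ex \<and> 1 \<le> k \<and> k \<le> int m" for k
    using that unfolding even_pos_roots_def by blast
  then show "?R \<subseteq> even_pos_roots" using D S T by (intro Un_least) (auto simp del: One_nat_def)
qed

lemma odd_pos_roots_pairs: "odd_pos_roots =
  (\<lambda>(a, b). eps a - eps b) ` odd_pairs \<union> (\<lambda>(a, b). eps a + eps b) ` odd_pairs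
   \<union> eps ` {a. ex \<and> - int n \<le> a \<and> a \<le> -1}" (is "_ = ?R")
proof
  show "odd_pos_roots \<subseteq> ?R"
    unfolding odd_pos_roots_def
  proof (intro Un_least subsetI; elim CollectE exE conjE)
    fix \<alpha> i k assume "\<alpha> = delta i - eps k" "1 \<le> i" "i \<le> int n" "1 \<le> k" "k \<le> int m"
    then show "\<alpha> \<in> ?R" by (intro UnI1 image_eqI[of _ _ "(- i, k)"]) (auto simp: odd_pairs_def)
  next
    fix \<alpha> i k assume "\<alpha> = delta i + eps k" "1 \<le> i" "i \<le> int n" "1 \<le> k" "k \<le> int m"
    then show "\<alpha> \<in> ?R" by (intro UnI1[OF UnI2] image_eqI[of _ _ "(- i, k)"]) (auto simp: odd_pairs_def)
  next
    fix \<alpha> i assume "\<alpha> = delta i" "ex" "1 \<le> i" "i \<le> int n"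
    then show "\<alpha> \<in> ?R" by (intro UnI2 image_eqI[of _ _ "- i"]) auto
  qed
  have D: "eps a - eps b \<in> odd_pos_roots \<and> eps a + eps b \<in> odd_pos_roots" if "(a, b) \<in> odd_pairs" for a b
  proof -
    have "eps a - eps b = delta (- a) - eps b" "eps a + eps b = delta (- a) + eps b"
      "1 \<le> - a \<and> - a \<le> int n \<and> 1 \<le> b \<and> b \<le> int m" using that by (auto simp: odd_pairs_def)
    then show ?thesis unfolding odd_pos_roots_def by blast
  qed
  have "eps a \<in> odd_pos_roots" if "ex \<and> - int n \<le> a \<and> a \<le> -1" for a
  proof -
    have "eps a = delta (- a)" "ex \<and> 1 \<le> - a \<and> - a \<le> int n" using that by auto
    then show ?thesis unfolding odd_pos_roots_def by blast
  qed
  then show "?R \<subseteq> odd_pos_roots" using D by (intro Un_least) auto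
qed

lemma finite_even_pairs: "finite even_pairs"
  by (rule finite_subset[of _ "W \<times> W"]) (auto simp: even_pairs_def)

lemma finite_pos_roots: "finite even_pos_roots" "finite odd_pos_roots"
proof -
  have "finite {k. ex \<and> 1 \<le> k \<and> k \<le> int m}" "finite {a. ex \<and> - int n \<le> a \<and> a \<le> -1}"
    by (rule finite_subset[of _ "{1..int m}"] finite_subset[of _ "{- int n..-1}"]; auto)+
  then show "finite even_pos_roots" "finite odd_pos_roots"
    by (simp_all add: even_pos_roots_pairs odd_pos_roots_pairs finite_even_pairs odd_pairs_def)
qed

lemma ht_neg: "1 \<le> i \<Longrightarrow> i \<le> int n \<Longrightarrow> ht (- i) = int m + i"
  and ht_pos: "1 \<le> k \<Longrightarrow> k \<le> int m \<Longrightarrow> ht k = int m + 1 - k"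
  by (auto simp: ht_def)

lemma H_delta: "1 \<le> i \<Longrightarrow> i \<le> int n \<Longrightarrow> H (delta i) = of_int (int m + i)"
  and H_eps': "1 \<le> k \<Longrightarrow> k \<le> int m \<Longrightarrow> H (eps k) = of_int (int m + 1 - k)"
  using ht_neg ht_pos by (auto simp: H_eps W_def)

lemma Re_H_pos_roots: "\<alpha> \<in> pos_roots \<Longrightarrow> Re (H \<alpha>) > 0"
  unfolding pos_roots_def even_pos_roots_def odd_pos_roots_def
  by (elim UnE CollectE exE conjE; simp add: H_diff H_add H_double H_delta H_eps')

lemma H_wt_diff:
  assumes "x \<in> inds" "y \<in> inds" "\<forall>c\<in>W. wt x c - wt y c = \<alpha> c"
  shows "H \<alpha> = of_int (ht x - ht y)"
proof -
  have "H \<alpha> = H (wt x - wt y)" unfolding H_def using assms by (intro sum.cong) auto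
  then show ?thesis using assms by (simp add: H_diff H_wt)
qed

lemma pair_cases: "x \<in> W \<Longrightarrow> y \<in> W \<Longrightarrow> x < y \<Longrightarrow> (x, y) \<in> even_pairs \<union> odd_pairs"
  by (auto simp: even_pairs_def odd_pairs_def W_def)

lemma diff_pos_root: "x \<in> W \<Longrightarrow> y \<in> W \<Longrightarrow> x < y \<Longrightarrow> eps x - eps y \<in> pos_roots"
proof -
  assume "x \<in> W" "y \<in> W" "x < y"
  from pair_cases[OF this] have "eps x - eps y \<in> (\<lambda>(a, b). eps a - eps b) ` (even_pairs \<union> odd_pairs)"
    by (intro image_eqI[of _ _ "(x, y)"]) auto
  then show ?thesis unfolding pos_roots_def even_pos_roots_pairs odd_pos_roots_pairs image_Un by blast
qed

lemma add_pos_root: "x \<in> W \<Longrightarrow> y \<in> W \<Longrightarrow> (x = y \<Longrightarrow> x < 0) \<Longrightarrow> eps x + eps y \<in> pos_roots"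
proof (induction x y rule: linorder_wlog)
  case (le x y)
  have "(x, y) \<in> even_pairs \<union> (\<lambda>a. (a, a)) ` {- int n .. -1} \<union> odd_pairs"
    using le pair_cases[of x y] by (cases "x = y") (auto simp: W_def)
  then have "eps x + eps y \<in> (\<lambda>(a, b). eps a + eps b) ` (even_pairs \<union> (\<lambda>a. (a, a)) ` {- int n .. -1} \<union> odd_pairs)"
    by (intro image_eqI[of _ _ "(x, y)"]) auto
  then show ?case
    unfolding pos_roots_def even_pos_roots_pairs odd_pos_roots_pairs image_Un by blast
next
  case (sym x y)
  then show ?case by (simp add: add.commute)
qed

lemma eps_pos_root: "ex \<Longrightarrow> x \<in> W \<Longrightarrow> eps x \<in> pos_roots"
proof -
  assume "ex" "x \<in> W"
  then have "eps x \<in> eps ` {k. ex \<and> 1 \<le> k \<and> k \<le> int m} \<union> eps ` {a. ex \<and> - int n \<le> a \<and> a \<le> -1}"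
    by (force simp: W_def)
  then show ?thesis unfolding pos_roots_def even_pos_roots_pairs odd_pos_roots_pairs by blast
qed

lemma ht_W_less: "x \<in> W \<Longrightarrow> y \<in> W \<Longrightarrow> ht x < ht y \<longleftrightarrow> y < x"
  by (auto simp: W_def ht_def)

text \<open>A converse of \<open>Re_H_pos_roots\<close> for the weights of matrix entries: a drop in
  height already makes the difference of weights a positive root, apart from the twofold
  \<open>eps k\<close> excluded by \<open>st\<close>.\<close>

lemma wt_diff_pos_root:
  assumes xy: "x \<in> inds" "y \<in> inds" and ht: "ht x > ht y" and st: "y = st x \<Longrightarrow> par x = 1"
  shows "wt x - wt y \<in> pos_roots"
proof -
  have pos: "ht z > 0" if "z \<in> W" for z using ht_pos_iff that W_subset_inds by blast
  show ?thesis
  proof (rule inds_cases[OF xy(1)])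
    assume x: "x \<in> W"
    show ?thesis
    proof (rule inds_cases[OF xy(2)])
      assume "y \<in> W"
      then show ?thesis using x ht diff_pos_root[of x y] ht_W_less[of y x] by (simp add: wt_W)
    next
      assume y: "st y \<in> W"
      have "x = st y \<Longrightarrow> x < 0" using st xy by (auto simp: par_def split: if_splits)
      then show ?thesis using add_pos_root[OF x y] x y xy by (simp add: wt_W wt_st_W)
    next
      assume y: "ex" "y = 2 * int m + 1"
      have "wt x - wt y = eps x" using x y(2) by (simp add: wt_mid wt_W)
      then show ?thesis using eps_pos_root[OF y(1) x] by (simp only:)
    qed
  next
    assume x: "st x \<in> W"
    then have hx: "ht x < 0" using pos[OF x] xy by simp
    show ?thesis
    proof (rule inds_cases[OF xy(2)])
      assume "y \<in> W"
      then show ?thesis using pos[of y] hx ht by linarith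
    next
      assume y: "st y \<in> W"
      have "ht (st x) < ht (st y)" using ht xy by simp
      then show ?thesis using x y diff_pos_root[of "st y" "st x"] ht_W_less[of "st x" "st y"] xy by (simp add: wt_st_W)
    next
      assume "y = 2 * int m + 1"
      then show ?thesis using hx ht by (simp add: ht_mid)
    qed
  next
    assume x: "ex" "x = 2 * int m + 1"
    show ?thesis
    proof (rule inds_cases[OF xy(2)])
      assume "y \<in> W"
      then show ?thesis using pos[of y] ht x by (simp add: ht_mid)
    next
      assume y: "st y \<in> W"
      have "wt x - wt y = eps (st y)" using x(2) xy y by (simp add: wt_mid wt_st_W)
      then show ?thesis using eps_pos_root[OF x(1) y] by (simp only:)
    next
      assume "y = 2 * int m + 1"
      then show ?thesis using ht x by simp
    qed
  qed
qed

text \<open>Roots disappear at this point: the positive part is strict triangularity with respect to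
  \<open>ht\<close>, a condition that products and brackets respect visibly.\<close>

lemma n_pos_eq: "n_pos = {A \<in> G. \<forall>x y. A x y \<noteq> 0 \<longrightarrow> ht x > ht y}"
  unfolding n_pos_def
proof (rule root_spaces_sum_eq)
  show "finite pos_roots" by (simp add: pos_roots_def finite_pos_roots)
  fix x y assume xy: "x \<in> inds" "y \<in> inds"
  show "ht x > ht y" if "\<alpha> \<in> pos_roots" "\<forall>c\<in>W. wt x c - wt y c = \<alpha> c" for \<alpha>
    using Re_H_pos_roots[OF that(1)] H_wt_diff[OF xy that(2)] by simp
  show "wt x - wt y \<in> pos_roots" if "ht x > ht y" "y = st x \<Longrightarrow> par x = 1"
    using wt_diff_pos_root[OF xy that] .
qed

lemma n_neg_eq: "n_neg = {A \<in> G. \<forall>x y. A x y \<noteq> 0 \<longrightarrow> ht x < ht y}"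
  unfolding n_neg_def
proof (rule root_spaces_sum_eq)
  show "finite (uminus ` pos_roots)" by (simp add: pos_roots_def finite_pos_roots)
  fix x y assume xy: "x \<in> inds" "y \<in> inds"
  show "ht x < ht y" if a: "\<alpha> \<in> uminus ` pos_roots" and b: "\<forall>c\<in>W. wt x c - wt y c = \<alpha> c" for \<alpha>
  proof -
    obtain \<beta> where \<beta>: "\<beta> \<in> pos_roots" "\<alpha> = - \<beta>" using a by (elim imageE)
    then have "\<forall>c\<in>W. wt y c - wt x c = \<beta> c" using b by (auto simp: algebra_simps)
    then show ?thesis using Re_H_pos_roots[OF \<beta>(1)] H_wt_diff[OF xy(2,1)] by simp
  qed
  show "wt x - wt y \<in> uminus ` pos_roots" if ht: "ht x < ht y" and st: "y = st x \<Longrightarrow> par x = 1"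
  proof -
    have "wt y - wt x \<in> pos_roots"
      using wt_diff_pos_root[OF xy(2,1) ht] st xy by (metis par_st st_st)
    then show ?thesis by (intro image_eqI[of _ _ "wt y - wt x"]) auto
  qed
qed

end

section \<open>Tensor powers of the endomorphism algebra\<close>

text \<open>All tensor powers at once: the values at lists of length \<open>r\<close> are the
  entries of the component in the \<open>r\<close>-th power. Splitting off a factor therefore does
  not change the type.\<close>

type_synonym tens = "(int \<times> int) list \<Rightarrow> complex"

global_interpretation TS: vector_space "\<lambda>(c::complex) (f :: tens) ps. c * f ps"
  by standard (auto simp: algebra_simps)

lemma sum_tens_apply: "(\<Sum>i\<in>I. f i) ps = (\<Sum>i\<in>I. f i ps)" for f :: "'i \<Rightarrow> tens"
  by (induction I rule: infinite_finite_induct) auto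

text \<open>The sign for moving \<open>A\<close> past a factor of parity \<open>k\<close>, taken
  entrywise so that \<open>A\<close> may be inhomogeneous.\<close>

definition tw :: "nat \<Rightarrow> endo \<Rightarrow> endo" where
  "tw k A = (\<lambda>x y. (-1) ^ ((par x + par y) * k) * A x y)"

lemma tw_add: "tw k (A + B) = tw k A + tw k B"
  and tw_scale: "tw k (scale c A) = scale c (tw k A)"
  by (auto simp: tw_def scale_def fun_eq_iff algebra_simps)

context osp
begin

text \<open>
  The action of an endomorphism on a tensor power of the space of endomorphisms of the superspace,
  by left multiplication in each factor. A tensor is given by its matrix entries: the list
  \<open>[(i\<^sub>1, j\<^sub>1), \<dots>]\<close> selects the entry \<open>(i\<^sub>1, j\<^sub>1)\<close> in the first factor, and so on.
\<close>

fun racts :: "endo \<Rightarrow> tens \<Rightarrow> tens" where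
  "racts A f [] = 0"
| "racts A f (q # ps) = (\<Sum>z\<in>inds. A (fst q) z * f ((z, snd q) # ps))
     + racts (tw (par (fst q) + par (snd q)) A) (\<lambda>qs. f (q # qs)) ps"

lemma racts_add_left: "racts (A + B) f ps = racts A f ps + racts B f ps"
  by (induction ps arbitrary: A B f) (simp_all add: tw_add algebra_simps sum.distrib)

lemma racts_scale_left: "racts (scale c A) f ps = c * racts A f ps"
  by (induction ps arbitrary: A f) (simp_all add: tw_scale algebra_simps scale_apply sum_distrib_left)

lemma racts_add: "racts A (f + h) ps = racts A f ps + racts A h ps"
proof (induction ps arbitrary: A f h)
  case (Cons q ps)
  have "(\<lambda>qs. (f + h) (q # qs)) = (\<lambda>qs. f (q # qs)) + (\<lambda>qs. h (q # qs))" by auto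
  then show ?case by (simp add: Cons algebra_simps sum.distrib)
qed simp

lemma racts_scale: "racts A (\<lambda>ps. c * f ps) ps = c * racts A f ps"
  by (induction ps arbitrary: A f) (simp_all add: algebra_simps sum_distrib_left)

lemma racts_zero: "racts A (\<lambda>ps. 0) ps = 0"
  using racts_scale[of A 0 "\<lambda>_. 0" ps] by simp

lemma racts_sum: "racts A (\<lambda>qs. \<Sum>i\<in>I. c i * f i qs) ps = (\<Sum>i\<in>I. c i * racts A (f i) ps)"
proof (induction I rule: infinite_finite_induct)
  case (insert x I)
  have "(\<lambda>qs. \<Sum>i\<in>insert x I. c i * f i qs) = (\<lambda>qs. c x * f x qs) + (\<lambda>qs. \<Sum>i\<in>I. c i * f i qs)"
    using insert by auto
  then show ?case using insert by (simp add: racts_add racts_scale)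
qed (simp_all add: racts_zero)

lemma tw_homog: "homog p A \<Longrightarrow> tw k A = scale ((-1) ^ (p * k)) A"
proof (intro ext)
  fix x y assume h: "homog p A"
  show "tw k A x y = scale ((-1) ^ (p * k)) A x y"
  proof (cases "A x y = 0")
    case False
    then have "even (par x + par y + p)" using h by (auto simp: homog_def)
    then have "even (par x + par y) \<longleftrightarrow> even p" by simp
    then have "(-1::complex) ^ ((par x + par y) * k) = (-1) ^ (p * k)"
      by (simp add: minus_one_power_iff)
    then show ?thesis by (simp add: tw_def scale_def)
  qed (simp add: tw_def scale_def)
qed

lemma racts_homog:
  "homog p A \<Longrightarrow> racts A f (q # ps) = (\<Sum>z\<in>inds. A (fst q) z * f ((z, snd q) # ps))
     + (-1) ^ (p * (par (fst q) + par (snd q))) * racts A (\<lambda>qs. f (q # qs)) ps"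
  by (simp add: tw_homog racts_scale_left)

lemma bracket_homog:
  assumes "homog p A" "homog q B"
  shows "bracket A B x y = (\<Sum>z\<in>inds. A x z * B z y - (-1) ^ (p * q) * (B x z * A z y))"
  unfolding bracket_apply
proof (intro sum.cong refl)
  fix z
  have "(-1) ^ ((par x + par z) * (par z + par y)) * (B x z * A z y) = (-1) ^ (p * q) * (B x z * A z y)"
  proof (cases "B x z = 0 \<or> A z y = 0")
    case False
    then have "even (par x + par z + q)" "even (par z + par y + p)" using assms by (auto simp: homog_def)
    then have "even (par x + par z) \<longleftrightarrow> even q" "even (par z + par y) \<longleftrightarrow> even p" by simp_all
    then have "even ((par x + par z) * (par z + par y)) \<longleftrightarrow> even (p * q)" by auto
    then show ?thesis by (simp add: minus_one_power_iff)
  qed auto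
  then show "A x z * B z y - (-1) ^ ((par x + par z) * (par z + par y)) * (B x z * A z y) =
    A x z * B z y - (-1) ^ (p * q) * (B x z * A z y)" by simp
qed

text \<open>The four terms record where the two matrices act: both on the first factor, one on each
  side in two ways, both on the remaining factors.\<close>

lemma racts_racts_Cons:
  assumes A: "homog a A" and B: "homog b B"
  shows "racts A (racts B f) ((i, j) # ps) = (\<Sum>u\<in>inds. (\<Sum>z\<in>inds. A i z * B z u) * f ((u, j) # ps))
     + (-1) ^ (a * b) * ((-1) ^ (b * (par i + par j)) * (\<Sum>z\<in>inds. A i z * racts B (\<lambda>qs. f ((z, j) # qs)) ps))
     + (-1) ^ (a * (par i + par j)) * (\<Sum>z\<in>inds. B i z * racts A (\<lambda>qs. f ((z, j) # qs)) ps)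
     + (-1) ^ ((a + b) * (par i + par j)) * racts A (racts B (\<lambda>qs. f ((i, j) # qs))) ps"
proof -
  let ?s = "par i + par j"
  have 1: "(\<lambda>qs. racts B f ((i, j) # qs)) = (\<lambda>qs. \<Sum>z\<in>inds. B i z * f ((z, j) # qs))
      + (\<lambda>qs. (-1) ^ (b * ?s) * racts B (\<lambda>qs. f ((i, j) # qs)) qs)"
    by (intro ext) (simp add: racts_homog[OF B] del: racts.simps)
  \<comment> \<open>By the time \<open>B\<close> passes the first factor, \<open>A\<close> has
    changed the parity of that factor from \<open>par i + par j\<close> to
    \<open>par z + par j\<close>; this produces the extra sign with exponent
    \<open>a * b\<close>.\<close>
  have 2: "A i z * ((-1) ^ (b * (par z + par j)) * c) = (-1) ^ (a * b) * ((-1) ^ (b * ?s) * (A i z * c))" for z c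
  proof (cases "A i z = 0")
    case False
    then have "even (par i + par z + a)" using A by (auto simp: homog_def)
    then have "even (b * (par z + par j)) \<longleftrightarrow> even (a * b + b * ?s)" by auto
    then have "(-1 :: complex) ^ (b * (par z + par j)) = (-1) ^ (a * b) * (-1) ^ (b * ?s)"
      by (simp add: minus_one_power_iff flip: power_add)
    then show ?thesis by (simp add: algebra_simps)
  qed simp
  have pw: "(-1 :: complex) ^ ((a + b) * ?s) = (-1) ^ (a * ?s) * (-1) ^ (b * ?s)"
    by (simp add: distrib_right power_add)
  have "racts A (racts B f) ((i, j) # ps) = 
     (\<Sum>z\<in>inds. A i z * ((\<Sum>u\<in>inds. B z u * f ((u, j) # ps)) + (-1) ^ (b * (par z + par j)) * racts B (\<lambda>qs. f ((z, j) # qs)) ps))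
     + (-1) ^ (a * ?s) * ((\<Sum>z\<in>inds. B i z * racts A (\<lambda>qs. f ((z, j) # qs)) ps)
       + (-1) ^ (b * ?s) * racts A (racts B (\<lambda>qs. f ((i, j) # qs))) ps)"
    unfolding racts_homog[OF A] fst_conv snd_conv 1 racts_add racts_sum racts_scale 
    by (simp add: racts_homog[OF B] del: racts.simps)
  also have "\<dots> = (\<Sum>z\<in>inds. \<Sum>u\<in>inds. A i z * B z u * f ((u, j) # ps))
     + (-1) ^ (a * b) * ((-1) ^ (b * ?s) * (\<Sum>z\<in>inds. A i z * racts B (\<lambda>qs. f ((z, j) # qs)) ps))
     + (-1) ^ (a * ?s) * (\<Sum>z\<in>inds. B i z * racts A (\<lambda>qs. f ((z, j) # qs)) ps)
     + (-1) ^ ((a + b) * ?s) * racts A (racts B (\<lambda>qs. f ((i, j) # qs))) ps"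
    by (simp only: pw distrib_left[where 'a = complex] sum.distrib 2 sum_distrib_left mult.assoc add.assoc)
  also have "(\<Sum>z\<in>inds. \<Sum>u\<in>inds. A i z * B z u * f ((u, j) # ps)) = (\<Sum>u\<in>inds. (\<Sum>z\<in>inds. A i z * B z u) * f ((u, j) # ps))"
    by (subst sum.swap) (simp add: sum_distrib_right)
  finally show ?thesis .
qed

text \<open>The terms with one matrix on the first factor and the other on the rest cancel in the
  supercommutator, and the induction hypothesis handles the rest.\<close>

lemma racts_bracket:
  assumes A: "homog a A" and B: "homog b B"
  shows "racts A (racts B f) ps - (-1) ^ (a * b) * racts B (racts A f) ps = racts (bracket A B) f ps"
proof (induction ps arbitrary: f)
  case (Cons q ps)
  obtain i j where q: "q = (i, j)" by (cases q)
  let ?s = "par i + par j"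
  let ?e = "(-1 :: complex) ^ (a * b)"
  have e: "?e * (?e * c) = c" for c by (simp flip: power_add mult.assoc mult_2)
  have e': "(-1 :: complex) ^ (b * a) = ?e" by (simp add: mult.commute)
  have s: "(b + a) * ?s = (a + b) * ?s" by simp
  have "racts A (racts B f) (q # ps) - ?e * racts B (racts A f) (q # ps) = 
      (\<Sum>u\<in>inds. (\<Sum>z\<in>inds. A i z * B z u) * f ((u, j) # ps)) - ?e * (\<Sum>u\<in>inds. (\<Sum>z\<in>inds. B i z * A z u) * f ((u, j) # ps))
      + (-1) ^ ((a + b) * ?s) * (racts A (racts B (\<lambda>qs. f ((i, j) # qs))) ps - ?e * racts B (racts A (\<lambda>qs. f ((i, j) # qs))) ps)"
    unfolding q racts_racts_Cons[OF A B] racts_racts_Cons[OF B A] e' s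
    by (simp only: distrib_left right_diff_distrib e) (simp add: algebra_simps)
  also have "\<dots> = (\<Sum>u\<in>inds. bracket A B i u * f ((u, j) # ps))
      + (-1) ^ ((a + b) * ?s) * racts (bracket A B) (\<lambda>qs. f ((i, j) # qs)) ps"
    unfolding Cons bracket_homog[OF A B]
    by (simp add: sum_distrib_left sum_distrib_right sum_subtractf algebra_simps)
  also have "\<dots> = racts (bracket A B) f (q # ps)"
    unfolding racts_homog[OF homog_bracket[OF A B]] q by simp
  finally show ?case .
qed simp

section \<open>Action of the free algebra and its descent to the enveloping superalgebra\<close>

definition Act :: "endo free_alg \<Rightarrow> tens \<Rightarrow> tens" where
  "Act p f = (\<lambda>ps. \<Sum>k\<in>Poly_Mapping.keys p. Poly_Mapping.lookup p k * foldr racts (letters k) f ps)"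

lemma Act_superset: "finite K \<Longrightarrow> Poly_Mapping.keys p \<subseteq> K \<Longrightarrow>
  Act p f ps = (\<Sum>k\<in>K. Poly_Mapping.lookup p k * foldr racts (letters k) f ps)"
  unfolding Act_def by (rule sum.mono_neutral_left) (auto simp: in_keys_iff)

lemma Act_add: "Act (p + q) f = Act p f + Act q f"
proof
  fix ps
  let ?K = "Poly_Mapping.keys p \<union> Poly_Mapping.keys q"
  show "Act (p + q) f ps = (Act p f + Act q f) ps"
    using Act_superset[of ?K p f ps] Act_superset[of ?K q f ps] Act_superset[of ?K "p + q" f ps] keys_add[of p q]
    by (simp add: lookup_add algebra_simps sum.distrib)
qed

lemma Act_single: "Act (Poly_Mapping.single k c) f = (\<lambda>ps. c * foldr racts (letters k) f ps)"
  by (auto simp: Act_def)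

lemma Act_0 [simp]: "Act 0 f = (\<lambda>ps. 0)"
  by (auto simp: Act_def)

lemma Act_const_mult: "Act (const c * p) f = (\<lambda>ps. c * Act p f ps)"
proof (induction p rule: free_alg_induct)
  case (single k d)
  then show ?case by (auto simp: const_def mult_single Act_single)
next
  case (add p q)
  then show ?case by (auto simp: Act_add distrib_left)
qed

lemma foldr_racts_add: "foldr racts w (f + h) = foldr racts w f + foldr racts w h"
proof (induction w)
  case (Cons a w)
  then show ?case by (intro ext) (simp only: foldr_Cons o_apply Cons racts_add, simp)
qed simp

lemma foldr_racts_scale: "foldr racts w (\<lambda>ps. c * f ps) = (\<lambda>ps. c * foldr racts w f ps)"
proof (induction w)
  case (Cons a w)
  then show ?case using racts_scale by auto
qed simp

lemma Act_mult: "Act (p * q) f = Act p (Act q f)"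
proof (induction p rule: free_alg_induct)
  case (single k c)
  have "Act (Poly_Mapping.single k c * q) f = (\<lambda>ps. c * foldr racts (letters k) (Act q f) ps)"
  proof (induction q rule: free_alg_induct)
    case (single l d)
    then show ?case by (auto simp: mult_single Act_single foldr_racts_scale)
  next
    case (add q r)
    then show ?case
      by (intro ext) (simp only: distrib_left[where 'a = "endo free_alg"] distrib_left[where 'a = complex]
        Act_add foldr_racts_add add, simp add: distrib_left)
  qed
  then show ?case by (simp add: Act_single)
qed (simp add: Act_add distrib_right)

lemma Act_zero_right: "Act p (\<lambda>ps. 0) = (\<lambda>ps. 0)"
  using foldr_racts_scale[of _ 0 "\<lambda>_. 0"] by (auto simp: Act_def)

lemma Act_gen: "Act (gen x) f = racts x f"
  by (auto simp: gen_def Act_single)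

lemma Act_const: "Act (const c) f = (\<lambda>ps. c * f ps)"
  by (auto simp: const_def Act_single)

lemma Act_1: "Act 1 f = f"
  using Act_const[of 1 f] by simp

lemma Act_diff: "Act (p - q) f = Act p f - Act q f"
proof -
  have "Act p f = Act (p - q) f + Act q f" by (simp flip: Act_add)
  then show ?thesis by auto
qed

lemma U_rels_subset: "U_rels \<subseteq> fa g"
proof -
  have "gen x \<in> fa G" if "x \<in> G" for x using that by (rule fa_gen)
  then show ?thesis
    unfolding U_rels_def g_eq_G osp_part_iff
    by (auto intro!: fa_diff fa_mult simp: G_add G_scale bracket_G)
qed

lemma ideal_U_ideal: "ideal U_ideal (free_algebra g)"
  unfolding U_ideal_def by (rule ring.genideal_ideal[OF ring_free_algebra U_rels_subset])

lemma U_rels_U_ideal: "U_rels \<subseteq> U_ideal"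
  unfolding U_ideal_def by (rule ring.genideal_self[OF ring_free_algebra U_rels_subset])

lemma U_ideal_fa: "U_ideal \<subseteq> fa g"
  using ideal.axioms(1)[OF ideal_U_ideal] additive_subgroup.a_subset by blast

lemma U_ideal_add: "p \<in> U_ideal \<Longrightarrow> q \<in> U_ideal \<Longrightarrow> p + q \<in> U_ideal"
  using additive_subgroup.a_closed[OF ideal.axioms(1)[OF ideal_U_ideal]] by simp

lemma U_ideal_0: "0 \<in> U_ideal"
  using additive_subgroup.zero_closed[OF ideal.axioms(1)[OF ideal_U_ideal]] by simp

lemma U_ideal_mult_left: "p \<in> U_ideal \<Longrightarrow> q \<in> fa g \<Longrightarrow> q * p \<in> U_ideal"
  and U_ideal_mult_right: "p \<in> U_ideal \<Longrightarrow> q \<in> fa g \<Longrightarrow> p * q \<in> U_ideal"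
  using ideal.I_l_closed[OF ideal_U_ideal] ideal.I_r_closed[OF ideal_U_ideal] by simp_all

lemma subspace_U_ideal: "FA.subspace U_ideal"
  by (simp add: FA.subspace_def U_ideal_0 U_ideal_add U_ideal_mult_left)

lemma U_ideal_minimal:
  assumes "FA.subspace I" "I \<subseteq> fa g" "U_rels \<subseteq> I"
    and "\<And>p q. p \<in> I \<Longrightarrow> q \<in> fa g \<Longrightarrow> q * p \<in> I" "\<And>p q. p \<in> I \<Longrightarrow> q \<in> fa g \<Longrightarrow> p * q \<in> I"
  shows "U_ideal \<subseteq> I"
proof -
  interpret ring "free_algebra g" by (rule ring_free_algebra)
  have "subgroup I (add_monoid (free_algebra g))"
  proof (rule add.subgroupI)
    show "I \<subseteq> carrier (free_algebra g)" "I \<noteq> {}" using assms(1,2) FA.subspace_0 by blast+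
    fix p q assume p: "p \<in> I" and q: "q \<in> I"
    show "p \<oplus>\<^bsub>free_algebra g\<^esub> q \<in> I" using p q assms(1) by (simp add: FA.subspace_add)
    have "- p \<in> I" using p assms(1) by (rule FA.subspace_neg[rotated])
    then show "\<ominus>\<^bsub>free_algebra g\<^esub> p \<in> I"
      using a_inv_free_algebra[of p g] p assms(2) by auto
  qed
  then have "ideal I (free_algebra g)"
    by (rule idealI[OF ring_free_algebra]) (use assms(4,5) in simp_all)
  then show ?thesis unfolding U_ideal_def using assms(3) by (rule genideal_minimal)
qed

text \<open>The elements that annihilate all tensors form a two-sided ideal, and by
  \<open>racts_bracket\<close> it contains the defining relations.\<close>

lemma Act_U_ideal:
  assumes "p \<in> U_ideal"
  shows "Act p f = (\<lambda>ps. 0)"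
proof -
  let ?I = "{p \<in> fa g. \<forall>f. Act p f = (\<lambda>ps. 0)}"
  have "U_ideal \<subseteq> ?I"
  proof (rule U_ideal_minimal)
    show "FA.subspace ?I"
      by (auto simp: FA.subspace_def Act_add Act_const_mult fa_add fa_mult)
    have "Act r f = (\<lambda>ps. 0)" if "r \<in> U_rels" for r f
      using that unfolding U_rels_def osp_part_iff
    proof (elim UnE CollectE exE conjE)
      fix x y assume "r = gen (x + y) - gen x - gen y"
      then show ?thesis by (auto simp: Act_diff Act_gen racts_add_left)
    next
      fix c x assume "r = gen (scale c x) - const c * gen x"
      then show ?thesis by (auto simp: Act_diff Act_gen Act_const_mult racts_scale_left)
    next
      fix p q x y
      assume r: "r = gen x * gen y - const ((- 1) ^ (p * q)) * gen y * gen x - gen (bracket x y)"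
        and h: "homog p x" "homog q y"
      show ?thesis
        using racts_bracket[OF h, of f]
        unfolding r by (auto simp: Act_diff Act_gen Act_mult Act_const simp flip: racts_bracket[OF h])
    qed
    then show "U_rels \<subseteq> ?I" using U_rels_subset by auto
  qed (auto simp: Act_mult Act_zero_right fa_mult)
  then show ?thesis using assms by blast
qed

text \<open>\<open>DD \<phi>\<close> pairs the first tensor factor with the functional \<open>\<phi>\<close>.\<close>

definition DD :: "endo \<Rightarrow> tens \<Rightarrow> tens" where
  "DD \<phi> f = (\<lambda>ps. \<Sum>i\<in>inds. \<Sum>j\<in>inds. \<phi> i j * f ((i, j) # ps))"

text \<open>The transpose of left multiplication: the functional \<open>\<phi>\<close> composed with
  multiplication by \<open>A\<close> on the left.\<close>

definition cstar :: "endo \<Rightarrow> endo \<Rightarrow> endo" where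
  "cstar \<phi> A = (\<lambda>z j. \<Sum>i\<in>inds. \<phi> i j * A i z)"

lemma homog_cstar:
  assumes "homog p \<phi>" "homog q A"
  shows "homog (p + q) (cstar \<phi> A)"
  unfolding homog_def
proof (intro allI impI)
  fix z j assume "cstar \<phi> A z j \<noteq> 0"
  then obtain i where "\<phi> i j * A i z \<noteq> 0" unfolding cstar_def by (metis (no_types, lifting) sum.neutral)
  then have "even (par i + par j + p)" "even (par i + par z + q)" using assms by (auto simp: homog_def)
  then show "even (par z + par j + (p + q))" by presburger
qed

lemma DD_add: "DD \<phi> (f + h) = DD \<phi> f + DD \<phi> h"
  by (auto simp: DD_def algebra_simps sum.distrib)

lemma DD_scale: "DD \<phi> (\<lambda>ps. c * f ps) = (\<lambda>ps. c * DD \<phi> f ps)"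
  by (auto simp: DD_def algebra_simps sum_distrib_left)

lemma DD_diff: "DD \<phi> (f - h) = DD \<phi> f - DD \<phi> h"
  by (auto simp: DD_def algebra_simps sum_subtractf)

text \<open>\<open>A\<close> acts either on the first factor, where it is absorbed into the
  functional, or on the other factors, where it passes the functional with the usual super
  sign.\<close>

lemma DD_racts:
  assumes \<phi>: "homog p \<phi>" and A: "homog q A"
  shows "DD \<phi> (racts A f) = DD (cstar \<phi> A) f + (\<lambda>ps. (-1) ^ (p * q) * racts A (DD \<phi> f) ps)"
proof
  fix ps
  have 1: "\<phi> i j * ((-1) ^ (q * (par i + par j)) * c) = (-1) ^ (p * q) * (\<phi> i j * c)" for i j c
  proof (cases "\<phi> i j = 0")
    case False
    then have "even (par i + par j + p)" using \<phi> by (auto simp: homog_def)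
    then have "even (q * (par i + par j)) \<longleftrightarrow> even (p * q)" by auto
    then show ?thesis by (simp add: minus_one_power_iff)
  qed simp
  have 2: "racts A (DD \<phi> f) ps = (\<Sum>i\<in>inds. \<Sum>j\<in>inds. \<phi> i j * racts A (\<lambda>qs. f ((i, j) # qs)) ps)"
  proof -
    have "DD \<phi> f = (\<lambda>qs. \<Sum>i\<in>inds. 1 * (\<Sum>j\<in>inds. \<phi> i j * f ((i, j) # qs)))" by (simp add: DD_def)
    then show ?thesis by (simp only: racts_sum) simp
  qed
  have 3: "DD (cstar \<phi> A) f ps = (\<Sum>i\<in>inds. \<Sum>j\<in>inds. \<Sum>z\<in>inds. \<phi> i j * A i z * f ((z, j) # ps))"
  proof -
    have "DD (cstar \<phi> A) f ps = (\<Sum>z\<in>inds. \<Sum>j\<in>inds. \<Sum>i\<in>inds. \<phi> i j * A i z * f ((z, j) # ps))"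
      by (simp add: DD_def cstar_def sum_distrib_right)
    also have "\<dots> = (\<Sum>j\<in>inds. \<Sum>z\<in>inds. \<Sum>i\<in>inds. \<phi> i j * A i z * f ((z, j) # ps))"
      by (rule sum.swap)
    also have "\<dots> = (\<Sum>j\<in>inds. \<Sum>i\<in>inds. \<Sum>z\<in>inds. \<phi> i j * A i z * f ((z, j) # ps))"
      by (intro sum.cong refl sum.swap)
    also have "\<dots> = (\<Sum>i\<in>inds. \<Sum>j\<in>inds. \<Sum>z\<in>inds. \<phi> i j * A i z * f ((z, j) # ps))"
      by (rule sum.swap)
    finally show ?thesis .
  qed
  have "DD \<phi> (racts A f) ps = (\<Sum>i\<in>inds. \<Sum>j\<in>inds. (\<Sum>z\<in>inds. \<phi> i j * A i z * f ((z, j) # ps)) 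
      + (-1) ^ (p * q) * (\<phi> i j * racts A (\<lambda>qs. f ((i, j) # qs)) ps))"
    unfolding DD_def
    by (simp only: racts_homog[OF A] fst_conv snd_conv distrib_left[where 'a = complex] 1 sum_distrib_left mult.assoc)
  then show "DD \<phi> (racts A f) ps = (DD (cstar \<phi> A) f + (\<lambda>ps. (-1) ^ (p * q) * racts A (DD \<phi> f) ps)) ps"
    by (simp add: 2 3 sum.distrib sum_distrib_left)
qed

end

section \<open>Independence of ordered monomials\<close>

locale osp_weight = osp m n ex for m n :: nat and ex :: bool +
  fixes lam :: weight
begin

text \<open>With this shift the diagonal letters kill the highest weight vector just as the positive
  root vectors do, so all letters outside \<open>negl\<close> can be treated alike.\<close>

definition mu :: "int \<times> int \<Rightarrow> complex" where
  "mu b = (if fst b = snd b then lam (fst b) else 0)"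

definition lt :: "int \<times> int \<Rightarrow> endo free_alg" where
  "lt b = gen (F b) - const (mu b)"

definition wd :: "(int \<times> int) list \<Rightarrow> endo free_alg" where
  "wd w = prod_list (map lt w)"

lemma wd_Nil [simp]: "wd [] = 1" and wd_Cons: "wd (b # w) = lt b * wd w"
  and wd_append: "wd (v @ w) = wd v * wd w"
  by (simp_all add: wd_def)

text \<open>Letters of negative roots come first, so that normal words respect the triangular decomposition.\<close>

definition key :: "int \<times> int \<Rightarrow> nat \<times> int \<times> int" where
  "key b = (if ht (fst b) < ht (snd b) then 0 else 1, - fst b, - snd b)"

text \<open>Even letters may repeat and odd ones may not: the square of an odd element is half its
  bracket with itself.\<close>

definition RR :: "int \<times> int \<Rightarrow> int \<times> int \<Rightarrow> bool" where
  "RR b c \<longleftrightarrow> key b < key c \<or> b = c \<and> lpar b = 0"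

definition normal :: "(int \<times> int) list \<Rightarrow> bool" where
  "normal w \<longleftrightarrow> sorted_wrt RR w"

lemma key_inj: "key b = key c \<longleftrightarrow> b = c"
  by (auto simp: key_def prod_eq_iff)

lemma RR_antisym: "RR b c \<Longrightarrow> RR c b \<Longrightarrow> b = c"
  by (auto simp: RR_def)

lemma RR_trans: "RR b c \<Longrightarrow> RR c d \<Longrightarrow> RR b d"
  by (auto simp: RR_def)

lemma normal_Nil [simp]: "normal []"
  and normal_Cons: "normal (b # w) \<longleftrightarrow> (\<forall>c\<in>set w. RR b c) \<and> normal w"
  and normal_append: "normal (v @ w) \<longleftrightarrow> normal v \<and> normal w \<and> (\<forall>b\<in>set v. \<forall>c\<in>set w. RR b c)"
  by (auto simp: normal_def sorted_wrt_append)

lemma normal_remove1: "normal w \<Longrightarrow> normal (remove1 b w)"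
  by (induction w) (auto simp: normal_Cons dest: notin_set_remove1 set_mp[OF set_remove1_subset])

text \<open>Makes removal of a fixed letter injective on the normal words that contain it.\<close>

lemma normal_mset_eq: "normal v \<Longrightarrow> normal w \<Longrightarrow> mset v = mset w \<Longrightarrow> v = w"
proof (induction v arbitrary: w)
  case (Cons b v)
  then obtain c w' where w: "w = c # w'" by (cases w) auto
  have "b = c"
  proof (rule ccontr)
    assume "b \<noteq> c"
    have "set (b # v) = set w" using Cons.prems(3) by (metis set_mset_mset)
    then have "c \<in> set v" "b \<in> set w'" using \<open>b \<noteq> c\<close> w by auto
    then have "RR b c" "RR c b" using Cons.prems w by (auto simp: normal_Cons)
    then show False using RR_antisym \<open>b \<noteq> c\<close> by blast
  qed
  then show ?case using Cons w by (auto simp: normal_Cons)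
qed simp

lemma normal_repeat:
  assumes "normal (b # w)" "b \<in> set w"
  shows "lpar b = 0" "w = b # remove1 b w"
proof -
  have "RR b b" using assms by (auto simp: normal_Cons)
  then show "lpar b = 0" by (auto simp: RR_def)
  obtain c w' where w: "w = c # w'" using assms(2) by (cases w) auto
  have "c = b"
  proof (rule ccontr)
    assume "c \<noteq> b"
    then have "RR b c" "RR c b" using assms w by (auto simp: normal_Cons)
    then show False using RR_antisym \<open>c \<noteq> b\<close> by blast
  qed
  then show "w = b # remove1 b w" using w by simp
qed

text \<open>The functional reading off the coefficient of \<open>F b\<close>, corrected so as to
  vanish at the identity. For a diagonal letter the entries of \<open>F c\<close> at
  \<open>x\<close> and \<open>st x\<close> are opposite, so the correction doubles the value instead
  of cancelling it.\<close>

definition psi :: "int \<times> int \<Rightarrow> endo" where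
  "psi b = (if fst b = snd b then E (fst b) (fst b) - E (st (fst b)) (st (fst b)) else E (fst b) (snd b))"

text \<open>As \<open>\<phi>\<close> stands for a functional on matrices, this is its value at the
  identity matrix.\<close>

definition trace :: "endo \<Rightarrow> complex" where
  "trace \<phi> = (\<Sum>i\<in>inds. \<phi> i i)"

lemma homog_psi: "b \<in> lets \<Longrightarrow> homog (lpar b) (psi b)"
  using par_less_2[of "fst b"] par_less_2[of "snd b"]
  by (auto simp: homog_def psi_def E_def lpar_def split: if_splits)

lemma trace_E: "x \<in> inds \<Longrightarrow> trace (E x y) = of_bool (x = y)"
proof -
  assume x: "x \<in> inds"
  have "trace (E x y) = (\<Sum>i\<in>inds. if i = x then of_bool (x = y) else 0)"
    unfolding trace_def by (intro sum.cong) (auto simp: E_def)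
  then show ?thesis using x by simp
qed

lemma trace_diff: "trace (\<phi> - \<psi>) = trace \<phi> - trace \<psi>"
  by (simp add: trace_def sum_subtractf)

lemma trace_psi: "b \<in> lets \<Longrightarrow> trace (psi b) = 0"
  using lets_inds[of b] by (auto simp: psi_def trace_diff trace_E)

lemma trace_cstar_E: "x \<in> inds \<Longrightarrow> y \<in> inds \<Longrightarrow> trace (cstar (E x y) A) = A x y"
proof -
  assume xy: "x \<in> inds" "y \<in> inds"
  have "trace (cstar (E x y) A) = (\<Sum>z\<in>inds. if z = y then A x y else 0)"
    unfolding trace_def
  proof (intro sum.cong refl)
    fix z
    have "cstar (E x y) A z z = (\<Sum>i\<in>inds. if i = x then (if z = y then A x z else 0) else 0)"
      unfolding cstar_def by (intro sum.cong) (auto simp: E_def)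
    then show "cstar (E x y) A z z = (if z = y then A x y else 0)" using xy by simp
  qed
  then show ?thesis using xy by simp
qed

lemma cstar_diff: "cstar (\<phi> - \<psi>) A = cstar \<phi> A - cstar \<psi> A"
  by (auto simp: cstar_def fun_eq_iff algebra_simps sum_subtractf)

lemma trace_cstar_psi:
  assumes "b \<in> lets" "c \<in> lets"
  shows "trace (cstar (psi b) (F c)) = (if b = c then if fst b = snd b then 2 * nu b else nu b else 0)"
proof -
  obtain x y where b: "b = (x, y)" by (cases b)
  have i: "x \<in> inds" "y \<in> inds" using assms by (auto simp: b lets_def)
  have "F c (st x) (st x) = - F c x x"
    using G_st[OF F_lets_G[OF assms(2)] i(1) i(1)] by (simp add: sig_diag)
  then show ?thesis
    using F_lets_apply[OF assms(2,1)] i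
    by (auto simp: psi_def b cstar_diff trace_diff trace_cstar_E)
qed

section \<open>Shifted letters acting on tensors and the filtration by word length\<close>

definition T :: "int \<times> int \<Rightarrow> tens \<Rightarrow> tens" where
  "T b f = (\<lambda>ps. racts (F b) f ps - mu b * f ps)"

definition f0 :: tens where
  "f0 ps = of_bool (\<forall>q\<in>set ps. fst q = snd q)"

definition Tw :: "(int \<times> int) list \<Rightarrow> tens" where
  "Tw w = foldr T w f0"

definition Fil :: "nat \<Rightarrow> tens set" where
  "Fil k = TS.span {Tw w | w. set w \<subseteq> lets \<and> length w < k}"

lemma Act_lt: "Act (lt b) f = T b f"
  by (auto simp: lt_def Act_diff Act_gen Act_const T_def)

lemma Act_wd: "Act (wd w) f0 = Tw w"
  by (induction w) (simp_all add: Act_1 wd_Cons Act_mult Act_lt Tw_def)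

lemma T_add: "T b (f + h) = T b f + T b h"
  by (auto simp: T_def racts_add algebra_simps)

lemma T_scale: "T b (\<lambda>ps. c * f ps) = (\<lambda>ps. c * T b f ps)"
  by (auto simp: T_def racts_scale algebra_simps)

lemma T_diff: "T b (f - h) = T b f - T b h"
proof -
  have "T b f = T b (f - h) + T b h" by (simp flip: T_add)
  then show ?thesis by auto
qed

lemma Tw_Nil: "Tw [] = f0" and Tw_Cons: "Tw (b # w) = T b (Tw w)"
  by (simp_all add: Tw_def)

lemma Fil_mono: "k \<le> l \<Longrightarrow> f \<in> Fil k \<Longrightarrow> f \<in> Fil l"
  unfolding Fil_def by (erule subsetD[OF TS.span_mono, rotated]) auto

lemma Tw_Fil: "set w \<subseteq> lets \<Longrightarrow> length w < k \<Longrightarrow> Tw w \<in> Fil k"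
  unfolding Fil_def by (rule TS.span_base) auto

lemma Fil_add: "f \<in> Fil k \<Longrightarrow> h \<in> Fil k \<Longrightarrow> f + h \<in> Fil k"
  and Fil_scale: "f \<in> Fil k \<Longrightarrow> (\<lambda>ps. c * f ps) \<in> Fil k"
  and Fil_diff: "f \<in> Fil k \<Longrightarrow> h \<in> Fil k \<Longrightarrow> f - h \<in> Fil k"
  and Fil_sum: "(\<And>i. i \<in> I \<Longrightarrow> f' i \<in> Fil k) \<Longrightarrow> sum f' I \<in> Fil k"
  unfolding Fil_def by (auto intro: TS.span_add TS.span_scale TS.span_diff TS.span_sum)

lemma Fil_zero: "(\<lambda>ps. 0) \<in> Fil k"
  using TS.span_zero unfolding Fil_def zero_fun_def by blast

lemma T_Fil:
  assumes "f \<in> Fil k" "b \<in> lets"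
  shows "T b f \<in> Fil (Suc k)"
  using assms(1) unfolding Fil_def[of k]
proof (induction rule: TS.span_induct_alt)
  case base
  have "T b (\<lambda>ps. 0) = (\<lambda>ps. 0)" using T_scale[of b 0 "\<lambda>_. 0"] by simp
  then show ?case by (simp add: Fil_zero zero_fun_def)
next
  case (step c f h)
  then obtain w where w: "f = Tw w" "set w \<subseteq> lets" "length w < k" by auto
  have "T b f \<in> Fil (Suc k)" using Tw_Fil[of "b # w" "Suc k"] w assms(2) by (simp add: Tw_Cons)
  then show ?case using step by (simp only: T_add T_scale Fil_add Fil_scale)
qed

lemma mu_odd: "lpar b = 1 \<Longrightarrow> mu b = 0"
  by (auto simp: mu_def lpar_def)

lemma DD_T:
  assumes \<phi>: "homog p \<phi>" and b: "b \<in> lets"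
  shows "DD \<phi> (T b f) = DD (cstar \<phi> (F b)) f + (\<lambda>ps. (-1) ^ (p * lpar b) * T b (DD \<phi> f) ps)"
proof -
  have "T b f = racts (F b) f - (\<lambda>ps. mu b * f ps)" by (auto simp: T_def)
  then have 1: "DD \<phi> (T b f) = DD (cstar \<phi> (F b)) f + (\<lambda>ps. (-1) ^ (p * lpar b) * racts (F b) (DD \<phi> f) ps)
     - (\<lambda>ps. mu b * DD \<phi> f ps)"
    by (simp only: DD_diff DD_scale DD_racts[OF \<phi> homog_F[OF b]])
  \<comment> \<open>Only even letters have a nonzero shift, so the super sign does not affect
    it.\<close>
  have "mu b * c = (-1) ^ (p * lpar b) * (mu b * c)" for c
    using mu_odd[of b] lpar_less_2[of b] by (cases "lpar b = 0") (auto simp: less_2_cases_iff)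
  then show ?thesis unfolding 1 by (auto simp: fun_eq_iff T_def algebra_simps)
qed

lemma DD_f0: "DD \<phi> f0 = (\<lambda>ps. trace \<phi> * f0 ps)"
proof
  fix ps
  have "DD \<phi> f0 ps = (\<Sum>i\<in>inds. \<Sum>j\<in>inds. if j = i then \<phi> i i * f0 ps else 0)"
    unfolding DD_def by (intro sum.cong) (auto simp: f0_def)
  then show "DD \<phi> f0 ps = trace \<phi> * f0 ps" by (simp add: trace_def sum_distrib_right)
qed

text \<open>Either no letter acts on the first factor, which gives the trace term, or some letter is
  used up there. The functional varies in the induction because such a letter replaces
  \<open>\<phi>\<close> by \<open>cstar \<phi> (F b)\<close>.\<close>

lemma DD_Tw_trace:
  assumes "homog p \<phi>" "set w \<subseteq> lets"
  shows "DD \<phi> (Tw w) - (\<lambda>ps. trace \<phi> * Tw w ps) \<in> Fil (length w)"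
  using assms
proof (induction w arbitrary: \<phi> p)
  case Nil
  then show ?case using Fil_zero[of 0] by (simp add: Tw_Nil DD_f0 fun_diff_def)
next
  case (Cons b w)
  let ?k = "length w"
  have b: "b \<in> lets" and w: "set w \<subseteq> lets" using Cons.prems by auto
  let ?\<psi> = "cstar \<phi> (F b)"
  let ?s = "(-1 :: complex) ^ (p * lpar b)"
  have h: "homog (p + lpar b) ?\<psi>" using homog_cstar[OF Cons.prems(1) homog_F[OF b]] .
  \<comment> \<open>A functional that is nonzero at the identity has a nonzero diagonal entry and is
    therefore even.\<close>
  have s: "?s * trace \<phi> = trace \<phi>"
  proof (cases "trace \<phi> = 0")
    case False
    then obtain i where "\<phi> i i \<noteq> 0"
      unfolding trace_def by (rule sum.not_neutral_contains_not_neutral)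
    then have "even p" using Cons.prems(1) by (auto simp: homog_def)
    then show ?thesis by simp
  qed simp
  have w': "Tw w \<in> Fil (Suc ?k)" using Tw_Fil[OF w] by simp
  have "DD ?\<psi> (Tw w) - (\<lambda>ps. trace ?\<psi> * Tw w ps) \<in> Fil (Suc ?k)"
    by (rule Fil_mono[OF _ Cons.IH[OF h w]]) simp
  from Fil_add[OF this Fil_scale[OF w', of "trace ?\<psi>"]]
  have 1: "DD ?\<psi> (Tw w) \<in> Fil (Suc ?k)" by simp
  have 2: "(\<lambda>ps. ?s * T b (DD \<phi> (Tw w) - (\<lambda>ps. trace \<phi> * Tw w ps)) ps) \<in> Fil (Suc ?k)"
    by (intro Fil_scale T_Fil b Cons.IH[OF Cons.prems(1) w])
  have "DD \<phi> (Tw (b # w)) - (\<lambda>ps. trace \<phi> * Tw (b # w) ps) =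
     DD ?\<psi> (Tw w) + (\<lambda>ps. ?s * T b (DD \<phi> (Tw w) - (\<lambda>ps. trace \<phi> * Tw w ps)) ps)"
    unfolding Tw_Cons DD_T[OF Cons.prems(1) b] T_diff T_scale
    using s by (auto simp: fun_eq_iff algebra_simps)
  then show ?case using Fil_add[OF 1 2] by (simp only: length_Cons)
qed

definition nu2 :: "int \<times> int \<Rightarrow> complex" where
  "nu2 b = (if fst b = snd b then 2 * nu b else nu b)"

lemma nu2_nz: "nu2 b \<noteq> 0"
  by (simp add: nu2_def nu_def)

text \<open>The superderivation property; in a normal word the occurrences of \<open>b\<close> are adjacent.\<close>

lemma DD_psi_Tw:
  assumes b: "b \<in> lets" and w: "set w \<subseteq> lets" "normal w"
  shows "\<exists>\<sigma>. \<sigma> \<noteq> 0 \<and> (lpar b = 0 \<longrightarrow> \<sigma> = 1) \<and>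
    DD (psi b) (Tw w) - (\<lambda>ps. \<sigma> * nu2 b * of_nat (count_list w b) * Tw (remove1 b w) ps) \<in> Fil (length w - 1)"
  using w
proof (induction w)
  case Nil
  then show ?case using Fil_zero[of 0] b by (intro exI[of _ 1]) (simp add: Tw_Nil DD_f0 trace_psi fun_diff_def)
next
  case (Cons c w)
  have c: "c \<in> lets" and w: "set w \<subseteq> lets" "normal w" using Cons.prems by (auto simp: normal_Cons)
  let ?s = "(-1 :: complex) ^ (lpar b * lpar c)"
  let ?\<psi> = "cstar (psi b) (F c)"
  have \<psi>: "homog (lpar b + lpar c) ?\<psi>" by (rule homog_cstar[OF homog_psi[OF b] homog_F[OF c]])
  obtain \<sigma> where \<sigma>: "\<sigma> \<noteq> 0" "lpar b = 0 \<longrightarrow> \<sigma> = 1"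
    and IH: "DD (psi b) (Tw w) - (\<lambda>ps. \<sigma> * nu2 b * of_nat (count_list w b) * Tw (remove1 b w) ps) \<in> Fil (length w - 1)"
      (is "?d \<in> _")
    using Cons.IH[OF w] by (elim exE conjE) (rule that)
  have 1: "DD ?\<psi> (Tw w) - (\<lambda>ps. trace ?\<psi> * Tw w ps) \<in> Fil (length w)"
    using DD_Tw_trace[OF \<psi> w(1)] .
  have 2: "(\<lambda>ps. ?s * T c ?d ps) \<in> Fil (length w)"
  \<comment> \<open>For the empty word the truncated \<open>length w - 1\<close> would make the
    bound from \<open>T_Fil\<close> too weak by one; there the error term is zero.\<close>
  proof (cases "w = []")
    case True
    then have "?d = (\<lambda>ps. 0)" using b by (simp add: Tw_Nil DD_f0 trace_psi fun_eq_iff)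
    moreover have "T c (\<lambda>ps. 0) = (\<lambda>ps. 0)" using T_scale[of c 0 "\<lambda>_. 0"] by simp
    ultimately show ?thesis by (simp add: Fil_zero)
  next
    case False
    then have "Suc (length w - 1) = length w" by (cases w) auto
    then show ?thesis using T_Fil[OF IH c] Fil_scale by metis
  qed
  have e: "DD (psi b) (Tw (c # w)) - ((\<lambda>ps. trace ?\<psi> * Tw w ps) 
       + (\<lambda>ps. ?s * (\<sigma> * nu2 b * of_nat (count_list w b)) * T c (Tw (remove1 b w)) ps)) \<in> Fil (length w)"
      (is "?l \<in> _")
  proof -
    have "?l = (DD ?\<psi> (Tw w) - (\<lambda>ps. trace ?\<psi> * Tw w ps)) + (\<lambda>ps. ?s * T c ?d ps)"
      unfolding Tw_Cons DD_T[OF homog_psi[OF b] c] T_diff T_scale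
      by (intro ext) (simp add: right_diff_distrib)
    then show ?thesis using Fil_add[OF 1 2] by (simp only:)
  qed
  show ?case
  proof (cases "c = b")
    case True
    have t: "trace ?\<psi> = nu2 b" using trace_cstar_psi[OF b c] True by (simp add: nu2_def)
    show ?thesis
    proof (cases "b \<in> set w")
      case False
      have eq: "(\<lambda>ps. trace ?\<psi> * Tw w ps) + (\<lambda>ps. ?s * (\<sigma> * nu2 b * of_nat (count_list w b)) * T c (Tw (remove1 b w)) ps)
        = (\<lambda>ps. 1 * nu2 b * of_nat (count_list (c # w) b) * Tw (remove1 b (c # w)) ps)"
        using False True by (intro ext) (simp add: t[unfolded True] count_list_0_iff)
      show ?thesis using e[unfolded eq]
        by (intro exI[of _ 1] conjI) (simp_all only: length_Cons diff_Suc_1 one_neq_zero simp_thms)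
    next
      \<comment> \<open>In a normal word a repeated letter is even and comes next. So no sign
        intervenes, and the new term adds 1 to the multiplicity.\<close>
      case b': True
      have "lpar b = 0" and r: "w = b # remove1 b w"
        using normal_repeat[of b w] b' True Cons.prems by auto
      then have "\<sigma> = 1" "?s = 1" using \<sigma> by auto
      moreover have "T c (Tw (remove1 b w)) = Tw w" by (subst (2) r) (simp add: True Tw_Cons)
      ultimately have eq: "(\<lambda>ps. trace ?\<psi> * Tw w ps) + (\<lambda>ps. ?s * (\<sigma> * nu2 b * of_nat (count_list w b)) * T c (Tw (remove1 b w)) ps)
        = (\<lambda>ps. 1 * nu2 b * of_nat (count_list (c # w) b) * Tw (remove1 b (c # w)) ps)"
        using True by (intro ext) (simp add: t[unfolded True] distrib_left distrib_right)
      show ?thesis using e[unfolded eq]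
        by (intro exI[of _ 1] conjI) (simp_all only: length_Cons diff_Suc_1 one_neq_zero simp_thms)
    qed
  next
    case False
    have t: "trace ?\<psi> = 0" using trace_cstar_psi[OF b c] False by simp
    have eq: "(\<lambda>ps. trace ?\<psi> * Tw w ps) + (\<lambda>ps. ?s * (\<sigma> * nu2 b * of_nat (count_list w b)) * T c (Tw (remove1 b w)) ps)
        = (\<lambda>ps. (?s * \<sigma>) * nu2 b * of_nat (count_list (c # w) b) * Tw (remove1 b (c # w)) ps)"
      using False by (intro ext) (simp add: t Tw_Cons)
    have "?s * \<sigma> \<noteq> 0" "lpar b = 0 \<longrightarrow> ?s * \<sigma> = 1" using \<sigma> by auto
    then show ?thesis using e[unfolded eq]
      by (intro exI[of _ "?s * \<sigma>"] conjI) (simp_all only: length_Cons diff_Suc_1 not_False_eq_True)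
  qed
qed

lemma DD_psi_Fil:
  assumes b: "b \<in> lets" and f: "f \<in> Fil k"
  shows "DD (psi b) f \<in> Fil (k - 1)"
  using f unfolding Fil_def[of k]
proof (induction rule: TS.span_induct_alt)
  case base
  have "DD (psi b) (\<lambda>ps. 0) = (\<lambda>ps. 0)" using DD_scale[of "psi b" 0 "\<lambda>_. 0"] by simp
  then show ?case by (simp add: Fil_zero zero_fun_def)
next
  case (step c f h)
  then obtain w where w: "f = Tw w" "set w \<subseteq> lets" "length w < k" by auto
  have "DD (psi b) f \<in> Fil (length w)"
    using DD_Tw_trace[OF homog_psi[OF b] w(2)] b by (simp add: trace_psi w(1) fun_diff_def)
  then have "DD (psi b) f \<in> Fil (k - 1)" using Fil_mono w(3) by (metis Suc_leI Suc_pred' diff_le_mono diff_Suc_1)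
  then show ?case using step by (simp only: DD_add DD_scale Fil_add Fil_scale)
qed

text \<open>For a letter \<open>b\<close> of a given word, \<open>DD (psi b)\<close> shortens
  exactly the words that contain \<open>b\<close>, modulo lower terms. The shortened words are
  distinct and normal, and their coefficients change by nonzero factors, among them the multiplicity
  of \<open>b\<close>.\<close>

lemma top_degree_independent:
  assumes "finite Ws" "\<And>w. w \<in> Ws \<Longrightarrow> normal w \<and> set w \<subseteq> lets \<and> length w = r"
    and "(\<Sum>w\<in>Ws. (\<lambda>ps. x w * Tw w ps)) \<in> Fil r"
  shows "\<forall>w\<in>Ws. x w = 0"
  using assms
proof (induction r arbitrary: Ws x)
  case 0
  have Ws: "Ws \<subseteq> {[]}" using 0(2) by auto
  show ?case
  proof
    fix w assume w: "w \<in> Ws"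
    then have "Ws = {[]}" "w = []" using Ws by auto
    then have "(\<lambda>ps. x [] * f0 ps) \<in> Fil 0" using 0(3) by (simp add: Tw_Nil)
    then have "(\<lambda>ps. x [] * f0 ps) = (\<lambda>ps. 0)" by (simp add: Fil_def zero_fun_def)
    \<comment> \<open>The entry at the empty list, that is the zeroth tensor power, detects the
      empty word.\<close>
    from fun_cong[OF this, of "[]"] show "x w = 0" using \<open>w = []\<close> by (simp add: f0_def)
  qed
next
  case (Suc r)
  show ?case
  proof
    fix w0 assume w0: "w0 \<in> Ws"
    then obtain b where b: "b \<in> set w0" using Suc.prems(2)[OF w0] by (cases w0) auto
    have bl: "b \<in> lets" using b Suc.prems(2)[OF w0] by auto
    have "\<exists>y. y \<noteq> 0 \<and> DD (psi b) (Tw w) - (\<lambda>ps. y * of_nat (count_list w b) * Tw (remove1 b w) ps) \<in> Fil r" if "w \<in> Ws" for w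
    proof -
      have "set w \<subseteq> lets" "normal w" "length w - 1 = r" using Suc.prems(2)[OF that] by auto
      from DD_psi_Tw[OF bl this(1,2)] this(3)
      obtain \<sigma> where "\<sigma> \<noteq> 0" "DD (psi b) (Tw w) - (\<lambda>ps. \<sigma> * nu2 b * of_nat (count_list w b) * Tw (remove1 b w) ps) \<in> Fil r"
        by auto
      then show ?thesis using nu2_nz[of b] by (intro exI[of _ "\<sigma> * nu2 b"]) auto
    qed
    then obtain y where y: "\<And>w. w \<in> Ws \<Longrightarrow> y w \<noteq> 0"
      "\<And>w. w \<in> Ws \<Longrightarrow> DD (psi b) (Tw w) - (\<lambda>ps. y w * of_nat (count_list w b) * Tw (remove1 b w) ps) \<in> Fil r"
      by metis
    let ?V = "{w \<in> Ws. b \<in> set w}"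
    have inj: "inj_on (remove1 b) ?V"
    proof
      fix v w assume v: "v \<in> ?V" and w: "w \<in> ?V" and e: "remove1 b v = remove1 b w"
      have "add_mset b (mset (remove1 b v)) = mset v" "add_mset b (mset (remove1 b w)) = mset w" using v w by auto
      then have "mset v = mset w" unfolding e by (rule subst)
      moreover have "normal v" "normal w" using Suc.prems(2)[of v] Suc.prems(2)[of w] v w by auto
      ultimately show "v = w" using normal_mset_eq by simp
    qed
    have "DD (psi b) (\<Sum>w\<in>Ws. (\<lambda>ps. x w * Tw w ps)) \<in> Fil r"
      using DD_psi_Fil[OF bl Suc.prems(3)] by simp
    moreover have "DD \<phi> (\<Sum>w\<in>I. (\<lambda>ps. x w * Tw w ps)) = (\<Sum>w\<in>I. (\<lambda>ps. x w * DD \<phi> (Tw w) ps))" for \<phi> I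
    proof (induction I rule: infinite_finite_induct)
      case (insert w I)
      show ?case unfolding sum.insert[OF insert(1,2)] DD_add DD_scale insert(3) by (rule refl)
    qed (use DD_scale[of \<phi> 0 "\<lambda>_. 0"] in \<open>simp_all add: zero_fun_def\<close>)
    ultimately have 1: "(\<Sum>w\<in>Ws. (\<lambda>ps. x w * DD (psi b) (Tw w) ps)) \<in> Fil r" by simp
    have "(\<Sum>w\<in>Ws. (\<lambda>ps. x w * (DD (psi b) (Tw w) - (\<lambda>ps. y w * of_nat (count_list w b) * Tw (remove1 b w) ps)) ps)) \<in> Fil r"
      by (intro Fil_sum Fil_scale y)
    from Fil_diff[OF 1 this] have "(\<Sum>w\<in>Ws. (\<lambda>ps. x w * DD (psi b) (Tw w) ps)) -
       (\<Sum>w\<in>Ws. (\<lambda>ps. x w * (DD (psi b) (Tw w) - (\<lambda>ps. y w * of_nat (count_list w b) * Tw (remove1 b w) ps)) ps)) \<in> Fil r" .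
    also have "(\<Sum>w\<in>Ws. (\<lambda>ps. x w * DD (psi b) (Tw w) ps)) -
       (\<Sum>w\<in>Ws. (\<lambda>ps. x w * (DD (psi b) (Tw w) - (\<lambda>ps. y w * of_nat (count_list w b) * Tw (remove1 b w) ps)) ps))
       = (\<Sum>w\<in>Ws. (\<lambda>ps. x w * y w * of_nat (count_list w b) * Tw (remove1 b w) ps))"
      (is "?A - ?B = ?C")
    proof
      fix ps
      have "(?A - ?B) ps = (\<Sum>w\<in>Ws. x w * DD (psi b) (Tw w) ps) - 
          (\<Sum>w\<in>Ws. x w * (DD (psi b) (Tw w) ps - y w * of_nat (count_list w b) * Tw (remove1 b w) ps))"
        by (simp only: minus_apply sum_tens_apply)
      also have "\<dots> = (\<Sum>w\<in>Ws. x w * DD (psi b) (Tw w) ps -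
          x w * (DD (psi b) (Tw w) ps - y w * of_nat (count_list w b) * Tw (remove1 b w) ps))"
        by (rule sum_subtractf[symmetric])
      also have "\<dots> = ?C ps"
        unfolding sum_tens_apply by (intro sum.cong refl) (simp only: right_diff_distrib diff_diff_eq2 add_diff_cancel_left' mult.assoc)
      finally show "(?A - ?B) ps = ?C ps" .
    qed
    also have "(\<Sum>w\<in>Ws. (\<lambda>ps. x w * y w * of_nat (count_list w b) * Tw (remove1 b w) ps))
       = (\<Sum>w\<in>?V. (\<lambda>ps. x w * y w * of_nat (count_list w b) * Tw (remove1 b w) ps))"
    proof (rule sum.mono_neutral_right)
      show "\<forall>w\<in>Ws - ?V. (\<lambda>ps. x w * y w * of_nat (count_list w b) * Tw (remove1 b w) ps) = 0"
      proof
        fix w assume "w \<in> Ws - ?V"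
        then have "count_list w b = 0" by (simp add: count_list_0_iff)
        then show "(\<lambda>ps. x w * y w * of_nat (count_list w b) * Tw (remove1 b w) ps) = 0"
          by (intro ext) simp
      qed
    qed (use Suc.prems(1) in auto)
    also have "\<dots> = (\<Sum>v\<in>remove1 b ` ?V. (\<lambda>ps. (x (the_inv_into ?V (remove1 b) v) * y (the_inv_into ?V (remove1 b) v) 
         * of_nat (count_list (the_inv_into ?V (remove1 b) v) b)) * Tw v ps))"
      by (subst sum.reindex[OF inj], rule sum.cong) (simp_all add: the_inv_into_f_f[OF inj])
    finally have "\<forall>v\<in>remove1 b ` ?V. x (the_inv_into ?V (remove1 b) v) * y (the_inv_into ?V (remove1 b) v) 
         * of_nat (count_list (the_inv_into ?V (remove1 b) v) b) = 0"
    proof (rule Suc.IH[rotated 2])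
      show "finite (remove1 b ` ?V)" using Suc.prems(1) by simp
      fix v assume "v \<in> remove1 b ` ?V"
      then obtain w where w: "w \<in> Ws" "b \<in> set w" "v = remove1 b w" by auto
      then show "normal v \<and> set v \<subseteq> lets \<and> length v = r"
        using Suc.prems(2)[OF w(1)] normal_remove1 set_remove1_subset[of b w] by (auto simp: length_remove1)
    qed
    then have "x w0 * y w0 * of_nat (count_list w0 b) = 0"
      using w0 b the_inv_into_f_f[OF inj, of w0] by auto
    then show "x w0 = 0" using y(1)[OF w0] b by (simp add: count_list_0_iff)
  qed
qed

text \<open>Applied to \<open>f0\<close>, a relation becomes one between tensors; the longest words
  with nonzero coefficient then contradict \<open>top_degree_independent\<close>, as the shorter
  ones lie in \<open>Fil r\<close>.\<close>

lemma normal_independent: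
  assumes fin: "finite Ws" and Ws: "\<And>w. w \<in> Ws \<Longrightarrow> normal w \<and> set w \<subseteq> lets"
    and 0: "(\<Sum>w\<in>Ws. const (x w) * wd w) \<in> U_ideal"
  shows "\<forall>w\<in>Ws. x w = 0"
proof (rule ccontr)
  let ?V = "{w \<in> Ws. x w \<noteq> 0}"
  assume "\<not> (\<forall>w\<in>Ws. x w = 0)"
  then have V: "?V \<noteq> {}" "finite ?V" using fin by auto
  define r where "r = Max (length ` ?V)"
  have r: "length w \<le> r" if "w \<in> ?V" for w unfolding r_def using V that by simp
  have "r \<in> length ` ?V" unfolding r_def using V by (intro Max_in) auto
  then obtain w0 where w0: "w0 \<in> ?V" "length w0 = r" by auto
  let ?top = "{w \<in> ?V. length w = r}" and ?low = "{w \<in> ?V. length w < r}"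
  have Act_sum: "Act (\<Sum>w\<in>I. const (x w) * wd w) f0 = (\<Sum>w\<in>I. (\<lambda>ps. x w * Tw w ps))" for I
  proof (induction I rule: infinite_finite_induct)
    case (insert w I)
    show ?case unfolding sum.insert[OF insert(1,2)] Act_add Act_const_mult Act_wd insert(3) by (rule refl)
  qed (simp_all add: zero_fun_def)
  have "(\<Sum>w\<in>?top. (\<lambda>ps. x w * Tw w ps)) + (\<Sum>w\<in>?low. (\<lambda>ps. x w * Tw w ps)) = (\<Sum>w\<in>?top \<union> ?low. (\<lambda>ps. x w * Tw w ps))"
    using fin by (intro sum.union_disjoint[symmetric]) auto
  also have "\<dots> = (\<Sum>w\<in>Ws. (\<lambda>ps. x w * Tw w ps))"
  proof (rule sum.mono_neutral_left)
    show "\<forall>w\<in>Ws - (?top \<union> ?low). (\<lambda>ps. x w * Tw w ps) = 0"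
    proof
      fix w assume w: "w \<in> Ws - (?top \<union> ?low)"
      then have "x w = 0" using r[of w] by fastforce
      then show "(\<lambda>ps. x w * Tw w ps) = 0" by (intro ext) simp
    qed
  qed (use fin in auto)
  also have "\<dots> = (\<lambda>ps. 0)" unfolding Act_sum[symmetric] by (rule Act_U_ideal[OF 0])
  finally have "(\<Sum>w\<in>?top. (\<lambda>ps. x w * Tw w ps)) + (\<Sum>w\<in>?low. (\<lambda>ps. x w * Tw w ps)) = 0"
    by (simp add: zero_fun_def)
  then have "(\<Sum>w\<in>?top. (\<lambda>ps. x w * Tw w ps)) = - (\<Sum>w\<in>?low. (\<lambda>ps. x w * Tw w ps))"
    by (rule eq_neg_iff_add_eq_0[THEN iffD2])
  also have "\<dots> = 0 - (\<Sum>w\<in>?low. (\<lambda>ps. x w * Tw w ps))" by (rule diff_0[symmetric])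
  also have "\<dots> \<in> Fil r"
  proof (rule Fil_diff)
    show "0 \<in> Fil r" using Fil_zero by (simp add: zero_fun_def)
    show "(\<Sum>w\<in>?low. (\<lambda>ps. x w * Tw w ps)) \<in> Fil r"
      using Ws by (intro Fil_sum Fil_scale Tw_Fil) auto
  qed
  finally have "\<forall>w\<in>?top. x w = 0"
    by (intro top_degree_independent[where r = r]) (use fin Ws in auto)
  then show False using w0 by auto
qed

end

section \<open>Spanning by ordered monomials\<close>

lemma const_sum: "const (sum f I) = (\<Sum>i\<in>I. const (f i))"
  by (induction I rule: infinite_finite_induct) (simp_all add: const_add)

lemma span_image_modulo:
  assumes p: "p \<in> FA.span (f ` B \<union> I)" and I: "FA.subspace I"
  obtains Us x where "finite Us" "Us \<subseteq> B" "p - (\<Sum>u\<in>Us. const (x u) * f u) \<in> I"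
proof -
  obtain a b where ab: "p = a + b" "a \<in> FA.span (f ` B)" "b \<in> I"
    using p I by (auto simp: FA.span_Un FA.span_eq_iff[THEN iffD2])
  obtain t r where t: "finite t" "t \<subseteq> f ` B" "a = (\<Sum>v\<in>t. const (r v) * v)"
    using ab(2) by (auto simp: FA.span_explicit)
  obtain Us where Us: "Us \<subseteq> B" "inj_on f Us" "t = f ` Us"
    using t(2) by (auto simp: subset_image_inj)
  have "finite Us" using t(1) Us by (simp add: finite_image_iff)
  moreover have "a = (\<Sum>u\<in>Us. const (r (f u)) * f u)"
    unfolding t(3) Us(3) by (simp add: sum.reindex[OF Us(2)])
  ultimately show ?thesis using that[OF _ Us(1), of "\<lambda>u. r (f u)"] ab by simp
qed

context osp
begin

lemma scale_0: "scale 0 x = 0"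
  by (auto simp: scale_def fun_eq_iff)

lemma gen_fa: "x \<in> G \<Longrightarrow> gen x \<in> fa g"
  by (rule fa_gen) (simp add: g_eq_G)

lemma gen_add: "x \<in> G \<Longrightarrow> y \<in> G \<Longrightarrow> gen (x + y) - (gen x + gen y) \<in> U_ideal"
  using U_rels_U_ideal by (force simp: U_rels_def g_eq_G diff_diff_eq)

lemma gen_scale: "x \<in> G \<Longrightarrow> gen (scale c x) - const c * gen x \<in> U_ideal"
  using U_rels_U_ideal by (force simp: U_rels_def g_eq_G)

lemma gen_comm:
  assumes "x \<in> G" "homog p x" "p < 2" "y \<in> G" "homog q y" "q < 2"
  shows "gen x * gen y - const ((-1) ^ (p * q)) * (gen y * gen x) - gen (bracket x y) \<in> U_ideal"
proof -
  have "gen x * gen y - const ((-1) ^ (p * q)) * gen y * gen x - gen (bracket x y) \<in> U_rels"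
    unfolding U_rels_def using assms by (intro UnI2) (auto simp: osp_part_iff)
  then show ?thesis using U_rels_U_ideal by (auto simp: mult.assoc)
qed

lemma U_ideal_diff: "p \<in> U_ideal \<Longrightarrow> q \<in> U_ideal \<Longrightarrow> p - q \<in> U_ideal"
  by (rule FA.subspace_diff[OF subspace_U_ideal])

lemma gen_0: "gen 0 \<in> U_ideal"
  using gen_scale[of 0 0] by (simp add: scale_0)

lemma gen_sum:
  assumes "\<And>i. i \<in> I \<Longrightarrow> f i \<in> G"
  shows "gen (\<Sum>i\<in>I. scale (c i) (f i)) - (\<Sum>i\<in>I. const (c i) * gen (f i)) \<in> U_ideal"
  using assms
proof (induction I rule: infinite_finite_induct)
  case (insert i I)
  have S: "(\<Sum>i\<in>I. scale (c i) (f i)) \<in> G" using insert.prems by (intro G_sum G_scale) auto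
  have fi: "f i \<in> G" using insert.prems by auto
  have IH: "gen (\<Sum>i\<in>I. scale (c i) (f i)) - (\<Sum>i\<in>I. const (c i) * gen (f i)) \<in> U_ideal"
    using insert by auto
  have "gen (\<Sum>i\<in>insert i I. scale (c i) (f i)) - (\<Sum>i\<in>insert i I. const (c i) * gen (f i)) = 
     (gen (scale (c i) (f i) + (\<Sum>i\<in>I. scale (c i) (f i))) - (gen (scale (c i) (f i)) + gen (\<Sum>i\<in>I. scale (c i) (f i))))
     + (gen (scale (c i) (f i)) - const (c i) * gen (f i)) 
     + (gen (\<Sum>i\<in>I. scale (c i) (f i)) - (\<Sum>i\<in>I. const (c i) * gen (f i)))"
    unfolding sum.insert[OF insert.hyps(1,2)] by (simp add: algebra_simps)
  then show ?case by (simp only: U_ideal_add gen_add[OF G_scale[OF fi] S] gen_scale[OF fi] IH)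
qed (simp_all add: gen_0)

lemma gen_expand:
  assumes "A \<in> G"
  shows "gen A - (\<Sum>b\<in>lets. const (A (fst b) (snd b) / nu b) * gen (F b)) \<in> U_ideal"
  using gen_sum[of lets F "\<lambda>b. A (fst b) (snd b) / nu b"] G_expand[OF assms] F_lets_G by simp

text \<open>Span modulo the relations: computations in the enveloping superalgebra are carried out
  on representatives.\<close>

definition spI :: "endo free_alg set \<Rightarrow> endo free_alg set" where
  "spI X = FA.span (X \<union> U_ideal)"

lemma spI_base: "x \<in> X \<Longrightarrow> x \<in> spI X"
  and spI_U: "x \<in> U_ideal \<Longrightarrow> x \<in> spI X"
  and spI_add: "x \<in> spI X \<Longrightarrow> y \<in> spI X \<Longrightarrow> x + y \<in> spI X"
  and spI_diff: "x \<in> spI X \<Longrightarrow> y \<in> spI X \<Longrightarrow> x - y \<in> spI X"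
  and spI_scale: "x \<in> spI X \<Longrightarrow> const c * x \<in> spI X"
  and spI_0: "0 \<in> spI X"
  and spI_sum: "(\<And>i. i \<in> I \<Longrightarrow> f i \<in> spI X) \<Longrightarrow> sum f I \<in> spI X"
  and spI_mono: "X \<subseteq> Y \<Longrightarrow> x \<in> spI X \<Longrightarrow> x \<in> spI Y"
  unfolding spI_def
  by (auto intro: FA.span_base FA.span_add FA.span_diff FA.span_scale FA.span_sum FA.span_zero
      subsetD[OF FA.span_mono, rotated])

lemma spI_cong: "x - y \<in> U_ideal \<Longrightarrow> y \<in> spI X \<Longrightarrow> x \<in> spI X"
  using spI_add[OF spI_U, of "x - y" y X] by simp

lemma spI_mult_left:
  assumes "x \<in> spI X" "q \<in> fa g" "\<And>x. x \<in> X \<Longrightarrow> q * x \<in> spI Y"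
  shows "q * x \<in> spI Y"
  using assms(1) unfolding spI_def[of X]
  by (rule span_mult_left[of x _ q "Y \<union> U_ideal", folded spI_def]) 
    (use assms(2,3) U_ideal_mult_left spI_U in auto)

lemma spI_mult_right:
  assumes "x \<in> spI X" "q \<in> fa g" "\<And>x. x \<in> X \<Longrightarrow> x * q \<in> spI Y"
  shows "x * q \<in> spI Y"
  using assms(1) unfolding spI_def[of X]
  by (rule span_mult_right[of x _ q "Y \<union> U_ideal", folded spI_def]) 
    (use assms(2,3) U_ideal_mult_right spI_U in auto)

lemma spI_trans: "x \<in> spI X \<Longrightarrow> X \<subseteq> spI Y \<Longrightarrow> x \<in> spI Y"
proof -
  assume x: "x \<in> spI X" and X: "X \<subseteq> spI Y"
  have "FA.span (X \<union> U_ideal) \<subseteq> spI Y"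
    by (rule FA.span_minimal) (use X spI_U in \<open>auto simp: spI_def FA.subspace_span\<close>)
  then show ?thesis using x by (auto simp: spI_def)
qed

end

context osp_weight
begin

lemma lt_fa: "b \<in> lets \<Longrightarrow> lt b \<in> fa g"
  by (simp add: lt_def fa_diff gen_fa F_lets_G)

lemma wd_fa: "set w \<subseteq> lets \<Longrightarrow> wd w \<in> fa g"
  by (induction w) (auto simp: wd_Cons intro: fa_mult lt_fa)

lemma lt_comm:
  assumes b: "b \<in> lets" and c: "c \<in> lets"
  shows "lt b * lt c - const ((-1) ^ (lpar b * lpar c)) * (lt c * lt b) - gen (bracket (F b) (F c)) \<in> U_ideal"
proof -
  let ?s = "const ((-1) ^ (lpar b * lpar c)) :: endo free_alg"
  \<comment> \<open>A nonzero shift belongs to an even letter. The sign is then 1, and the shifts,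
    being central, cancel in the commutator.\<close>
  have "lt b * lt c - ?s * (lt c * lt b) = gen (F b) * gen (F c) - ?s * (gen (F c) * gen (F b))"
  proof (cases "mu b = 0 \<and> mu c = 0")
    case False
    then have "lpar b * lpar c = 0"
      using mu_odd[of b] mu_odd[of c] lpar_less_2[of b] lpar_less_2[of c] by (auto simp: less_2_cases_iff)
    then have "?s = 1" by (simp only: power_0 const_1)
    then show ?thesis
      by (simp add: lt_def algebra_simps const_commute[of "mu b" "gen (F c)"] const_commute[of "mu c" "gen (F b)"]
         const_commute[of "mu b" "const (mu c)"])
  qed (simp add: lt_def)
  then show ?thesis
    using gen_comm[OF F_lets_G[OF b] homog_F[OF b] lpar_less_2 F_lets_G[OF c] homog_F[OF c] lpar_less_2]
    by (simp only:)
qed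

lemma gen_spI_lt:
  assumes A: "A \<in> G"
  shows "gen A \<in> spI (insert 1 (lt ` lets))"
proof (rule spI_cong[OF gen_expand[OF A]], rule spI_sum, rule spI_scale)
  fix b assume b: "b \<in> lets"
  have "gen (F b) = lt b + const (mu b) * 1" by (simp add: lt_def)
  then show "gen (F b) \<in> spI (insert 1 (lt ` lets))"
    using b by (simp only: spI_add spI_scale spI_base insertI1 insertI2 imageI)
qed

text \<open>Only diagonal letters are shifted, so a matrix with zero diagonal expands without a
  constant term. For brackets of letters in \<open>posl\<close> this expresses that
  \<open>lam\<close> defines a character of the Borel subalgebra.\<close>

lemma gen_spI_lt_strict:
  assumes A: "A \<in> G" and L: "\<And>x y. (x, y) \<in> lets \<Longrightarrow> A x y \<noteq> 0 \<Longrightarrow> (x, y) \<in> L" and d: "\<And>x. A x x = 0"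
  shows "gen A \<in> spI (lt ` L)"
proof (rule spI_cong[OF gen_expand[OF A]], rule spI_sum)
  fix b assume b: "b \<in> lets"
  show "const (A (fst b) (snd b) / nu b) * gen (F b) \<in> spI (lt ` L)"
  proof (cases "A (fst b) (snd b) = 0")
    case False
    then have "fst b \<noteq> snd b" "b \<in> L" using d L[of "fst b" "snd b"] b by auto
    then have "gen (F b) = lt b" "b \<in> L" by (auto simp: lt_def mu_def)
    then show ?thesis by (simp add: spI_scale spI_base)
  qed (simp add: spI_0)
qed

section \<open>Negative and nonnegative letters\<close>

definition negl :: "(int \<times> int) set" where
  "negl = {b \<in> lets. ht (fst b) < ht (snd b)}"

definition posl :: "(int \<times> int) set" where
  "posl = {b \<in> lets. ht (fst b) \<ge> ht (snd b)}"

lemma negl_lets: "negl \<subseteq> lets" and posl_lets: "posl \<subseteq> lets"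
  and lets_split: "lets = negl \<union> posl"
  by (auto simp: negl_def posl_def)

lemma F_negl: "b \<in> negl \<Longrightarrow> F b x y \<noteq> 0 \<Longrightarrow> ht x < ht y"
  using F_support[of b x y] lets_inds[of b] by (auto simp: negl_def)

lemma F_posl: "b \<in> posl \<Longrightarrow> F b x y \<noteq> 0 \<Longrightarrow> ht x \<ge> ht y"
  using F_support[of b x y] lets_inds[of b] by (auto simp: posl_def)

lemma F_lets_cartan: "b \<in> lets \<Longrightarrow> F b x x \<noteq> 0 \<Longrightarrow> F b \<in> cartan"
proof -
  assume b: "b \<in> lets" and nz: "F b x x \<noteq> 0"
  have "fst b = snd b" using F_support[OF b nz] lets_inds[OF b] by (auto simp: st_eq_iff)
  then have "F b u v \<noteq> 0 \<Longrightarrow> u = v" for u v using F_support[OF b, of u v] by auto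
  then show ?thesis using F_lets_G[OF b] by (auto simp: cartan_eq)
qed

lemma bracket_negl:
  assumes "b \<in> negl" "c \<in> negl" 
  shows "gen (bracket (F b) (F c)) \<in> spI (lt ` negl)"
proof -
  let ?A = "bracket (F b) (F c)"
  have lets: "b \<in> lets" "c \<in> lets" using assms negl_lets by auto
  have s: "ht x < ht y" if nz: "?A x y \<noteq> 0" for x y
    by (rule bracket_nz[OF nz]) (use F_negl[OF assms(1)] F_negl[OF assms(2)] in \<open>meson less_trans\<close>)
  show ?thesis
    by (rule gen_spI_lt_strict[OF bracket_G[OF F_lets_G[OF lets(1)] F_lets_G[OF lets(2)]]])
      (use s in \<open>fastforce simp: negl_def\<close>)+
qed

lemma bracket_posl:
  assumes "b \<in> posl" "c \<in> posl" 
  shows "gen (bracket (F b) (F c)) \<in> spI (lt ` posl)"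
proof -
  let ?A = "bracket (F b) (F c)"
  have lets: "b \<in> lets" "c \<in> lets" using assms posl_lets by auto
  have G: "?A \<in> G" by (rule bracket_G[OF F_lets_G[OF lets(1)] F_lets_G[OF lets(2)]])
  have s: "ht x \<ge> ht y" if nz: "?A x y \<noteq> 0" for x y
    by (rule bracket_nz[OF nz]) (use F_posl[OF assms(1)] F_posl[OF assms(2)] in \<open>meson order_trans\<close>)
  \<comment> \<open>A nonzero diagonal entry would put a factor into the Cartan subalgebra, and a
    bracket with such an element multiplies diagonal entries by 0.\<close>
  have d: "?A x x = 0" for x
  proof (rule ccontr)
    assume nz: "?A x x \<noteq> 0"
    then obtain z where z: "z \<in> inds" "F b x z \<noteq> 0 \<and> F c z x \<noteq> 0 \<or> F c x z \<noteq> 0 \<and> F b z x \<noteq> 0"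
      by (rule bracket_nz)
    then have "x \<in> inds" using G_inds F_lets_G lets by blast
    have "ht x \<ge> ht z \<and> ht z \<ge> ht x" using z F_posl assms by blast
    then have "x = z" using ht_inj[OF \<open>x \<in> inds\<close> z(1)] by simp
    then have "F b \<in> cartan" using z F_lets_cartan lets by blast
    then show False using bracket_cartan[OF _ F_lets_G[OF lets(2)], of "F b" x x] nz by simp
  qed
  show ?thesis
    by (rule gen_spI_lt_strict[OF G]) (use s d in \<open>auto simp: posl_def\<close>)
qed

section \<open>Straightening of words\<close>

definition Nrm :: "(int \<times> int) set \<Rightarrow> nat \<Rightarrow> endo free_alg set" where
  "Nrm L k = {wd u | u. set u \<subseteq> L \<and> normal u \<and> u \<noteq> [] \<and> length u \<le> k}"

lemma Nrm_mono: "k \<le> l \<Longrightarrow> Nrm L k \<subseteq> Nrm L l"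
  by (auto simp: Nrm_def)

lemma mult_letters_spI:
  assumes "p \<in> spI (lt ` L)" "q \<in> fa g" "\<And>b. b \<in> L \<Longrightarrow> lt b * q \<in> spI Y"
  shows "p * q \<in> spI Y"
  by (rule spI_mult_right[OF assms(1,2)]) (use assms(3) in auto)

text \<open>Moving \<open>c\<close> to its place costs brackets, which shorten the word and are
  absorbed by \<open>IH\<close>. The leading words are tracked by their multiset, because putting a
  letter in front of them requires knowing which letters occur.\<close>

lemma insert_normal:
  assumes L: "L \<subseteq> lets" and br: "\<And>b c. b \<in> L \<Longrightarrow> c \<in> L \<Longrightarrow> gen (bracket (F b) (F c)) \<in> spI (lt ` L)"
    and IH: "\<And>w. set w \<subseteq> L \<Longrightarrow> w \<noteq> [] \<Longrightarrow> length w \<le> k \<Longrightarrow> wd w \<in> spI (Nrm L (length w))"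
    and v: "set v \<subseteq> L" "normal v" "length v \<le> k" and c: "c \<in> L"
  shows "wd (c # v) \<in> spI ({wd u | u. normal u \<and> mset u = mset (c # v)} \<union> Nrm L (length v))"
  using v
proof (induction v)
  case Nil
  then show ?case by (intro spI_base) (auto simp: normal_Cons intro!: exI[of _ "[c]"])
next
  case (Cons d v)
  have d: "d \<in> L" and v: "set v \<subseteq> L" "normal v" "length v \<le> k" using Cons.prems by (auto simp: normal_Cons)
  have vf: "wd v \<in> fa g" using v(1) L by (intro wd_fa) auto
  let ?X = "{wd u | u. normal u \<and> mset u = mset (c # d # v)} \<union> Nrm L (length (d # v))"
  have low: "gen (bracket (F c) (F d)) * wd v \<in> spI ?X"
  proof (rule mult_letters_spI[OF br[OF c d] vf])
    fix b assume "b \<in> L"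
    then have "wd (b # v) \<in> spI (Nrm L (length (b # v)))" using v Cons.prems by (intro IH) auto
    then show "lt b * wd v \<in> spI ?X" 
      unfolding wd_Cons by (rule spI_mono[rotated]) auto
  qed
  have comm: "wd (c # d # v) - (const ((-1) ^ (lpar c * lpar d)) * (lt d * wd (c # v)) + gen (bracket (F c) (F d)) * wd v) \<in> U_ideal"
  proof -
    have "c \<in> lets" "d \<in> lets" using c d L by auto
    from U_ideal_mult_right[OF lt_comm[OF this] vf]
    show ?thesis by (simp add: wd_Cons algebra_simps)
  qed
  consider "RR c d" | "c = d" "lpar c = 1" | "key d < key c"
    using lpar_less_2[of c] key_inj[of c d] linorder_less_linear[of "key c" "key d"]
    unfolding RR_def by (auto simp: less_2_cases_iff)
  then show ?case
  proof cases
    case 1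
    then have "normal (c # d # v)" using Cons.prems by (auto simp: normal_Cons intro: RR_trans)
    then show ?thesis by (intro spI_base) auto
  next
    case 2
    \<comment> \<open>For an odd letter twice the square is the bracket, so a repetition reduces to
      shorter words.\<close>
    have "wd (c # d # v) + wd (c # d # v) - gen (bracket (F c) (F d)) * wd v \<in> U_ideal"
      using comm 2 by (simp add: wd_Cons const_uminus algebra_simps)
    from spI_cong[OF this low] have "const (1 / 2) * (wd (c # d # v) + wd (c # d # v)) \<in> spI ?X" by (rule spI_scale)
    moreover have "const (1 / 2) * (wd (c # d # v) + wd (c # d # v)) = wd (c # d # v)"
      by (simp add: distrib_left flip: distrib_right const_add)
    ultimately show ?thesis by simp
  next
    case 3
    have "lt d * wd (c # v) \<in> spI ?X"
    proof (rule spI_mult_left[OF Cons.IH[OF v]])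
      show "lt d \<in> fa g" using d L by (intro lt_fa) auto
      fix p assume "p \<in> {wd u | u. normal u \<and> mset u = mset (c # v)} \<union> Nrm L (length v)"
      then consider u where "p = wd u" "normal u" "mset u = mset (c # v)" | u where "p = wd u" "set u \<subseteq> L" "length u \<le> length v"
        by (auto simp: Nrm_def)
      then show "lt d * p \<in> spI ?X"
      proof cases
        case 1
        \<comment> \<open>\<open>d\<close> precedes \<open>c\<close> by assumption and the letters
          of \<open>v\<close> by normality; the multiset shows that \<open>u\<close> has no other
          letters.\<close>
        have "set u = set (c # v)" using 1(3) by (metis set_mset_mset)
        moreover have "RR d c" using 3 by (simp add: RR_def)
        ultimately have "normal (d # u)" using Cons.prems 1(2) by (auto simp: normal_Cons)
        moreover have "mset (d # u) = mset (c # d # v)" using 1(3) by simp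
        ultimately show ?thesis unfolding 1(1) wd_Cons[symmetric] by (intro spI_base) blast
      next
        case 2
        have "wd (d # u) \<in> spI (Nrm L (length (d # u)))" using 2 d Cons.prems by (intro IH) auto
        moreover have "Nrm L (length (d # u)) \<subseteq> ?X" using Nrm_mono[of "length (d # u)" "length (d # v)" L] 2(3) by auto
        ultimately show ?thesis unfolding 2(1) wd_Cons[symmetric] by (rule spI_mono[rotated])
      qed
    qed
    then show ?thesis using comm low by (intro spI_cong[OF comm] spI_add spI_scale)
  qed
qed

lemma sort_words:
  assumes L: "L \<subseteq> lets" and br: "\<And>b c. b \<in> L \<Longrightarrow> c \<in> L \<Longrightarrow> gen (bracket (F b) (F c)) \<in> spI (lt ` L)"
  shows "set w \<subseteq> L \<Longrightarrow> w \<noteq> [] \<Longrightarrow> length w \<le> k \<Longrightarrow> wd w \<in> spI (Nrm L (length w))"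
proof (induction k arbitrary: w)
  case (Suc k)
  obtain c w' where w: "w = c # w'" using Suc.prems(2) by (cases w) auto
  have c: "c \<in> L" and w': "set w' \<subseteq> L" "length w' \<le> k" using Suc.prems w by auto
  have ins: "wd (c # v) \<in> spI (Nrm L (length w))" if v: "set v \<subseteq> L" "normal v" "length v \<le> length w'" for v
  proof (rule spI_trans[OF insert_normal[OF L br Suc.IH v(1,2) _ c]])
    show "length v \<le> k" using v(3) w'(2) by simp
    have "wd u \<in> Nrm L (length w)" if "normal u" "mset u = mset (c # v)" for u
    proof -
      have "set u = set (c # v)" "length u = length (c # v)" using that(2) by (metis set_mset_mset, metis size_mset)
      then show ?thesis using that v c unfolding Nrm_def w by fastforce
    qed
    moreover have "Nrm L (length v) \<subseteq> Nrm L (length w)" using v w by (intro Nrm_mono) simp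
    ultimately show "{wd u |u. normal u \<and> mset u = mset (c # v)} \<union> Nrm L (length v) \<subseteq> spI (Nrm L (length w))"
      by (auto intro!: spI_base)
  qed
  show ?case
  proof (cases "w' = []")
    case True
    then show ?thesis using ins[of "[]"] w by simp
  next
    case False
    have "lt c * wd w' \<in> spI (Nrm L (length w))"
    proof (rule spI_mult_left[OF Suc.IH[OF w'(1) False w'(2)]])
      show "lt c \<in> fa g" using c L by (intro lt_fa) auto
      fix p assume "p \<in> Nrm L (length w')"
      then show "lt c * p \<in> spI (Nrm L (length w))" using ins by (auto simp: Nrm_def wd_Cons)
    qed
    then show ?thesis by (simp add: w wd_Cons)
  qed
qed simp

lemma sort_negl: "set w \<subseteq> negl \<Longrightarrow> wd w \<in> spI {wd u | u. set u \<subseteq> negl \<and> normal u}"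
proof (cases "w = []")
  case True
  then show ?thesis by (intro spI_base) (auto intro!: exI[of _ "[]"])
next
  case False
  assume "set w \<subseteq> negl"
  from sort_words[OF negl_lets bracket_negl this False order_refl]
  show ?thesis by (rule spI_mono[rotated]) (auto simp: Nrm_def)
qed

text \<open>Since brackets within \<open>posl\<close> have no constant term, sorting a nonempty word
  never leads to the empty one; this matters because nonempty words in \<open>posl\<close> kill the
  highest weight vector.\<close>

lemma sort_posl: "set w \<subseteq> posl \<Longrightarrow> w \<noteq> [] \<Longrightarrow> wd w \<in> spI {wd u | u. set u \<subseteq> posl \<and> normal u \<and> u \<noteq> []}"
  by (rule spI_mono[OF _ sort_words[OF posl_lets bracket_posl _ _ order_refl]]) (auto simp: Nrm_def)

section \<open>Triangular form of products\<close>

definition Tri :: "endo free_alg set" where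
  "Tri = {wd u * wd v | u v. set u \<subseteq> negl \<and> set v \<subseteq> posl}"

lemma Tri_mult_negl:
  assumes "p \<in> spI Tri" "b \<in> negl"
  shows "lt b * p \<in> spI Tri"
proof (rule spI_mult_left[OF assms(1)])
  show "lt b \<in> fa g" using assms(2) negl_lets by (intro lt_fa) auto
  fix x assume "x \<in> Tri"
  then obtain u v where x: "x = wd u * wd v" "set u \<subseteq> negl" "set v \<subseteq> posl" by (auto simp: Tri_def)
  then have "lt b * x = wd (b # u) * wd v" "set (b # u) \<subseteq> negl" using assms(2) by (simp_all add: wd_Cons mult.assoc)
  then show "lt b * x \<in> spI Tri" using x(3) unfolding Tri_def by (intro spI_base) blast
qed

text \<open>Moving \<open>c\<close> through \<open>u\<close> creates brackets with letters of
  \<open>negl\<close>, which involve constants and letters of both kinds. Hence \<open>c\<close> is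
  arbitrary in the induction on \<open>u\<close>.\<close>

lemma posl_Tri:
  assumes "set u \<subseteq> negl" "set v \<subseteq> posl" "c \<in> posl"
  shows "lt c * (wd u * wd v) \<in> spI Tri"
  using assms
proof (induction u arbitrary: c v)
  case Nil
  then have "lt c * (wd [] * wd v) = wd [] * wd (c # v)" "set (c # v) \<subseteq> posl" by (simp_all add: wd_Cons)
  then show ?case unfolding Tri_def by (intro spI_base) fastforce
next
  case (Cons d u)
  have d: "d \<in> negl" and u: "set u \<subseteq> negl" using Cons.prems by auto
  have lets: "c \<in> lets" "d \<in> lets" using d Cons.prems posl_lets negl_lets by auto
  have uf: "wd u * wd v \<in> fa g" using u Cons.prems(2) posl_lets negl_lets by (intro fa_mult wd_fa) auto
  have 1: "lt d * (lt c * (wd u * wd v)) \<in> spI Tri"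
    using Tri_mult_negl[OF Cons.IH[OF u Cons.prems(2,3)] d] .
  have 2: "gen (bracket (F c) (F d)) * (wd u * wd v) \<in> spI Tri"
  proof (rule spI_mult_right[OF gen_spI_lt uf])
    show "bracket (F c) (F d) \<in> G" by (rule bracket_G[OF F_lets_G[OF lets(1)] F_lets_G[OF lets(2)]])
    fix x assume "x \<in> insert 1 (lt ` lets)"
    then consider "x = 1" | e where "x = lt e" "e \<in> negl" | e where "x = lt e" "e \<in> posl"
      using lets_split by auto
    then show "x * (wd u * wd v) \<in> spI Tri"
    proof cases
      case 1
      then show ?thesis using u Cons.prems(2) unfolding Tri_def by (intro spI_base) auto
    next
      case 2
      have "wd u * wd v \<in> spI Tri" using u Cons.prems(2) unfolding Tri_def by (intro spI_base) auto
      then show ?thesis unfolding 2(1) using 2(2) by (rule Tri_mult_negl)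
    next
      case 3
      then show ?thesis using Cons.IH[OF u Cons.prems(2)] by simp
    qed
  qed
  have "lt c * (wd (d # u) * wd v) - (const ((-1) ^ (lpar c * lpar d)) * (lt d * (lt c * (wd u * wd v)))
      + gen (bracket (F c) (F d)) * (wd u * wd v)) \<in> U_ideal"
    using U_ideal_mult_right[OF lt_comm[OF lets] uf] by (simp add: wd_Cons algebra_simps)
  from spI_cong[OF this spI_add[OF spI_scale[OF 1] 2]] show ?case .
qed

lemma lt_mult_Tri:
  assumes "p \<in> spI Tri" "b \<in> lets"
  shows "lt b * p \<in> spI Tri"
proof (cases "b \<in> negl")
  case False
  then have b: "b \<in> posl" using assms(2) lets_split by auto
  show ?thesis
  proof (rule spI_mult_left[OF assms(1) lt_fa[OF assms(2)]])
    fix x assume "x \<in> Tri"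
    then obtain u v where "x = wd u * wd v" "set u \<subseteq> negl" "set v \<subseteq> posl" by (auto simp: Tri_def)
    then show "lt b * x \<in> spI Tri" using posl_Tri[OF _ _ b] by simp
  qed
qed (rule Tri_mult_negl[OF assms(1)])

lemma fa_Tri: "p \<in> fa g \<Longrightarrow> p \<in> spI Tri"
proof -
  have "mon w \<in> spI Tri" if "set w \<subseteq> g" for w
    using that
  proof (induction w)
    case Nil
    show ?case unfolding Tri_def by (intro spI_base) (auto intro!: exI[of _ "[]"])
  next
    case (Cons x w)
    have x: "x \<in> G" and w: "mon w \<in> spI Tri" using Cons by (auto simp: g_eq_G)
    have "gen x * mon w \<in> spI Tri"
    proof (rule spI_mult_right[OF gen_spI_lt[OF x]])
      show "mon w \<in> fa g" using Cons.prems by (intro fa_mon) auto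
      fix y assume "y \<in> insert 1 (lt ` lets)"
      then show "y * mon w \<in> spI Tri" using w lt_mult_Tri by auto
    qed
    then show ?case by (simp add: mon_Cons)
  qed
  then have "FA.span (mon ` lists g) \<subseteq> spI Tri"
    unfolding spI_def by (intro FA.span_minimal FA.subspace_span) (auto simp: in_lists_conv_set)
  then show "p \<in> fa g \<Longrightarrow> p \<in> spI Tri" by (auto simp: fa_eq_span)
qed

text \<open>The left ideal that annihilates the highest weight vector.\<close>

definition K :: "endo free_alg set" where
  "K = spI ({p * (gen h - const (ev lam h)) | p h. p \<in> fa g \<and> h \<in> cartan} \<union> {p * gen x | p x. p \<in> fa g \<and> x \<in> n_pos})"

lemma K_U: "p \<in> U_ideal \<Longrightarrow> p \<in> K"
  and K_add: "p \<in> K \<Longrightarrow> q \<in> K \<Longrightarrow> p + q \<in> K"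
  and K_diff: "p \<in> K \<Longrightarrow> q \<in> K \<Longrightarrow> p - q \<in> K"
  and K_scale: "p \<in> K \<Longrightarrow> const c * p \<in> K"
  and K_0: "0 \<in> K"
  and K_sum: "(\<And>i. i \<in> I \<Longrightarrow> f i \<in> K) \<Longrightarrow> sum f I \<in> K"
  unfolding K_def by (auto intro: spI_U spI_add spI_diff spI_scale spI_0 spI_sum)

lemma K_cartan: "p \<in> fa g \<Longrightarrow> h \<in> cartan \<Longrightarrow> p * (gen h - const (ev lam h)) \<in> K"
  and K_npos: "p \<in> fa g \<Longrightarrow> x \<in> n_pos \<Longrightarrow> p * gen x \<in> K"
  unfolding K_def by (rule spI_base; blast)+

lemma K_mult:
  assumes "p \<in> K" "q \<in> fa g"
  shows "q * p \<in> K"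
  using assms(1) unfolding K_def
proof (rule spI_mult_left[OF _ assms(2)], fold K_def)
  fix x assume "x \<in> {p * (gen h - const (ev lam h)) | p h. p \<in> fa g \<and> h \<in> cartan} \<union> {p * gen x | p x. p \<in> fa g \<and> x \<in> n_pos}"
  then consider p h where "x = p * (gen h - const (ev lam h))" "p \<in> fa g" "h \<in> cartan" | p y where "x = p * gen y" "p \<in> fa g" "y \<in> n_pos"
    by blast
  then show "q * x \<in> K"
  proof cases
    case 1
    then show ?thesis using K_cartan[of "q * p" h] assms(2) by (simp add: fa_mult mult.assoc)
  next
    case 2
    then show ?thesis using K_npos[of "q * p" y] assms(2) by (simp add: fa_mult mult.assoc)
  qed
qed

lemma K_cong: "p - q \<in> K \<Longrightarrow> q \<in> K \<longleftrightarrow> p \<in> K"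
  using K_add[of "p - q" q] K_diff[of p "p - q"] by auto

lemma lt_posl_cases:
  assumes "b \<in> posl"
  obtains c where "c \<in> W" "b = (c, c)" "lt b = gen (F b) - const (ev lam (F b))" "F b \<in> cartan"
  | "F b \<in> n_pos" "lt b = gen (F b)"
proof -
  obtain x y where b: "b = (x, y)" by (cases b)
  have l: "b \<in> lets" using assms posl_lets by auto
  show ?thesis
  proof (cases "x = y")
    case True
    then have x: "x \<in> W" using l diag_lets_iff b by simp
    show ?thesis
      by (rule that(1)[OF x]) (use True x in \<open>auto simp: b lt_def mu_def ev_F_diag F_diag_cartan\<close>)
  next
    case False
    have "ht x > ht y" using assms False ht_inj[of x y] lets_inds[OF l] by (fastforce simp: posl_def b)
    then have "F b u v \<noteq> 0 \<Longrightarrow> ht u > ht v" for u v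
      using F_support[OF l, of u v] lets_inds[OF l] by (auto simp: b)
    then have "F b \<in> n_pos" using F_lets_G[OF l] by (simp add: n_pos_eq)
    moreover have "lt b = gen (F b)" using False by (simp add: lt_def mu_def b)
    ultimately show ?thesis by (rule that(2))
  qed
qed

lemma K_lt: "p \<in> fa g \<Longrightarrow> b \<in> posl \<Longrightarrow> p * lt b \<in> K"
  by (erule lt_posl_cases) (auto intro: K_cartan K_npos)

lemma K_wd: "p \<in> fa g \<Longrightarrow> set v \<subseteq> posl \<Longrightarrow> v \<noteq> [] \<Longrightarrow> p * wd v \<in> K"
proof (induction v arbitrary: p rule: rev_induct)
  case (snoc b v)
  have "wd v \<in> fa g" using snoc.prems posl_lets by (intro wd_fa) auto
  then have "(p * wd v) * lt b \<in> K" using snoc.prems by (intro K_lt fa_mult) auto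
  then show ?case by (simp add: wd_append wd_Cons mult.assoc)
qed simp

text \<open>Modulo relations its span meets that of the normal words in \<open>negl\<close> only in
  0, by \<open>normal_independent\<close>. So it serves as an upper bound for
  \<open>K\<close>.\<close>

definition TriK :: "endo free_alg set" where
  "TriK = {wd u | u. normal u \<and> set u \<subseteq> lets \<and> \<not> set u \<subseteq> negl}"

lemma normal_negl_posl: "set u \<subseteq> negl \<Longrightarrow> set v \<subseteq> posl \<Longrightarrow> normal u \<Longrightarrow> normal v \<Longrightarrow> normal (u @ v)"
  by (fastforce simp: normal_append RR_def key_def negl_def posl_def)

lemma negl_posl_disjoint: "negl \<inter> posl = {}"
  by (auto simp: negl_def posl_def)

lemma wd_TriK:
  assumes "set u \<subseteq> negl" "set v \<subseteq> posl" "v \<noteq> []"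
  shows "wd u * wd v \<in> spI TriK"
proof -
  have vf: "wd v \<in> fa g" using assms posl_lets by (intro wd_fa) auto
  show ?thesis
  proof (rule spI_mult_right[OF sort_negl[OF assms(1)] vf])
    fix x assume "x \<in> {wd u |u. set u \<subseteq> negl \<and> normal u}"
    then obtain u' where x: "x = wd u'" and u': "set u' \<subseteq> negl" "normal u'" by blast
    show "x * wd v \<in> spI TriK"
    proof (rule spI_mult_left[OF sort_posl[OF assms(2,3)]])
      show "x \<in> fa g" using u' negl_lets unfolding x by (intro wd_fa) auto
      fix y assume "y \<in> {wd u |u. set u \<subseteq> posl \<and> normal u \<and> u \<noteq> []}"
      then obtain v' where y: "y = wd v'" and v': "set v' \<subseteq> posl" "normal v'" "v' \<noteq> []" by blast
      have "x * y = wd (u' @ v')" by (simp add: x y wd_append)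
      moreover have "\<not> set (u' @ v') \<subseteq> negl"
        using v' negl_posl_disjoint by (cases v') auto
      ultimately show "x * y \<in> spI TriK"
        using normal_negl_posl[OF u'(1) v'(1) u'(2) v'(2)] u'(1) v'(1) negl_lets posl_lets unfolding TriK_def
        by (intro spI_base CollectI exI[of _ "u' @ v'"]) auto
    qed
  qed
qed

text \<open>In triangular form the last letter \<open>b\<close> joins the factor in
  \<open>posl\<close>, which is then nonempty and stays so under sorting.\<close>

lemma Tri_lt_TriK:
  assumes "p \<in> fa g" "b \<in> posl"
  shows "p * lt b \<in> spI TriK"
proof (rule spI_mult_right[OF fa_Tri[OF assms(1)]])
  show "lt b \<in> fa g" using assms posl_lets by (intro lt_fa) auto
  fix x assume "x \<in> Tri"
  then obtain u v where x: "x = wd u * wd v" "set u \<subseteq> negl" "set v \<subseteq> posl" by (auto simp: Tri_def)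
  then have "x * lt b = wd u * wd (v @ [b])" by (simp add: wd_append wd_Cons mult.assoc)
  then show "x * lt b \<in> spI TriK" using wd_TriK[of u "v @ [b]"] x assms(2) by simp
qed

lemma K_TriK: "p \<in> K \<Longrightarrow> p \<in> spI TriK"
  unfolding K_def
proof (erule spI_trans, safe)
  fix p h assume p: "p \<in> fa g" and h: "h \<in> cartan"
  have hG: "h \<in> G" using h by (simp add: cartan_eq)
  let ?c = "\<lambda>b. h (fst b) (snd b) / nu b"
  have b: "const (?c b) * (gen (F b) - const (ev lam (F b))) \<in> spI (lt ` posl)" if "b \<in> lets" for b
  proof (cases "fst b = snd b")
    case True
    then obtain c where "b = (c, c)" by (cases b) auto
    then have c: "b = (c, c)" "c \<in> W" using that diag_lets_iff by auto
    then have "gen (F b) - const (ev lam (F b)) = lt b" "b \<in> posl"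
      using that by (auto simp: lt_def mu_def ev_F_diag posl_def)
    then show ?thesis by (auto intro: spI_scale spI_base)
  next
    case False
    then have "h (fst b) (snd b) = 0" using h by (auto simp: cartan_eq)
    then show ?thesis by (simp add: spI_0)
  qed
  \<comment> \<open>Expanding \<open>h\<close> and its value under \<open>lam\<close> with the same
    coefficients lets the shift be distributed over the letters.\<close>
  have "ev lam h = (\<Sum>b\<in>lets. ?c b * ev lam (F b))"
    by (subst G_expand[OF hG]) (simp add: ev_sum_right ev_scale_right)
  then have ce: "const (ev lam h) = (\<Sum>b\<in>lets. const (?c b) * const (ev lam (F b)))"
    by (simp add: const_sum flip: const_mult)
  have "gen h - const (ev lam h) - (\<Sum>b\<in>lets. const (?c b) * (gen (F b) - const (ev lam (F b))))
      = gen h - (\<Sum>b\<in>lets. const (?c b) * gen (F b))"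
    unfolding right_diff_distrib sum_subtractf ce by simp
  then have "gen h - const (ev lam h) - (\<Sum>b\<in>lets. const (?c b) * (gen (F b) - const (ev lam (F b)))) \<in> U_ideal"
    using gen_expand[OF hG] by (simp only:)
  from spI_cong[OF this spI_sum[OF b]] have "gen h - const (ev lam h) \<in> spI (lt ` posl)" by simp
  then show "p * (gen h - const (ev lam h)) \<in> spI TriK"
    by (rule spI_mult_left[OF _ p]) (use Tri_lt_TriK[OF p] in auto)
next
  fix p x assume p: "p \<in> fa g" and x: "x \<in> n_pos"
  have "gen x \<in> spI (lt ` posl)"
  proof (rule gen_spI_lt_strict)
    show "x \<in> G" using x by (simp add: n_pos_eq)
    show "x u u = 0" for u using x by (force simp: n_pos_eq)
    show "(u, v) \<in> posl" if "(u, v) \<in> lets" "x u v \<noteq> 0" for u v using x that by (auto simp: n_pos_eq posl_def intro: less_imp_le)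
  qed
  then show "p * gen x \<in> spI TriK"
    by (rule spI_mult_left[OF _ p]) (use Tri_lt_TriK[OF p] in auto)
qed

lemma subspace_K: "FA.subspace K"
  unfolding K_def spI_def by (rule FA.subspace_span)

text \<open>In triangular form every product with a nonempty factor in \<open>posl\<close> lies in
  \<open>K\<close>.\<close>

theorem verma_spanning:
  assumes "p \<in> fa g"
  obtains Us x where "finite Us" "Us \<subseteq> {u. set u \<subseteq> negl \<and> normal u}" "p - (\<Sum>u\<in>Us. const (x u) * wd u) \<in> K"
proof -
  let ?B = "{u. set u \<subseteq> negl \<and> normal u}"
  have neg: "wd u \<in> FA.span (wd ` ?B \<union> K)" if "set u \<subseteq> negl" for u
  proof -
    have "{wd u | u. set u \<subseteq> negl \<and> normal u} \<union> U_ideal \<subseteq> wd ` ?B \<union> K" using K_U by auto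
    then show ?thesis using sort_negl[OF that] FA.span_mono unfolding spI_def by blast
  qed
  have "Tri \<union> U_ideal \<subseteq> FA.span (wd ` ?B \<union> K)"
  proof -
    have K: "K \<subseteq> FA.span (wd ` ?B \<union> K)" by (auto intro: FA.span_base)
    have "wd u * wd v \<in> FA.span (wd ` ?B \<union> K)" if "set u \<subseteq> negl" "set v \<subseteq> posl" for u v
    proof (cases "v = []")
      case True
      then show ?thesis using neg[OF that(1)] by simp
    next
      case False
      have "wd u \<in> fa g" using that negl_lets by (intro wd_fa) auto
      then show ?thesis using K_wd[OF _ that(2) False] K by blast
    qed
    then show ?thesis using K_U K unfolding Tri_def by blast
  qed
  then have "spI Tri \<subseteq> FA.span (wd ` ?B \<union> K)"
    unfolding spI_def by (intro FA.span_minimal FA.subspace_span)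
  then have "p \<in> FA.span (wd ` ?B \<union> K)" using fa_Tri[OF assms] by blast
  then show ?thesis using that by (rule span_image_modulo[OF _ subspace_K])
qed

text \<open>An element of \<open>K\<close> is a combination of normal words with a letter outside
  \<open>negl\<close>. Those differ from the given words, so a relation modulo \<open>K\<close>
  becomes one between distinct normal words modulo \<open>U_ideal\<close>.\<close>

theorem verma_independent:
  assumes fin: "finite Us" and Us: "Us \<subseteq> {u. set u \<subseteq> negl \<and> normal u}"
    and K: "(\<Sum>u\<in>Us. const (x u) * wd u) \<in> K"
  shows "\<forall>u\<in>Us. x u = 0"
proof -
  let ?B = "{u. normal u \<and> set u \<subseteq> lets \<and> \<not> set u \<subseteq> negl}"
  have "TriK = wd ` ?B" by (auto simp: TriK_def)
  then have "(\<Sum>u\<in>Us. const (x u) * wd u) \<in> FA.span (wd ` ?B \<union> U_ideal)"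
    using K_TriK[OF K] unfolding spI_def by simp
  then obtain Vs y where V: "finite Vs" "Vs \<subseteq> ?B"
    "(\<Sum>u\<in>Us. const (x u) * wd u) - (\<Sum>v\<in>Vs. const (y v) * wd v) \<in> U_ideal"
    by (rule span_image_modulo[OF _ subspace_U_ideal])
  have dj: "Us \<inter> Vs = {}" using Us V by auto
  define z where "z w = (if w \<in> Us then x w else - y w)" for w
  have "(\<Sum>w\<in>Us \<union> Vs. const (z w) * wd w) = (\<Sum>u\<in>Us. const (z u) * wd u) + (\<Sum>v\<in>Vs. const (z v) * wd v)"
    using fin V dj by (intro sum.union_disjoint) auto
  also have "(\<Sum>u\<in>Us. const (z u) * wd u) = (\<Sum>u\<in>Us. const (x u) * wd u)"
    by (intro sum.cong) (auto simp: z_def)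
  also have "(\<Sum>v\<in>Vs. const (z v) * wd v) = - (\<Sum>v\<in>Vs. const (y v) * wd v)"
    unfolding sum_negf[symmetric] using dj by (intro sum.cong) (auto simp: z_def const_uminus)
  finally have "(\<Sum>w\<in>Us \<union> Vs. const (z w) * wd w) \<in> U_ideal" using V(3) by simp
  from normal_independent[OF _ _ this] have "\<forall>w\<in>Us \<union> Vs. z w = 0"
    using fin V Us negl_lets by auto
  then have "\<forall>u\<in>Us. z u = 0" by blast
  then show ?thesis by (simp add: z_def)
qed

end

section \<open>Verma modules as quotients of the free algebra\<close>

context osp
begin

section \<open>Cosets in the enveloping superalgebra\<close>

definition cls :: "endo free_alg \<Rightarrow> endo free_alg set" where
  "cls p = U_ideal +>\<^bsub>free_algebra g\<^esub> p"

lemma cls_eq: "cls p = {u + p | u. u \<in> U_ideal}"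
  by (auto simp: cls_def a_r_coset_def')

lemma inU_cls: "inU x = cls (gen x)" and scalU_cls: "scalU c = cls (const c)"
  by (simp_all add: inU_def scalU_def cls_def)

lemma cls_eqI: "p - q \<in> U_ideal \<Longrightarrow> cls p = cls q"
proof -
  have sub: "cls p \<subseteq> cls q" if d: "p - q \<in> U_ideal" for p q
  proof
    fix x assume "x \<in> cls p"
    then obtain u where u: "x = u + p" "u \<in> U_ideal" by (auto simp: cls_eq)
    then have "x = (u + (p - q)) + q" "u + (p - q) \<in> U_ideal" using d U_ideal_add by auto
    then show "x \<in> cls q" unfolding cls_eq by blast
  qed
  assume d: "p - q \<in> U_ideal"
  then have "q - p \<in> U_ideal" using U_ideal_diff[OF U_ideal_0 d] by simp
  then show ?thesis using sub d by blast
qed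

lemma cls_eqD: "cls p = cls q \<Longrightarrow> p - q \<in> U_ideal"
proof -
  assume e: "cls p = cls q"
  have "p \<in> cls p" unfolding cls_eq using U_ideal_0 by force
  then show ?thesis unfolding e by (auto simp: cls_eq)
qed

lemma ring_U: "ring U"
  unfolding U_def by (rule ideal.quotient_is_ring[OF ideal_U_ideal])

lemma cls_hom: "cls \<in> ring_hom (free_algebra g) U"
  using ideal.rcos_ring_hom[OF ideal_U_ideal] unfolding U_def cls_def by simp

lemma cls_mult: "p \<in> fa g \<Longrightarrow> q \<in> fa g \<Longrightarrow> cls p \<otimes>\<^bsub>U\<^esub> cls q = cls (p * q)"
  and cls_add: "p \<in> fa g \<Longrightarrow> q \<in> fa g \<Longrightarrow> cls p \<oplus>\<^bsub>U\<^esub> cls q = cls (p + q)"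
  and cls_1: "\<one>\<^bsub>U\<^esub> = cls 1"
  and cls_carrier: "p \<in> fa g \<Longrightarrow> cls p \<in> carrier U"
  using cls_hom by (simp_all add: ring_hom_def Pi_iff)

lemma cls_0: "\<zero>\<^bsub>U\<^esub> = cls 0"
  by (auto simp: U_def FactRing_def cls_eq)

lemma carrier_U: "carrier U = cls ` fa g"
  by (auto simp: U_def FactRing_def A_RCOSETS_defs cls_def a_r_coset_def)

lemma cls_finsum:
  assumes "finite I" "\<And>i. i \<in> I \<Longrightarrow> f i \<in> fa g"
  shows "(\<Oplus>\<^bsub>U\<^esub>i\<in>I. cls (f i)) = cls (\<Sum>i\<in>I. f i)"
proof -
  interpret U: ring U by (rule ring_U)
  show ?thesis
    using assms
  proof (induction I rule: finite_induct)
    case empty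
    then show ?case by (simp add: cls_0)
  next
    case (insert i I)
    have "(\<lambda>i. cls (f i)) \<in> I \<rightarrow> carrier U" using insert.prems cls_carrier by auto
    then show ?case
      using insert by (simp add: U.finsum_insert cls_carrier cls_add fa_sum)
  qed
qed

lemma foldr_cls: "set xs \<subseteq> G \<Longrightarrow> foldr (\<lambda>x u. inU x \<otimes>\<^bsub>U\<^esub> u) xs \<one>\<^bsub>U\<^esub> = cls (mon xs)"
proof (induction xs)
  case (Cons x xs)
  have "mon xs \<in> fa g" using Cons.prems by (intro fa_mon) (auto simp: g_eq_G)
  then show ?case using Cons by (simp add: inU_cls cls_mult gen_fa mon_Cons)
qed (simp add: cls_1)

lemma cls_gen_ring:
  assumes "set xs \<subseteq> X" "X \<subseteq> G"
  shows "cls (mon xs) \<in> generate_ring U (range scalU \<union> inU ` X)"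
  using assms(1)
proof (induction xs)
  case Nil
  then show ?case using generate_ring.one by (simp flip: cls_1)
next
  case (Cons x xs)
  have "mon xs \<in> fa g" "x \<in> G" using Cons.prems assms(2) by (auto intro!: fa_mon simp: g_eq_G)
  then have "cls (mon (x # xs)) = inU x \<otimes>\<^bsub>U\<^esub> cls (mon xs)" by (simp add: inU_cls cls_mult gen_fa mon_Cons)
  moreover have "inU x \<in> generate_ring U (range scalU \<union> inU ` X)"
    using Cons.prems by (intro generate_ring.incl) auto
  ultimately show ?case using Cons by (auto intro: generate_ring.eng_mult)
qed

lemma cls_sum_generate:
  assumes "finite I" "\<And>i. i \<in> I \<Longrightarrow> cls (f i) \<in> generate_ring U Z" "\<And>i. i \<in> I \<Longrightarrow> f i \<in> fa g"
  shows "cls (\<Sum>i\<in>I. f i) \<in> generate_ring U Z"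
  using assms
proof (induction I rule: finite_induct)
  case empty
  then show ?case using ring.zero_in_generate[OF ring_U] by (simp flip: cls_0)
next
  case (insert i I)
  have "cls (\<Sum>i\<in>insert i I. f i) = cls (f i) \<oplus>\<^bsub>U\<^esub> cls (\<Sum>i\<in>I. f i)"
    using insert by (simp add: cls_add fa_sum)
  then show ?case using insert by (auto intro!: generate_ring.eng_add)
qed

end

context osp_weight
begin

section \<open>The tensor product relations and left multiplication\<close>

abbreviation TK :: "((endo free_alg set \<times> complex) \<Rightarrow>\<^sub>0 int) set" where
  "TK \<equiv> tensor_kernel lam"

lemma borel_action_carrier: "(y, c) \<in> borel_action lam \<Longrightarrow> y \<in> carrier U"
  by (auto simp: borel_action_def scalU_cls inU_cls cartan_eq n_pos_eq intro!: cls_carrier gen_fa)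

lemma frag3_keys: "Poly_Mapping.keys (frag_of a - frag_of b - frag_of c) \<subseteq> {a, b, c}"
  using keys_diff[of "frag_of a - frag_of b" "frag_of c"] keys_diff[of "frag_of a" "frag_of b"] by auto

lemma frag2_keys: "Poly_Mapping.keys (frag_of a - frag_of b) \<subseteq> {a, b}"
  using keys_diff[of "frag_of a" "frag_of b"] by auto

lemma tensor_rels_carrier: "tensor_rels lam \<subseteq> carrier pairs"
proof -
  interpret U: ring U by (rule ring_U)
  show ?thesis
    unfolding tensor_rels_def using borel_action_carrier
    by (auto dest!: subsetD[OF frag3_keys] subsetD[OF frag2_keys])
qed

lemma subgroup_TK: "subgroup TK pairs"
  unfolding tensor_kernel_def by (rule group.generate_is_subgroup[OF group_free_Abelian_group tensor_rels_carrier])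

lemma TK_add: "a \<in> TK \<Longrightarrow> b \<in> TK \<Longrightarrow> a + b \<in> TK"
  using subgroup.m_closed[OF subgroup_TK] by simp

lemma TK_carrier: "a \<in> TK \<Longrightarrow> Poly_Mapping.keys a \<subseteq> carrier U \<times> UNIV"
  using subgroup.mem_carrier[OF subgroup_TK] by fastforce

lemma TK_minus: "a \<in> TK \<Longrightarrow> - a \<in> TK"
  using subgroup.m_inv_closed[OF subgroup_TK, of a] TK_carrier[of a] by simp

lemma TK_diff: "a \<in> TK \<Longrightarrow> b \<in> TK \<Longrightarrow> a - b \<in> TK"
  using TK_add[of a "- b"] TK_minus by simp

lemma TK_0: "0 \<in> TK"
  using subgroup.one_closed[OF subgroup_TK] by simp

lemma TK_rel: "r \<in> tensor_rels lam \<Longrightarrow> r \<in> TK"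
  unfolding tensor_kernel_def by (rule generate.incl)

lemma TK_cong: "a - b \<in> TK \<Longrightarrow> a \<in> TK \<longleftrightarrow> b \<in> TK"
  using TK_add[of "a - b" b] TK_diff[of a "a - b"] by auto

lemma TK_add_left: "u \<in> carrier U \<Longrightarrow> u' \<in> carrier U \<Longrightarrow> frag_of (u \<oplus>\<^bsub>U\<^esub> u', w) - frag_of (u, w) - frag_of (u', w) \<in> TK"
  by (rule TK_rel) (unfold tensor_rels_def, blast)

lemma TK_add_right: "u \<in> carrier U \<Longrightarrow> frag_of (u, w + w') - frag_of (u, w) - frag_of (u, w') \<in> TK"
  by (rule TK_rel) (unfold tensor_rels_def, blast)

lemma TK_balance: "u \<in> carrier U \<Longrightarrow> (y, c) \<in> borel_action lam \<Longrightarrow> frag_of (u \<otimes>\<^bsub>U\<^esub> y, w) - frag_of (u, c * w) \<in> TK"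
  by (rule TK_rel) (unfold tensor_rels_def, blast)

lemma coset_TK: "TK #>\<^bsub>pairs\<^esub> f = {k + f | k. k \<in> TK}"
  by (auto simp: r_coset_def)

lemma coset_TK_eq: "TK #>\<^bsub>pairs\<^esub> f = TK #>\<^bsub>pairs\<^esub> f' \<longleftrightarrow> f - f' \<in> TK"
proof
  assume e: "TK #>\<^bsub>pairs\<^esub> f = TK #>\<^bsub>pairs\<^esub> f'"
  have "f \<in> TK #>\<^bsub>pairs\<^esub> f" unfolding coset_TK using TK_0 by force
  then show "f - f' \<in> TK" unfolding e by (auto simp: coset_TK)
next
  have sub: "TK #>\<^bsub>pairs\<^esub> f \<subseteq> TK #>\<^bsub>pairs\<^esub> f'" if d: "f - f' \<in> TK" for f f'
  proof
    fix x assume "x \<in> TK #>\<^bsub>pairs\<^esub> f"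
    then obtain k where "x = k + f" "k \<in> TK" by (auto simp: coset_TK)
    then have "x = (k + (f - f')) + f'" "k + (f - f') \<in> TK" using d TK_add by auto
    then show "x \<in> TK #>\<^bsub>pairs\<^esub> f'" unfolding coset_TK by blast
  qed
  assume d: "f - f' \<in> TK"
  then have "f' - f \<in> TK" using TK_minus[OF d] by simp
  then show "TK #>\<^bsub>pairs\<^esub> f = TK #>\<^bsub>pairs\<^esub> f'" using sub d by blast
qed

definition tau :: "endo free_alg \<Rightarrow> ((endo free_alg set \<times> complex) \<Rightarrow>\<^sub>0 int) set" where
  "tau p = tensor lam (cls p) 1"

lemma tau_eq: "tau p = TK #>\<^bsub>pairs\<^esub> frag_of (cls p, 1)"
  by (simp add: tau_def tensor_def)

lemma carrier_verma: "carrier (verma lam) = {TK #>\<^bsub>pairs\<^esub> f | f. Poly_Mapping.keys f \<subseteq> carrier U \<times> UNIV}"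
  by (auto simp: verma_def FactGroup_def RCOSETS_def)

lemma one_verma: "\<one>\<^bsub>verma lam\<^esub> = TK"
  by (simp add: verma_def FactGroup_def)

lemma tau_carrier: "p \<in> fa g \<Longrightarrow> tau p \<in> carrier (verma lam)"
  unfolding carrier_verma tau_eq using cls_carrier by (intro CollectI exI conjI refl) auto

lemma frag_cls_add:
  assumes "p \<in> fa g" "q \<in> fa g"
  shows "frag_of (cls (p + q), w) - frag_of (cls p, w) - frag_of (cls q, w) \<in> TK"
  using TK_add_left[OF cls_carrier[OF assms(1)] cls_carrier[OF assms(2)]] by (simp add: cls_add assms)

lemma frag_cls_diff:
  assumes "p \<in> fa g" "q \<in> fa g"
  shows "frag_of (cls p, w) - frag_of (cls q, w) - frag_of (cls (p - q), w) \<in> TK"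
  using frag_cls_add[OF fa_diff[OF assms] assms(2), of w] by (simp add: algebra_simps)

lemma frag_cls_const:
  assumes "p \<in> fa g"
  shows "frag_of (cls (p * const c), 1) - frag_of (cls p, c) \<in> TK"
  using TK_balance[OF cls_carrier[OF assms], of "scalU c" c 1]
  by (simp add: borel_action_def scalU_cls cls_mult assms)

lemma frag_cls_0: "frag_of (cls 0, w) \<in> TK"
  using TK_minus[OF frag_cls_diff[of 0 0 w]] by simp

text \<open>Balancing with \<open>scalU\<close> moves the second component of a pair into the first,
  after which sums of pairs combine into one.\<close>

lemma tau_surj:
  assumes "v \<in> carrier (verma lam)"
  obtains p where "p \<in> fa g" "v = tau p"
proof -
  obtain f where f: "v = TK #>\<^bsub>pairs\<^esub> f" "Poly_Mapping.keys f \<subseteq> carrier U \<times> UNIV"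
    using assms by (auto simp: carrier_verma)
  have "\<exists>p\<in>fa g. f - frag_of (cls p, 1) \<in> TK"
    using f(2)
  proof (induction rule: frag_induction)
    case zero
    show ?case using TK_minus[OF frag_cls_0] by (intro bexI[of _ 0]) auto
  next
    case (one x)
    then obtain q w where x: "x = (cls q, w)" "q \<in> fa g" by (auto simp: carrier_U)
    have "frag_of x - frag_of (cls (q * const w), 1) \<in> TK"
      using TK_minus[OF frag_cls_const[OF x(2), of w]] by (simp add: x)
    then show ?case using x(2) by (intro bexI[of _ "q * const w"]) (auto intro: fa_mult)
  next
    case (diff a b)
    then obtain p q where p: "p \<in> fa g" "a - frag_of (cls p, 1) \<in> TK" and q: "q \<in> fa g" "b - frag_of (cls q, 1) \<in> TK"
      by blast
    have "a - b - frag_of (cls (p - q), 1) = (a - frag_of (cls p, 1)) - (b - frag_of (cls q, 1))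
       + (frag_of (cls p, 1) - frag_of (cls q, 1) - frag_of (cls (p - q), 1))" by simp
    then have "a - b - frag_of (cls (p - q), 1) \<in> TK"
      using TK_add[OF TK_diff[OF p(2) q(2)] frag_cls_diff[OF p(1) q(1), of 1]] by (simp only:)
    then show ?case using p q by (intro bexI[of _ "p - q"]) (auto intro: fa_diff)
  qed
  then show ?thesis using that coset_TK_eq f(1) tau_eq by metis
qed

definition lmult :: "endo free_alg set \<Rightarrow> ((endo free_alg set \<times> complex) \<Rightarrow>\<^sub>0 int) \<Rightarrow> ((endo free_alg set \<times> complex) \<Rightarrow>\<^sub>0 int)" where
  "lmult z = frag_extend (\<lambda>(u, w). frag_of (z \<otimes>\<^bsub>U\<^esub> u, w))"

lemma lmult_of: "lmult z (frag_of (u, w)) = frag_of (z \<otimes>\<^bsub>U\<^esub> u, w)"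
  and lmult_add: "lmult z (a + b) = lmult z a + lmult z b"
  and lmult_diff: "lmult z (a - b) = lmult z a - lmult z b"
  and lmult_minus: "lmult z (- a) = - lmult z a"
  and lmult_0: "lmult z 0 = 0"
  by (simp_all add: lmult_def frag_extend_add frag_extend_diff frag_extend_minus)

text \<open>Balancing takes place on the right of the first component, so left multiplication maps
  relations to relations.\<close>

lemma lmult_TK:
  assumes z: "z \<in> carrier U" and a: "a \<in> TK"
  shows "lmult z a \<in> TK"
proof -
  interpret U: ring U by (rule ring_U)
  let ?H = "{a. Poly_Mapping.keys a \<subseteq> carrier U \<times> UNIV \<and> lmult z a \<in> TK}"
  have "TK \<subseteq> ?H"
    unfolding tensor_kernel_def
  proof (rule group.generate_subgroup_incl[OF group_free_Abelian_group], fold tensor_kernel_def)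
    show "subgroup ?H pairs"
      by (rule group.subgroupI[OF group_free_Abelian_group])
        (auto simp: lmult_add lmult_minus lmult_0 TK_add TK_minus TK_0 dest!: subsetD[OF keys_add] intro!: exI[of _ 0])
    have "lmult z r \<in> TK" if "r \<in> tensor_rels lam" for r
      using that unfolding tensor_rels_def
    proof (elim UnE CollectE exE conjE)
      fix u u' w assume "r = frag_of (u \<oplus>\<^bsub>U\<^esub> u', w) - frag_of (u, w) - frag_of (u', w)" "u \<in> carrier U" "u' \<in> carrier U"
      then show ?thesis using TK_add_left[of "z \<otimes>\<^bsub>U\<^esub> u" "z \<otimes>\<^bsub>U\<^esub> u'" w] z by (simp add: lmult_diff lmult_of U.r_distr)
    next
      fix u w w' assume "r = frag_of (u, w + w') - frag_of (u, w) - frag_of (u, w')" "u \<in> carrier U"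
      then show ?thesis using TK_add_right[of "z \<otimes>\<^bsub>U\<^esub> u" w w'] z by (simp add: lmult_diff lmult_of)
    next
      fix u y c w assume "r = frag_of (u \<otimes>\<^bsub>U\<^esub> y, w) - frag_of (u, c * w)" "u \<in> carrier U" "(y, c) \<in> borel_action lam"
      then show ?thesis using TK_balance[of "z \<otimes>\<^bsub>U\<^esub> u" y c w] z borel_action_carrier
        by (simp add: lmult_diff lmult_of U.m_assoc)
    qed
    then show "tensor_rels lam \<subseteq> ?H" using subsetD[OF tensor_rels_carrier] by (simp add: subsetI)
  qed
  then show ?thesis using a by blast
qed

text \<open>By \<open>lmult_TK\<close> the whole coset is mapped into a single coset, so
  \<open>the_elem\<close> is applied to a singleton.\<close>

lemma act_tau:
  assumes "q \<in> fa g" "p \<in> fa g"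
  shows "act lam (cls q) (tau p) = tau (q * p)"
proof -
  have "(\<lambda>a. TK #>\<^bsub>pairs\<^esub> lmult (cls q) a) ` tau p = {tau (q * p)}"
  proof -
    have "TK #>\<^bsub>pairs\<^esub> lmult (cls q) a = tau (q * p)" if a: "a \<in> tau p" for a
    proof -
      obtain k where k: "a = k + frag_of (cls p, 1)" "k \<in> TK" using a unfolding tau_eq coset_TK by blast
      have "lmult (cls q) a - frag_of (cls (q * p), 1) = lmult (cls q) k"
        by (simp add: k lmult_add lmult_of cls_mult assms)
      then show ?thesis
        unfolding tau_eq coset_TK_eq using lmult_TK[OF cls_carrier[OF assms(1)] k(2)] by simp
    qed
    moreover have "tau p \<noteq> {}" using TK_0 by (auto simp: tau_eq coset_TK)
    ultimately show ?thesis by auto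
  qed
  then show ?thesis by (simp add: act_def lmult_def)
qed

definition rep :: "endo free_alg set \<Rightarrow> endo free_alg" where
  "rep u = (SOME p. p \<in> fa g \<and> u = cls p)"

lemma rep: "u \<in> carrier U \<Longrightarrow> rep u \<in> fa g \<and> cls (rep u) = u"
  unfolding rep_def carrier_U by (rule someI2_ex) auto

lemma rep_cls: "p \<in> fa g \<Longrightarrow> rep (cls p) - p \<in> U_ideal"
  using rep[OF cls_carrier, of p] cls_eqD by blast

text \<open>
  Choosing representatives turns a formal sum of tensors into an element of the free algebra, which
  is well defined modulo \<open>K\<close>.
\<close>

definition Phi :: "((endo free_alg set \<times> complex) \<Rightarrow>\<^sub>0 int) \<Rightarrow> endo free_alg" where
  "Phi f = (\<Sum>x\<in>Poly_Mapping.keys f. of_int (Poly_Mapping.lookup f x) * (rep (fst x) * const (snd x)))"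

lemma Phi_superset: "finite X \<Longrightarrow> Poly_Mapping.keys f \<subseteq> X \<Longrightarrow>
  Phi f = (\<Sum>x\<in>X. of_int (Poly_Mapping.lookup f x) * (rep (fst x) * const (snd x)))"
  unfolding Phi_def by (rule sum.mono_neutral_left) (auto simp: in_keys_iff)

lemma Phi_add: "Phi (a + b) = Phi a + Phi b"
proof -
  let ?X = "Poly_Mapping.keys a \<union> Poly_Mapping.keys b"
  show ?thesis
    using Phi_superset[of ?X a] Phi_superset[of ?X b] Phi_superset[of ?X "a + b"] keys_add[of a b]
    by (simp add: lookup_add distrib_right sum.distrib)
qed

lemma Phi_0: "Phi 0 = 0"
  by (simp add: Phi_def)

lemma Phi_diff: "Phi (a - b) = Phi a - Phi b"
proof -
  have "Phi a = Phi (a - b) + Phi b" by (simp flip: Phi_add)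
  then show ?thesis by simp
qed

lemma Phi_minus: "Phi (- a) = - Phi a"
  using Phi_diff[of 0 a] by (simp add: Phi_0)

lemma Phi_of: "Phi (frag_of (u, w)) = rep u * const w"
  by (simp add: Phi_def)

lemma K_mult_const: "p \<in> K \<Longrightarrow> p * const w \<in> K"
  using K_scale[of p w] by (simp add: const_commute)

text \<open>The choice of representatives disturbs the additive relations only by
  \<open>U_ideal\<close>; the balancing relations are turned into the generators of
  \<open>K\<close>.\<close>

lemma Phi_TK:
  assumes a: "a \<in> TK"
  shows "Phi a \<in> K"
proof -
  interpret U: ring U by (rule ring_U)
  let ?H = "{a. Poly_Mapping.keys a \<subseteq> carrier U \<times> UNIV \<and> Phi a \<in> K}"
  have K_minus: "- p \<in> K" if "p \<in> K" for p using K_diff[OF K_0 that] by simp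
  have "TK \<subseteq> ?H"
    unfolding tensor_kernel_def
  proof (rule group.generate_subgroup_incl[OF group_free_Abelian_group])
    show "subgroup ?H pairs"
      by (rule group.subgroupI[OF group_free_Abelian_group])
        (auto simp: Phi_add Phi_minus Phi_0 K_add K_minus K_0 dest!: subsetD[OF keys_add] intro!: exI[of _ 0])
    have "Phi r \<in> K" if "r \<in> tensor_rels lam" for r
      using that unfolding tensor_rels_def
    proof (elim UnE CollectE exE conjE)
      fix u u' w assume r: "r = frag_of (u \<oplus>\<^bsub>U\<^esub> u', w) - frag_of (u, w) - frag_of (u', w)" and u: "u \<in> carrier U" "u' \<in> carrier U"
      have "cls (rep (u \<oplus>\<^bsub>U\<^esub> u')) = cls (rep u + rep u')"
        using u rep by (simp flip: cls_add)
      then have "(rep (u \<oplus>\<^bsub>U\<^esub> u') - (rep u + rep u')) * const w \<in> K"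
        by (intro K_mult_const K_U cls_eqD)
      then show ?thesis
        unfolding r Phi_diff Phi_of by (simp only: left_diff_distrib distrib_right diff_diff_eq)
    next
      fix u w w' assume r: "r = frag_of (u, w + w') - frag_of (u, w) - frag_of (u, w')"
      show ?thesis
        unfolding r Phi_diff Phi_of by (simp only: const_add distrib_left diff_diff_eq diff_self K_0)
    next
      fix u y c w assume r: "r = frag_of (u \<otimes>\<^bsub>U\<^esub> y, w) - frag_of (u, c * w)" and u: "u \<in> carrier U" and y: "(y, c) \<in> borel_action lam"
      have yK: "rep u * rep y - rep u * const c \<in> K"
      proof -
        have y': "rep u * rep y - rep u * p \<in> K" if "p \<in> fa g" "y = cls p" for p
          using U_ideal_mult_left[OF rep_cls[OF that(1)], of "rep u"] rep[OF u] that(2)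
          by (intro K_U) (simp add: right_diff_distrib)
        from y consider "y = cls (const c)" | h where "y = cls (gen h)" "c = ev lam h" "h \<in> cartan" | x where "y = cls (gen x)" "c = 0" "x \<in> n_pos"
          by (auto simp: borel_action_def scalU_cls inU_cls)
        then show ?thesis
        proof cases
          case 1
          then show ?thesis using y' by simp
        next
          case 2
          have "rep u * gen h - rep u * const c \<in> K"
            using K_cartan[of "rep u" h] 2 rep[OF u] by (simp add: right_diff_distrib)
          moreover have "rep u * rep y - rep u * gen h \<in> K"
            using y'[of "gen h"] 2 by (simp add: gen_fa cartan_eq)
          ultimately show ?thesis using K_add by fastforce
        next
          case 3
          have "rep u * gen x \<in> K" using K_npos[of "rep u" x] 3 rep[OF u] by simp
          moreover have "rep u * rep y - rep u * gen x \<in> K"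
            using y'[of "gen x"] 3 by (simp add: gen_fa n_pos_eq)
          ultimately show ?thesis using K_add 3(2) by fastforce
        qed
      qed
      have "cls (rep (u \<otimes>\<^bsub>U\<^esub> y)) = cls (rep u * rep y)"
        using u rep borel_action_carrier[OF y] by (simp flip: cls_mult)
      then have "rep (u \<otimes>\<^bsub>U\<^esub> y) - rep u * rep y \<in> K" by (intro K_U cls_eqD)
      from K_mult_const[OF K_add[OF this yK], of w]
      show ?thesis by (simp add: r Phi_diff Phi_of const_mult algebra_simps)
    qed
    then show "tensor_rels lam \<subseteq> ?H" using subsetD[OF tensor_rels_carrier] by (simp add: subsetI)
  qed
  then show ?thesis using a by blast
qed

text \<open>Identifies the Verma module with \<open>fa g\<close> modulo \<open>K\<close>.
  \<open>Phi\<close> gives the map back from tensors; conversely, the elements with zero tensor form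
  a subspace that contains the generators of \<open>K\<close>.\<close>

lemma frag_TK_iff:
  assumes p: "p \<in> fa g"
  shows "frag_of (cls p, 1) \<in> TK \<longleftrightarrow> p \<in> K"
proof
  assume "frag_of (cls p, 1) \<in> TK"
  then have "rep (cls p) \<in> K" using Phi_TK Phi_of[of "cls p" 1] by fastforce
  then show "p \<in> K" using K_cong[OF K_U[OF rep_cls[OF p]]] K_diff[OF _ K_U[OF rep_cls[OF p]]] by fastforce
next
  let ?H = "{p \<in> fa g. frag_of (cls p, 1) \<in> TK}"
  have mult: "q * p \<in> ?H" if "p \<in> ?H" "q \<in> fa g" for p q
    using lmult_TK[OF cls_carrier[OF that(2)], of "frag_of (cls p, 1)"] that
    by (simp add: lmult_of cls_mult fa_mult)
  have "p + q \<in> ?H" if "p \<in> ?H" "q \<in> ?H" for p q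
  proof -
    have "frag_of (cls (p + q), 1) - (frag_of (cls p, 1) + frag_of (cls q, 1)) \<in> TK"
      using frag_cls_add[of p q 1] that by (simp add: algebra_simps)
    then show ?thesis using TK_cong TK_add that fa_add by blast
  qed
  then have sub: "FA.subspace ?H"
    using mult frag_cls_0 by (auto simp: FA.subspace_def)
  have diff: "p - q \<in> ?H" if "p \<in> fa g" "q \<in> fa g" "frag_of (cls p, 1) - frag_of (cls q, 1) \<in> TK" for p q
    using that TK_diff[OF that(3) frag_cls_diff[OF that(1,2), of 1]] by (simp add: fa_diff)
  have c0: "frag_of (cls p, 0) \<in> TK" if "p \<in> fa g" for p
    using TK_minus[OF TK_add_right[OF cls_carrier[OF that], of 0 0]] by simp
  have "K \<subseteq> ?H"
    unfolding K_def spI_def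
  proof (rule FA.span_minimal[OF _ sub], safe)
    fix p h assume p: "p \<in> fa g" and h: "h \<in> cartan"
    have hg: "gen h \<in> fa g" using h by (simp add: gen_fa cartan_eq)
    have 1: "frag_of (cls (p * gen h), 1) - frag_of (cls p, ev lam h) \<in> TK"
      using TK_balance[OF cls_carrier[OF p], of "inU h" "ev lam h" 1] h
      by (auto simp: borel_action_def inU_cls cls_mult p hg)
    have "frag_of (cls (p * gen h), 1) - frag_of (cls (p * const (ev lam h)), 1) \<in> TK"
      using TK_diff[OF 1 frag_cls_const[OF p, of "ev lam h"]] by simp
    from diff[OF _ _ this] p hg have *: "p * (gen h - const (ev lam h)) \<in> ?H"
      by (simp add: fa_mult right_diff_distrib)
    then show "frag_of (cls (p * (gen h - const (ev lam h))), 1) \<in> TK"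
      "p * (gen h - const (ev lam h)) \<in> fa g" by auto
  next
    fix p x assume p: "p \<in> fa g" and x: "x \<in> n_pos"
    have xg: "gen x \<in> fa g" using x by (simp add: gen_fa n_pos_eq)
    show "p * gen x \<in> fa g" using p xg by (rule fa_mult)
    have "frag_of (cls (p * gen x), 1) - frag_of (cls p, 0) \<in> TK"
      using TK_balance[OF cls_carrier[OF p], of "inU x" 0 1] x
      by (auto simp: borel_action_def inU_cls cls_mult p xg)
    then show "frag_of (cls (p * gen x), 1) \<in> TK" using TK_cong c0[OF p] by blast
  next
    fix p assume p: "p \<in> U_ideal"
    then show "p \<in> fa g" using U_ideal_fa by blast
    have "cls p = cls 0" using p by (intro cls_eqI) simp
    then show "frag_of (cls p, 1) \<in> TK" using frag_cls_0 by simp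
  qed
  then show "frag_of (cls p, 1) \<in> TK" if "p \<in> K" using that by blast
qed

lemma tau_cong_iff:
  assumes "p \<in> fa g" "q \<in> fa g"
  shows "tau p = tau q \<longleftrightarrow> p - q \<in> K"
proof -
  have "frag_of (cls p, 1) - frag_of (cls q, 1) \<in> TK \<longleftrightarrow> frag_of (cls (p - q), 1) \<in> TK"
    using TK_cong[OF frag_cls_diff[OF assms, of 1]] .
  then show ?thesis unfolding tau_eq coset_TK_eq using frag_TK_iff fa_diff assms by blast
qed

lemma tau_one_iff:
  assumes "p \<in> fa g"
  shows "tau p = \<one>\<^bsub>verma lam\<^esub> \<longleftrightarrow> p \<in> K"
proof -
  have "TK #>\<^bsub>pairs\<^esub> 0 = TK" by (auto simp: coset_TK)
  then have "tau p = TK \<longleftrightarrow> frag_of (cls p, 1) \<in> TK"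
    unfolding tau_eq using coset_TK_eq[of "frag_of (cls p, 1)" 0] by simp
  then show ?thesis using frag_TK_iff[OF assms] by (simp add: one_verma)
qed

text \<open>Together with \<open>weight_vector_tau\<close> and \<open>tau_surj\<close> this turns
  all claims about the Verma module into membership in \<open>K\<close>.\<close>

lemma singular_tau:
  assumes "p \<in> fa g"
  shows "singular lam (tau p) \<longleftrightarrow> p \<notin> K \<and> (\<forall>x\<in>n_pos. gen x * p \<in> K)"
proof -
  have "act lam (inU x) (tau p) = \<one>\<^bsub>verma lam\<^esub> \<longleftrightarrow> gen x * p \<in> K" if "x \<in> n_pos" for x
  proof -
    have "gen x \<in> fa g" using that by (simp add: n_pos_eq gen_fa)
    then show ?thesis using assms by (simp add: inU_cls act_tau tau_one_iff fa_mult)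
  qed
  then show ?thesis unfolding singular_def using assms by (auto simp: tau_carrier tau_one_iff)
qed

lemma weight_vector_tau:
  assumes "p \<in> fa g"
  shows "weight_vector lam \<mu> (tau p) \<longleftrightarrow> (\<forall>h\<in>cartan. gen h * p - const (ev \<mu> h) * p \<in> K)"
proof -
  have "act lam (inU h) (tau p) = act lam (scalU (ev \<mu> h)) (tau p) \<longleftrightarrow> gen h * p - const (ev \<mu> h) * p \<in> K" if "h \<in> cartan" for h
  proof -
    have "gen h \<in> fa g" using that by (simp add: cartan_eq gen_fa)
    then show ?thesis using assms by (simp add: inU_cls scalU_cls act_tau tau_cong_iff fa_mult)
  qed
  then show ?thesis unfolding weight_vector_def using assms by (auto simp: tau_carrier)
qed

lemma hwv_tau: "highest_weight_vector lam = tau 1"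
  by (simp add: highest_weight_vector_def tau_def cls_1)

end

section \<open>The half sum of the positive roots\<close>

lemma eps_diff_inj: "eps a - eps b = eps c - eps d \<Longrightarrow> a \<noteq> b \<Longrightarrow> c \<noteq> d \<Longrightarrow> a = c \<and> b = d"
proof -
  assume e: "eps a - eps b = eps c - eps d" and ne: "a \<noteq> b" "c \<noteq> d"
  show ?thesis using fun_cong[OF e, of a] fun_cong[OF e, of b] ne
    by (auto simp: eps_def of_bool_def split: if_splits)
qed

lemma eps_diff_neq_add: "a \<noteq> b \<Longrightarrow> eps a - eps b \<noteq> eps c + eps d"
proof
  assume ne: "a \<noteq> b" and e: "eps a - eps b = eps c + eps d"
  from fun_cong[OF e, of b] have "Re (- 1) = Re (eps c b + eps d b)" using ne by (simp add: eps_def)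
  moreover have "Re (eps c b + eps d b) \<ge> 0" by (simp add: eps_def)
  ultimately show False by simp
qed

lemma eps_diff_neq: "a \<noteq> b \<Longrightarrow> eps a - eps b \<noteq> eps c"
proof
  assume ne: "a \<noteq> b" and e: "eps a - eps b = eps c"
  from fun_cong[OF e, of b] show False using ne by (auto simp: eps_def of_bool_def split: if_splits)
qed

lemma eps_add_inj: "eps a + eps b = eps c + eps d \<Longrightarrow> a \<le> b \<Longrightarrow> c \<le> d \<Longrightarrow> a = c \<and> b = d"
proof -
  assume e: "eps a + eps b = eps c + eps d" and le: "a \<le> b" "c \<le> d"
  show ?thesis using fun_cong[OF e, of a] fun_cong[OF e, of b] fun_cong[OF e, of c] fun_cong[OF e, of d] le
    by (auto simp: eps_def of_bool_def split: if_splits)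
qed

lemma eps_add_neq: "eps a + eps b \<noteq> eps c"
proof
  assume e: "eps a + eps b = eps c"
  from fun_cong[OF e, of a] fun_cong[OF e, of b] show False
    by (auto simp: eps_def of_bool_def split: if_splits)
qed

lemma eps_inj: "eps a = eps b \<Longrightarrow> a = b"
  by (auto simp: eps_def fun_eq_iff of_bool_def split: if_splits)

text \<open>\<open>rho\<close> sums over sets of roots, so coinciding roots would count once. The
  orderings of the pairs make the parametrisations injective and the three families
  disjoint.\<close>

lemma sum_root_families:
  assumes fin: "finite P" "finite P'" "finite Q"
    and P: "\<And>a b. (a, b) \<in> P \<Longrightarrow> a < b" and P': "\<And>a b. (a, b) \<in> P' \<Longrightarrow> a \<le> b"
  shows "(\<Sum>\<alpha>\<in>(\<lambda>(a, b). eps a - eps b) ` P \<union> (\<lambda>(a, b). eps a + eps b) ` P' \<union> eps ` Q. \<alpha> x)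
    = (\<Sum>(a, b)\<in>P. eps a x - eps b x) + (\<Sum>(a, b)\<in>P'. eps a x + eps b x) + (\<Sum>a\<in>Q. eps a x)"
proof -
  have i1: "inj_on (\<lambda>(a, b). eps a - eps b) P"
  proof (rule inj_onI, clarify)
    fix a b c d assume ab: "(a, b) \<in> P" "(c, d) \<in> P" and e: "eps a - eps b = eps c - eps d"
    have "a \<noteq> b" "c \<noteq> d" using P[OF ab(1)] P[OF ab(2)] by auto
    then show "a = c \<and> b = d" using eps_diff_inj[OF e] by simp
  qed
  have i2: "inj_on (\<lambda>(a, b). eps a + eps b) P'"
  proof (rule inj_onI, clarify)
    fix a b c d assume ab: "(a, b) \<in> P'" "(c, d) \<in> P'" and e: "eps a + eps b = eps c + eps d"
    show "a = c \<and> b = d" using eps_add_inj[OF e P'[OF ab(1)] P'[OF ab(2)]] .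
  qed
  have 1: "(\<Sum>\<alpha>\<in>(\<lambda>(a, b). eps a - eps b) ` P. \<alpha> x) = (\<Sum>(a, b)\<in>P. eps a x - eps b x)"
    unfolding sum.reindex[OF i1] by (intro sum.cong) auto
  have 2: "(\<Sum>\<alpha>\<in>(\<lambda>(a, b). eps a + eps b) ` P'. \<alpha> x) = (\<Sum>(a, b)\<in>P'. eps a x + eps b x)"
    unfolding sum.reindex[OF i2] by (intro sum.cong) auto
  have 3: "(\<Sum>\<alpha>\<in>eps ` Q. \<alpha> x) = (\<Sum>a\<in>Q. eps a x)"
    by (subst sum.reindex) (auto intro!: inj_onI dest: eps_inj)
  have d1: "(\<lambda>(a, b). eps a - eps b) ` P \<inter> (\<lambda>(a, b). eps a + eps b) ` P' = {}"
  proof (rule ccontr)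
    assume "\<not> ?thesis"
    then obtain a b c d where "(a, b) \<in> P" "eps a - eps b = eps c + eps d" by auto
    then show False using eps_diff_neq_add[of a b c d] P[of a b] by simp
  qed
  have d2: "((\<lambda>(a, b). eps a - eps b) ` P \<union> (\<lambda>(a, b). eps a + eps b) ` P') \<inter> eps ` Q = {}"
  proof (rule ccontr)
    assume "\<not> ?thesis"
    then obtain a b c where "(a, b) \<in> P \<and> eps c = eps a - eps b \<or> eps c = eps a + eps b" by auto
    then show False using eps_diff_neq[of a b c] P[of a b] eps_add_neq[of a b c] by auto
  qed
  show ?thesis
    using fin d1 d2 by (simp add: sum.union_disjoint 1 2 3)
qed

context osp
begin

lemma sum_first_coordinate:
  assumes "finite P"
  shows "(\<Sum>(a, b)\<in>P. eps a x) = of_nat (card {b. (x, b) \<in> P})"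
proof -
  have "(\<Sum>(a, b)\<in>P. eps a x) = (\<Sum>q\<in>P. of_bool (fst q = x))"
    by (intro sum.cong) (auto simp: eps_def)
  also have "\<dots> = of_nat (card {q \<in> P. fst q = x})"
    using assms by (simp add: of_bool_def flip: sum.inter_filter)
  also have "{q \<in> P. fst q = x} = (\<lambda>b. (x, b)) ` {b. (x, b) \<in> P}" by auto
  also have "card \<dots> = card {b. (x, b) \<in> P}" by (rule card_image) (auto simp: inj_on_def)
  finally show ?thesis .
qed

lemma sum_eps: "finite Q \<Longrightarrow> (\<Sum>a\<in>Q. eps a x) = of_bool (x \<in> Q)"
  by (simp add: eps_def of_bool_def sum.delta')

text \<open>The two roots of a pair \<open>(a, b)\<close> add up to twice \<open>eps a\<close>, so
  only the number of pairs that begin with \<open>x\<close> counts.\<close>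

lemma sum_even_pos_roots: "(\<Sum>\<alpha>\<in>even_pos_roots. \<alpha> x) =
   2 * of_nat (card {b. (x, b) \<in> even_pairs}) + 2 * of_bool (- int n \<le> x \<and> x \<le> -1) + of_bool (ex \<and> 1 \<le> x \<and> x \<le> int m)"
proof -
  let ?d = "(\<lambda>a. (a, a)) ` {- int n .. -1}"
  have fin: "finite {k. ex \<and> 1 \<le> k \<and> k \<le> int m}"
    by (rule finite_subset[of _ "{1..int m}"]) auto
  have "(\<Sum>\<alpha>\<in>even_pos_roots. \<alpha> x) = (\<Sum>(a, b)\<in>even_pairs. eps a x - eps b x)
     + (\<Sum>(a, b)\<in>even_pairs \<union> ?d. eps a x + eps b x) + (\<Sum>a\<in>{k. ex \<and> 1 \<le> k \<and> k \<le> int m}. eps a x)"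
    unfolding even_pos_roots_pairs
    by (rule sum_root_families) (use fin finite_even_pairs in \<open>auto simp: even_pairs_def\<close>)
  also have "(\<Sum>(a, b)\<in>even_pairs \<union> ?d. eps a x + eps b x)
     = (\<Sum>(a, b)\<in>even_pairs. eps a x + eps b x) + (\<Sum>(a, b)\<in>?d. eps a x + eps b x)"
    using finite_even_pairs by (intro sum.union_disjoint) (auto simp: even_pairs_def)
  also have "(\<Sum>(a, b)\<in>?d. eps a x + eps b x) = (\<Sum>a\<in>{- int n .. -1}. 2 * eps a x)"
    by (subst sum.reindex) (auto simp: inj_on_def)
  also have "\<dots> = 2 * of_bool (- int n \<le> x \<and> x \<le> -1)"
    by (simp add: sum_eps flip: sum_distrib_left)
  also have "(\<Sum>(a, b)\<in>even_pairs. eps a x + eps b x) 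
    = 2 * (\<Sum>(a, b)\<in>even_pairs. eps a x) - (\<Sum>(a, b)\<in>even_pairs. eps a x - eps b x)"
    by (simp add: sum_distrib_left case_prod_unfold algebra_simps flip: sum_subtractf sum.distrib)
  finally show ?thesis by (simp add: sum_eps fin sum_first_coordinate finite_even_pairs)
qed

lemma sum_odd_pos_roots: "(\<Sum>\<alpha>\<in>odd_pos_roots. \<alpha> x) =
   2 * of_nat (card {b. (x, b) \<in> odd_pairs}) + of_bool (ex \<and> - int n \<le> x \<and> x \<le> -1)"
proof -
  have fin: "finite {a. ex \<and> - int n \<le> a \<and> a \<le> -1}" "finite odd_pairs"
    by (rule finite_subset[of _ "{- int n .. -1}"]) (auto simp: odd_pairs_def)
  have "(\<Sum>\<alpha>\<in>odd_pos_roots. \<alpha> x) = (\<Sum>(a, b)\<in>odd_pairs. eps a x - eps b x)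
     + (\<Sum>(a, b)\<in>odd_pairs. eps a x + eps b x) + (\<Sum>a\<in>{a. ex \<and> - int n \<le> a \<and> a \<le> -1}. eps a x)"
    unfolding odd_pos_roots_pairs
    by (rule sum_root_families) (use fin in \<open>auto simp: odd_pairs_def\<close>)
  also have "(\<Sum>(a, b)\<in>odd_pairs. eps a x + eps b x) 
    = 2 * (\<Sum>(a, b)\<in>odd_pairs. eps a x) - (\<Sum>(a, b)\<in>odd_pairs. eps a x - eps b x)"
    by (simp add: sum_distrib_left case_prod_unfold algebra_simps flip: sum_subtractf sum.distrib)
  finally show ?thesis by (simp add: sum_eps fin sum_first_coordinate)
qed

lemma rho_neg:
  assumes "1 \<le> s" "s \<le> n"
  shows "rho (- int s) = of_nat s - of_nat m - of_bool ex / 2"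
proof -
  have "{b. (- int s, b) \<in> even_pairs} = {- int s <..< 0}" using assms by (auto simp: even_pairs_def W_def)
  moreover have "{b. (- int s, b) \<in> odd_pairs} = {1..int m}" using assms by (auto simp: odd_pairs_def)
  moreover have "card {- int s <..< 0} = s - 1" by simp
  ultimately show ?thesis
    using assms by (simp add: rho_def sum_even_pos_roots sum_odd_pos_roots of_nat_diff field_simps)
qed

lemma rho_pos:
  assumes "1 \<le> t" "t \<le> m"
  shows "rho (int t) = of_nat m - of_nat t + of_bool ex / 2"
proof -
  have "{b. (int t, b) \<in> even_pairs} = {int t <.. int m}" using assms by (auto simp: even_pairs_def W_def)
  moreover have "{b. (int t, b) \<in> odd_pairs} = {}" using assms by (auto simp: odd_pairs_def)
  ultimately show ?thesis
    using assms by (simp add: rho_def sum_even_pos_roots sum_odd_pos_roots of_nat_diff nat_diff_distrib field_simps)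
qed

lemma dual_form_delta_eps:
  assumes "1 \<le> s" "s \<le> n" "1 \<le> t" "t \<le> m"
  shows "dual_form \<mu> (delta (int s) - eps (int t)) = \<mu> (- int s) + \<mu> (int t)"
proof -
  have "(\<Sum>i=1..int n. \<mu> (- i) * (delta (int s) - eps (int t)) (- i)) = (\<Sum>i=1..int n. if i = int s then \<mu> (- int s) else 0)"
    using assms by (intro sum.cong) (auto simp: eps_def)
  moreover have "(\<Sum>k=1..int m. \<mu> k * (delta (int s) - eps (int t)) k) = (\<Sum>k=1..int m. if k = int t then - \<mu> (int t) else 0)"
    using assms by (intro sum.cong) (auto simp: eps_def)
  ultimately show ?thesis using assms by (simp add: dual_form_def)
qed

text \<open>The contributions of \<open>m\<close> to \<open>rho\<close>, and the halves present when
  \<open>ex\<close> holds, have opposite signs at \<open>- s\<close> and \<open>t\<close> and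
  cancel.\<close>

lemma atypical_iff:
  assumes "1 \<le> s" "s \<le> n" "1 \<le> t" "t \<le> m"
  shows "atypical \<mu> (delta (int s) - eps (int t)) \<longleftrightarrow> \<mu> (- int s) + \<mu> (int t) + of_nat s - of_nat t = 0"
proof -
  have key: "(\<mu> + rho) (- int s) + (\<mu> + rho) (int t) = \<mu> (- int s) + \<mu> (int t) + of_nat s - of_nat t"
    unfolding plus_fun_apply rho_neg[OF assms(1,2)] rho_pos[OF assms(3,4)] by simp
  show ?thesis unfolding atypical_def dual_form_delta_eps[OF assms] key by (rule refl)
qed

end

section \<open>Paths of indices\<close>

text \<open>The letters of the product that runs through the indices of an ascending list.\<close>

fun pth :: "int list \<Rightarrow> (int \<times> int) list" where
  "pth (x # y # zs) = pth (y # zs) @ [(y, x)]"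
| "pth _ = []"

lemma pth_append: "pth (xs @ x # ys) = pth (x # ys) @ pth (xs @ [x])"
proof (induction xs)
  case (Cons a xs)
  then show ?case by (cases xs) auto
qed simp

lemma pth_snoc: "pth (L @ [y, x]) = (x, y) # pth (L @ [y])"
  using pth_append[of L y "[x]"] by simp

lemma pth_in:
  assumes "b \<in> set (pth L)" "sorted_wrt (<) L"
  shows "fst b \<in> set L" "snd b \<in> set L" "snd b < fst b"
  using assms by (induction L rule: pth.induct) auto

lemma pth_fst_gt: "sorted_wrt (<) (x # L) \<Longrightarrow> b \<in> set (pth (x # L)) \<Longrightarrow> x < fst b"
proof -
  assume s: "sorted_wrt (<) (x # L)" and b: "b \<in> set (pth (x # L))"
  have "snd b \<in> set (x # L)" "snd b < fst b" using pth_in[OF b s] by auto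
  then show ?thesis using s by auto
qed

lemma pth_sorted: "sorted_wrt (<) L \<Longrightarrow> sorted_wrt (\<lambda>b c. fst c < fst b) (pth L)"
proof (induction L rule: pth.induct)
  case (1 x y zs)
  have "y < fst b" if "b \<in> set (pth (y # zs))" for b
    using pth_fst_gt[of y zs b] 1(2) that by simp
  then show ?case using 1 by (simp add: sorted_wrt_append)
qed auto

lemma pth_coords: "2 \<le> length L \<Longrightarrow> fst ` set (pth L) \<union> snd ` set (pth L) = set L"
proof (induction L rule: pth.induct)
  case (1 x y zs)
  show ?case
  proof (cases zs)
    case (Cons z zs')
    then show ?thesis using 1 by auto
  qed auto
qed auto

lemma sorted_list_of_set_eqI: "sorted_wrt (<) l \<Longrightarrow> set l = A \<Longrightarrow> sorted_list_of_set A = l"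
  for l :: "int list"
  using sorted_list_of_set.idem_if_sorted_distinct[of l] by (auto simp: strict_sorted_iff)

context osp
begin

lemma st_W: "x \<in> W \<Longrightarrow> st x = dual_ind x"
  by (auto simp: st_def dual_ind_def W_def)

lemma st_notin_W: "x \<in> W \<Longrightarrow> st x \<notin> W"
  by (auto simp: st_def W_def)

lemma W_inds: "x \<in> W \<Longrightarrow> x \<in> inds"
  using W_subset_inds by blast

text \<open>For \<open>y < x\<close> in \<open>W\<close> the sign \<open>sig x y\<close> is -1, the
  fixed sign in \<open>root_vec\<close>.\<close>

lemma root_vec_eq_F: "x \<in> W \<Longrightarrow> y \<in> W \<Longrightarrow> y < x \<Longrightarrow> root_vec x y = F (x, y)"
  unfolding root_vec_def F_def by (auto simp: st_W[symmetric] sig_def kap_def scale_def fun_eq_iff par_def st_def W_def)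

lemma chain_eq_pth:
  "sorted_wrt (<) (y # js) \<Longrightarrow> set (y # js) \<subseteq> W \<Longrightarrow> chain y js = map F (pth (y # js))"
  by (induction js arbitrary: y) (auto simp: root_vec_eq_F)

lemma F_W_apply: "x \<in> W \<Longrightarrow> y \<in> W \<Longrightarrow> u \<in> W \<or> v \<in> W \<Longrightarrow> F (x, y) u v = of_bool (u = x \<and> v = y)"
  using st_notin_W by (auto simp: F_apply)

lemma F_W_block: "x \<in> W \<Longrightarrow> y \<in> W \<Longrightarrow> F (x, y) u v \<noteq> 0 \<Longrightarrow> u \<in> W \<longleftrightarrow> v \<in> W"
proof -
  assume W: "x \<in> W" "y \<in> W" and nz: "F (x, y) u v \<noteq> 0"
  have "u = x \<and> v = y \<or> u = st y \<and> v = st x" using nz by (auto simp: F_apply)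
  then show ?thesis using W st_notin_W by auto
qed

text \<open>No letter has both coordinates outside \<open>W\<close>. So a matrix in \<open>G\<close>
  that does not mix \<open>W\<close> with the other indices is determined by its block on
  \<open>W\<close>.\<close>

lemma block_eqI:
  assumes "A \<in> G" "B \<in> G" "\<And>x y. x \<in> W \<Longrightarrow> y \<in> W \<Longrightarrow> A x y = B x y"
    and "\<And>x y. A x y \<noteq> 0 \<Longrightarrow> x \<in> W \<longleftrightarrow> y \<in> W" "\<And>x y. B x y \<noteq> 0 \<Longrightarrow> x \<in> W \<longleftrightarrow> y \<in> W"
  shows "A = B"
proof (rule G_eqI[OF assms(1,2)])
  fix x y assume xy: "(x, y) \<in> lets"
  then have i: "x \<in> inds" "y \<in> inds" by (auto simp: lets_def)
  consider "x \<in> W" "y \<in> W" | "x \<in> W \<longleftrightarrow> y \<notin> W" | "x \<notin> W" "y \<notin> W" by blast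
  then show "A x y = B x y"
  proof cases
    case 3
    then have "ht x \<le> 0" "ht y \<le> 0" using ht_pos_iff i by force+
    then have "ht x = 0" "x < 0" using xy by (auto simp: lets_def)
    then show ?thesis using ht_eq_0[OF i(1)] by simp
  next
    case 2
    then have "A x y = 0" "B x y = 0" using assms(4,5) by blast+
    then show ?thesis by simp
  qed (use assms(3) in simp)
qed

definition sgn2 :: "int \<times> int \<Rightarrow> int \<times> int \<Rightarrow> complex" where
  "sgn2 b c = (-1) ^ (lpar b * lpar c)"

text \<open>The blocks on \<open>W\<close> are matrix units, so these are the relations of the
  general linear superalgebra; the mirror blocks follow by \<open>block_eqI\<close>.\<close>

lemma bracket_F:
  assumes W: "a \<in> W" "b \<in> W" "c \<in> W" "d \<in> W"
  shows "bracket (F (a, b)) (F (c, d)) =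
    scale (of_bool (b = c)) (F (a, d)) + scale (- (sgn2 (a, b) (c, d) * of_bool (d = a))) (F (c, b))" (is "?L = ?R")
proof (rule block_eqI)
  show "?L \<in> G" "?R \<in> G" using W by (auto intro!: bracket_G G_add G_scale F_G W_inds)
  fix x y
  show "x \<in> W \<longleftrightarrow> y \<in> W" if nz: "?L x y \<noteq> 0"
  proof (rule bracket_nz[OF nz])
    fix z assume "F (a, b) x z \<noteq> 0 \<and> F (c, d) z y \<noteq> 0 \<or> F (c, d) x z \<noteq> 0 \<and> F (a, b) z y \<noteq> 0"
    then show "x \<in> W \<longleftrightarrow> y \<in> W" using F_W_block W by meson
  qed
  show "x \<in> W \<longleftrightarrow> y \<in> W" if nz: "?R x y \<noteq> 0"
  proof -
    have "F (a, d) x y \<noteq> 0 \<or> F (c, b) x y \<noteq> 0" using nz by (auto simp: scale_apply)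
    then show ?thesis using F_W_block W by meson
  qed
  show "?L x y = ?R x y" if "x \<in> W" "y \<in> W"
  proof -
    have "?L x y = (\<Sum>z\<in>inds. F (a, b) x z * F (c, d) z y - sgn2 (a, b) (c, d) * (F (c, d) x z * F (a, b) z y))"
      using bracket_homog[OF homog_F_inds homog_F_inds] W W_inds by (simp add: sgn2_def)
    also have "\<dots> = (\<Sum>z\<in>inds. (if z = b then of_bool (x = a \<and> b = c \<and> y = d) else 0)
        - sgn2 (a, b) (c, d) * (if z = d then of_bool (x = c \<and> d = a \<and> y = b) else 0))"
    proof (intro sum.cong refl)
      fix z
      have e: "F (a, b) x z = of_bool (x = a \<and> z = b)" "F (c, d) z y = of_bool (z = c \<and> y = d)"
        "F (c, d) x z = of_bool (x = c \<and> z = d)" "F (a, b) z y = of_bool (z = a \<and> y = b)"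
        using F_W_apply W that by blast+
      have "of_bool (x = a \<and> z = b) * of_bool (z = c \<and> y = d) = (if z = b then of_bool (x = a \<and> b = c \<and> y = d) else (0::complex))"
        "of_bool (x = c \<and> z = d) * of_bool (z = a \<and> y = b) = (if z = d then of_bool (x = c \<and> d = a \<and> y = b) else (0::complex))"
        by auto
      then show "F (a, b) x z * F (c, d) z y - sgn2 (a, b) (c, d) * (F (c, d) x z * F (a, b) z y) =
        (if z = b then of_bool (x = a \<and> b = c \<and> y = d) else 0)
        - sgn2 (a, b) (c, d) * (if z = d then of_bool (x = c \<and> d = a \<and> y = b) else 0)"
        unfolding e by (simp only:)
    qed
    also have "\<dots> = of_bool (x = a \<and> b = c \<and> y = d) - sgn2 (a, b) (c, d) * of_bool (x = c \<and> d = a \<and> y = b)"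
      using W W_inds by (simp add: sum_subtractf flip: sum_distrib_left)
    also have "\<dots> = ?R x y"
      using F_W_apply[of a d x y] F_W_apply[of c b x y] W that
      by (simp add: scale_apply of_bool_conj mult_ac)
    finally show ?thesis .
  qed
qed

definition ff :: "int \<Rightarrow> int \<Rightarrow> endo free_alg" where
  "ff a b = gen (F (a, b))"

lemma ff_fa: "a \<in> W \<Longrightarrow> b \<in> W \<Longrightarrow> ff a b \<in> fa g"
  by (simp add: ff_def gen_fa F_G W_inds)

lemma ff_comm:
  assumes W: "a \<in> W" "b \<in> W" "c \<in> W" "d \<in> W"
  shows "ff a b * ff c d - (const (sgn2 (a, b) (c, d)) * (ff c d * ff a b) + const (of_bool (b = c)) * ff a d
      - const (sgn2 (a, b) (c, d) * of_bool (d = a)) * ff c b) \<in> U_ideal"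
proof -
  let ?A = "scale (of_bool (b = c)) (F (a, d))" and ?B = "scale (- (sgn2 (a, b) (c, d) * of_bool (d = a))) (F (c, b))"
  have G: "F (a, d) \<in> G" "F (c, b) \<in> G" "F (a, b) \<in> G" "F (c, d) \<in> G" using W by (auto intro: F_G W_inds)
  have 1: "ff a b * ff c d - const (sgn2 (a, b) (c, d)) * (ff c d * ff a b) - gen (?A + ?B) \<in> U_ideal"
    using gen_comm[OF G(3) homog_F_inds lpar_less_2 G(4) homog_F_inds lpar_less_2] W W_inds
    unfolding bracket_F[OF W] ff_def sgn2_def by simp
  have 2: "gen (?A + ?B) - (gen ?A + gen ?B) \<in> U_ideal" using G by (intro gen_add G_scale)
  have 3: "gen ?A - const (of_bool (b = c)) * ff a d \<in> U_ideal" unfolding ff_def by (rule gen_scale[OF G(1)])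
  have 4: "gen ?B - const (- (sgn2 (a, b) (c, d) * of_bool (d = a))) * ff c b \<in> U_ideal" unfolding ff_def by (rule gen_scale[OF G(2)])
  have "ff a b * ff c d - (const (sgn2 (a, b) (c, d)) * (ff c d * ff a b) + const (of_bool (b = c)) * ff a d
      - const (sgn2 (a, b) (c, d) * of_bool (d = a)) * ff c b) = 
    (ff a b * ff c d - const (sgn2 (a, b) (c, d)) * (ff c d * ff a b) - gen (?A + ?B))
    + (gen (?A + ?B) - (gen ?A + gen ?B)) + (gen ?A - const (of_bool (b = c)) * ff a d)
    + (gen ?B - const (- (sgn2 (a, b) (c, d) * of_bool (d = a))) * ff c b)"
    by (simp add: const_uminus)
  then show ?thesis using U_ideal_add[OF U_ideal_add[OF U_ideal_add[OF 1 2] 3] 4] by (simp only:)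
qed

end

section \<open>Raising operators on path words\<close>

context osp_weight
begin

text \<open>Equality after application to the highest weight vector. As \<open>K\<close> is only a
  left ideal, this relation is compatible with multiplication on the left.\<close>

definition ceq :: "endo free_alg \<Rightarrow> endo free_alg \<Rightarrow> bool" (infix "\<approxeq>" 50) where
  "p \<approxeq> q \<longleftrightarrow> p - q \<in> K"

lemma ceq_refl: "p \<approxeq> p"
  by (simp add: ceq_def K_0)

lemma ceq_trans [trans]: "p \<approxeq> q \<Longrightarrow> q \<approxeq> r \<Longrightarrow> p \<approxeq> r"
  using K_add[of "p - q" "q - r"] by (simp add: ceq_def)

lemma ceq_sym: "p \<approxeq> q \<Longrightarrow> q \<approxeq> p"
  using K_diff[OF K_0, of "p - q"] by (simp add: ceq_def)

lemma ceq_U: "p - q \<in> U_ideal \<Longrightarrow> p \<approxeq> q"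
  by (simp add: ceq_def K_U)

lemma ceq_add: "p \<approxeq> q \<Longrightarrow> p' \<approxeq> q' \<Longrightarrow> p + p' \<approxeq> q + q'"
  using K_add[of "p - q" "p' - q'"] by (simp add: ceq_def algebra_simps)

lemma ceq_mult: "p \<approxeq> q \<Longrightarrow> r \<in> fa g \<Longrightarrow> r * p \<approxeq> r * q"
  using K_mult[of "p - q" r] by (simp add: ceq_def right_diff_distrib)

lemma ceq_scale: "p \<approxeq> q \<Longrightarrow> const c * p \<approxeq> const c * q"
  by (rule ceq_mult) auto

lemma ceq_sum: "(\<And>i. i \<in> I \<Longrightarrow> f i \<approxeq> h i) \<Longrightarrow> sum f I \<approxeq> sum h I"
  using K_sum[of I "\<lambda>i. f i - h i"] by (simp add: ceq_def sum_subtractf)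

lemma ceq_0: "p \<approxeq> 0 \<longleftrightarrow> p \<in> K"
  by (simp add: ceq_def)

lemma ceq_K: "p \<approxeq> q \<Longrightarrow> p \<in> K \<longleftrightarrow> q \<in> K"
  unfolding ceq_def by (metis K_cong)

lemma neg_letter: "x \<in> W \<Longrightarrow> y \<in> W \<Longrightarrow> y < x \<Longrightarrow> (x, y) \<in> negl"
  using ht_W_less[of x y] ht_pos_iff[of x] ht_pos_iff[of y] W_inds by (auto simp: negl_def lets_def)

lemma neg_letters:
  assumes "\<And>b. b \<in> set w \<Longrightarrow> fst b \<in> W \<and> snd b \<in> W \<and> snd b < fst b"
  shows "set w \<subseteq> negl"
proof
  fix b assume "b \<in> set w"
  then have "(fst b, snd b) \<in> negl" using assms by (intro neg_letter) auto
  then show "b \<in> negl" by simp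
qed

lemma lt_ff: "y \<noteq> x \<Longrightarrow> lt (x, y) = ff x y"
  by (simp add: lt_def mu_def ff_def)

lemma F_pos: "a \<in> W \<Longrightarrow> b \<in> W \<Longrightarrow> a < b \<Longrightarrow> F (a, b) \<in> n_pos"
  using ht_W_less[of b a] W_inds by (auto simp: n_pos_eq F_G F_apply split: if_splits)

lemma ff_pos_K: "a \<in> W \<Longrightarrow> b \<in> W \<Longrightarrow> a < b \<Longrightarrow> ff a b \<in> K"
  using K_npos[of 1 "F (a, b)"] F_pos by (simp add: ff_def)

section \<open>Weights of words\<close>

definition wtw :: "(int \<times> int) list \<Rightarrow> weight" where
  "wtw u = sum_list (map (\<lambda>b. wt (fst b) - wt (snd b)) u)"

lemma wtw_Nil [simp]: "wtw [] = 0" and wtw_Cons: "wtw (b # u) = wt (fst b) - wt (snd b) + wtw u"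
  by (simp_all add: wtw_def)

lemma cartan_comm:
  assumes h: "h \<in> cartan" and b: "b \<in> lets"
  shows "gen h * gen (F b) - (gen (F b) * gen h + const (ev (wt (fst b) - wt (snd b)) h) * gen (F b)) \<in> U_ideal"
proof -
  have hG: "h \<in> G" and h0: "homog 0 h" using h by (auto simp: cartan_eq homog_def)
  let ?c = "ev (wt (fst b) - wt (snd b)) h"
  have "bracket h (F b) = scale ?c (F b)"
  proof (intro ext)
    fix x y
    show "bracket h (F b) x y = scale ?c (F b) x y"
    proof (cases "F b x y = 0")
      case False
      then have "(x, y) = b \<or> (x, y) = (st (snd b), st (fst b))" by (rule F_support[OF b])
      then have "wt x - wt y = wt (fst b) - wt (snd b)" using lets_inds[OF b] by auto
      then show ?thesis using bracket_cartan[OF h F_lets_G[OF b]] by (simp add: scale_apply)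
    qed (use bracket_cartan[OF h F_lets_G[OF b]] in \<open>simp add: scale_apply\<close>)
  qed
  then have 1: "gen h * gen (F b) - gen (F b) * gen h - gen (scale ?c (F b)) \<in> U_ideal"
    using gen_comm[OF hG h0 _ F_lets_G[OF b] homog_F[OF b] lpar_less_2] by simp
  have 2: "gen (scale ?c (F b)) - const ?c * gen (F b) \<in> U_ideal" by (rule gen_scale[OF F_lets_G[OF b]])
  show ?thesis using U_ideal_add[OF 1 2] by (simp add: algebra_simps)
qed

lemma lt_negl: "b \<in> negl \<Longrightarrow> lt b = gen (F b)"
  by (auto simp: lt_def mu_def negl_def)

lemma weight_wd:
  assumes h: "h \<in> cartan" and u: "set u \<subseteq> negl"
  shows "gen h * wd u \<approxeq> const (ev (lam + wtw u) h) * wd u"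
  using u
proof (induction u)
  case Nil
  show ?case using K_cartan[OF fa_1 h] by (simp add: ceq_def)
next
  case (Cons b u)
  have b: "b \<in> negl" "b \<in> lets" and u: "set u \<subseteq> negl" using Cons.prems negl_lets by auto
  have uf: "wd u \<in> fa g" using u negl_lets by (intro wd_fa) auto
  let ?c = "ev (wt (fst b) - wt (snd b)) h"
  have "gen h * wd (b # u) \<approxeq> lt b * (gen h * wd u) + const ?c * (lt b * wd u)"
    using U_ideal_mult_right[OF cartan_comm[OF h b(2)] uf] lt_negl[OF b(1)]
    by (intro ceq_U) (simp add: wd_Cons algebra_simps)
  also have "\<dots> \<approxeq> lt b * (const (ev (lam + wtw u) h) * wd u) + const ?c * (lt b * wd u)"
    by (intro ceq_add ceq_refl ceq_mult Cons.IH u lt_fa b)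
  also have "lt b * (const (ev (lam + wtw u) h) * wd u) + const ?c * (lt b * wd u) = const (ev (lam + wtw (b # u)) h) * wd (b # u)"
  proof -
    have "ev (lam + wtw (b # u)) h = ev (lam + wtw u) h + ?c"
      by (simp add: wtw_Cons ev_add)
    then show ?thesis
      by (simp only: wd_Cons const_add distrib_right const_left_commute)
  qed
  finally show ?case .
qed

lemma ff_diag_wd:
  assumes c: "c \<in> W" and u: "set u \<subseteq> negl"
  shows "ff c c * wd u \<approxeq> const (lam c + wtw u c) * wd u"
  using weight_wd[OF F_diag_cartan[OF c] u] by (simp add: ff_def ev_F_diag c)

text \<open>Letting the Cartan subalgebra act on an expansion of \<open>p\<close> multiplies each
  word by its own weight. By independence, the words of a different weight have coefficient
  0.\<close>

lemma weight_expand: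
  assumes p: "p \<in> fa g" and w: "\<And>h. h \<in> cartan \<Longrightarrow> gen h * p \<approxeq> const (ev \<mu> h) * p"
  obtains Us x where "finite Us" "Us \<subseteq> {u. set u \<subseteq> negl \<and> normal u \<and> (\<forall>c\<in>W. wtw u c = \<mu> c - lam c)}"
    "p \<approxeq> (\<Sum>u\<in>Us. const (x u) * wd u)"
proof -
  obtain Us x where Us: "finite Us" "Us \<subseteq> {u. set u \<subseteq> negl \<and> normal u}" "p - (\<Sum>u\<in>Us. const (x u) * wd u) \<in> K"
    by (rule verma_spanning[OF p])
  let ?q = "\<Sum>u\<in>Us. const (x u) * wd u"
  have pq: "p \<approxeq> ?q" using Us(3) by (simp add: ceq_def)
  have x0: "x u = 0" if u: "u \<in> Us" and c: "c \<in> W" and ne: "wtw u c \<noteq> \<mu> c - lam c" for u c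
  proof -
    let ?h = "F (c, c)"
    have h: "?h \<in> cartan" by (rule F_diag_cartan[OF c])
    have hf: "gen ?h \<in> fa g" using c by (intro gen_fa F_G W_inds)
    have "(\<Sum>u\<in>Us. const (x u) * (const (lam c + wtw u c) * wd u)) \<approxeq> (\<Sum>u\<in>Us. const (x u) * (gen ?h * wd u))"
      using Us(2) ff_diag_wd[OF c] by (intro ceq_sum ceq_scale ceq_sym[OF ff_diag_wd[OF c, unfolded ff_def]]) auto
    also have "(\<Sum>u\<in>Us. const (x u) * (gen ?h * wd u)) = gen ?h * ?q"
      by (simp add: sum_distrib_left const_left_commute)
    also have "gen ?h * ?q \<approxeq> gen ?h * p" by (intro ceq_mult ceq_sym[OF pq] hf)
    also have "gen ?h * p \<approxeq> const (\<mu> c) * p" using w[OF h] by (simp add: ev_F_diag c)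
    also have "const (\<mu> c) * p \<approxeq> const (\<mu> c) * ?q" by (rule ceq_scale[OF pq])
    finally have "(\<Sum>u\<in>Us. const (x u) * (const (lam c + wtw u c) * wd u) - const (\<mu> c) * (const (x u) * wd u)) \<in> K"
      unfolding ceq_def sum_distrib_left sum_subtractf[symmetric] .
    also have "(\<Sum>u\<in>Us. const (x u) * (const (lam c + wtw u c) * wd u) - const (\<mu> c) * (const (x u) * wd u))
       = (\<Sum>u\<in>Us. const (x u * (lam c + wtw u c - \<mu> c)) * wd u)"
    proof (intro sum.cong refl)
      fix u
      have "const (x u) * (const (lam c + wtw u c) * wd u) - const (\<mu> c) * (const (x u) * wd u)
        = (const (x u * (lam c + wtw u c)) - const (\<mu> c * x u)) * wd u"
        by (simp only: const_mult left_diff_distrib mult.assoc)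
      also have "const (x u * (lam c + wtw u c)) - const (\<mu> c * x u) = const (x u * (lam c + wtw u c - \<mu> c))"
        by (simp only: const_diff[symmetric] right_diff_distrib mult.commute[of "\<mu> c"])
      finally show "const (x u) * (const (lam c + wtw u c) * wd u) - const (\<mu> c) * (const (x u) * wd u)
         = const (x u * (lam c + wtw u c - \<mu> c)) * wd u" .
    qed
    finally have "(\<Sum>u\<in>Us. const (x u * (lam c + wtw u c - \<mu> c)) * wd u) \<in> K" .
    from verma_independent[OF Us(1,2) this] u have "x u * (lam c + wtw u c - \<mu> c) = 0" by blast
    moreover have "lam c + wtw u c - \<mu> c \<noteq> 0" using ne by (auto simp: algebra_simps)
    ultimately show ?thesis by simp
  qed
  let ?V = "{u \<in> Us. x u \<noteq> 0}"
  have "?q = (\<Sum>u\<in>?V. const (x u) * wd u)"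
    using Us(1) by (intro sum.mono_neutral_right) auto
  then show ?thesis using that[of ?V x] Us x0 pq by fastforce
qed

lemma pth_negl:
  assumes "sorted_wrt (<) L" "set L \<subseteq> W"
  shows "set (pth L) \<subseteq> negl"
  using pth_in[OF _ assms(1)] assms(2) by (intro neg_letters) auto

text \<open>\<open>key\<close> compares negated first coordinates, so a path read from its upper end
  is in normal order.\<close>

lemma normal_if_desc:
  assumes "sorted_wrt (\<lambda>b c. fst c < fst b) w" "set w \<subseteq> negl"
  shows "normal w"
  unfolding normal_def
  by (rule sorted_wrt_mono_rel[OF _ assms(1)]) (use assms(2) in \<open>auto simp: RR_def key_def negl_def\<close>)

lemma neg_letters_fa:
  assumes "\<And>b. b \<in> set w \<Longrightarrow> fst b \<in> W \<and> snd b \<in> W \<and> snd b < fst b"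
  shows "wd w \<in> fa g"
  using neg_letters[OF assms] negl_lets by (intro wd_fa) auto

text \<open>By \<open>bracket_F\<close> the raising letter supercommutes with every letter of
  \<open>w\<close>. The resulting scalar is recorded only when no two odd letters meet; otherwise
  the result is used only to show that a product vanishes.\<close>

lemma ff_pass:
  assumes k: "k \<in> W" "k' \<in> W"
    and w: "\<And>b. b \<in> set w \<Longrightarrow> fst b \<in> W \<and> snd b \<in> W \<and> snd b < fst b \<and> fst b \<noteq> k' \<and> snd b \<noteq> k"
  shows "\<exists>c. ff k k' * wd w - const c * (wd w * ff k k') \<in> U_ideal \<and> ((\<forall>b\<in>set w. lpar (k, k') * lpar b = 0) \<longrightarrow> c = 1)"
  using w
proof (induction w)
  case Nil
  then show ?case by (intro exI[of _ 1]) (simp add: U_ideal_0)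
next
  case (Cons b w)
  obtain x y where b: "b = (x, y)" by (cases b)
  have xy: "x \<in> W" "y \<in> W" "y < x" "x \<noteq> k'" "y \<noteq> k" using Cons.prems[of b] by (auto simp: b)
  have "\<exists>c. ff k k' * wd w - const c * (wd w * ff k k') \<in> U_ideal \<and> ((\<forall>b\<in>set w. lpar (k, k') * lpar b = 0) \<longrightarrow> c = 1)"
    by (rule Cons.IH) (use Cons.prems in auto)
  then obtain c where c: "ff k k' * wd w - const c * (wd w * ff k k') \<in> U_ideal" 
    "(\<forall>b\<in>set w. lpar (k, k') * lpar b = 0) \<longrightarrow> c = 1"
    by (elim exE conjE) (rule that)
  let ?s = "sgn2 (k, k') b"
  have wf: "wd w \<in> fa g"
    using Cons.prems by (intro neg_letters_fa) auto
  have "ff k k' * ff x y - const ?s * (ff x y * ff k k') \<in> U_ideal"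
    using ff_comm[OF k xy(1,2)] xy by (simp add: b)
  from U_ideal_mult_right[OF this wf]
  have 1: "ff k k' * wd (b # w) - const ?s * (lt b * (ff k k' * wd w)) \<in> U_ideal"
    using xy by (simp add: wd_Cons lt_ff b algebra_simps)
  have "const ?s * lt b \<in> fa g" using xy by (simp add: b lt_ff fa_mult ff_fa)
  from U_ideal_mult_left[OF c(1) this]
  have 2: "const ?s * (lt b * (ff k k' * wd w)) - const (?s * c) * (wd (b # w) * ff k k') \<in> U_ideal"
    by (simp only: wd_Cons right_diff_distrib const_mult const_left_commute[of "lt b"] mult.assoc)
  have "ff k k' * wd (b # w) - const (?s * c) * (wd (b # w) * ff k k') \<in> U_ideal"
    using U_ideal_add[OF 1 2] by simp
  moreover have "?s * c = 1" if "\<forall>b\<in>set (b # w). lpar (k, k') * lpar b = 0"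
  proof -
    have "c = 1" "lpar (k, k') * lpar b = 0" using that c(2) by auto
    then show ?thesis by (simp only: sgn2_def power_0 mult_1)
  qed
  ultimately show ?case by blast
qed

text \<open>Once it has passed the word, the raising operator meets the highest weight
  vector.\<close>

lemma ff_pass_K:
  assumes k: "k \<in> W" "k' \<in> W" "k < k'"
    and w: "\<And>b. b \<in> set w \<Longrightarrow> fst b \<in> W \<and> snd b \<in> W \<and> snd b < fst b \<and> fst b \<noteq> k' \<and> snd b \<noteq> k"
  shows "ff k k' * wd w \<in> K"
proof -
  have "\<exists>c. ff k k' * wd w - const c * (wd w * ff k k') \<in> U_ideal \<and> ((\<forall>b\<in>set w. lpar (k, k') * lpar b = 0) \<longrightarrow> c = 1)"
    by (rule ff_pass[OF k(1,2)]) (rule w)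
  then obtain c where "ff k k' * wd w - const c * (wd w * ff k k') \<in> U_ideal"
    by (elim exE conjE) (rule that)
  then have c: "ff k k' * wd w \<approxeq> const c * (wd w * ff k k')" by (rule ceq_U)
  have "wd w \<in> fa g"
  proof (rule neg_letters_fa)
    fix b assume "b \<in> set w"
    from w[OF this] show "fst b \<in> W \<and> snd b \<in> W \<and> snd b < fst b" by simp
  qed
  then have "const c * (wd w * ff k k') \<in> K"
    by (rule K_scale[OF K_mult[OF ff_pos_K[OF k]]])
  then show ?thesis using ceq_K[OF c] by simp
qed

lemma ff_pass_even:
  assumes k: "k \<in> W" "k' \<in> W"
    and w: "\<And>b. b \<in> set w \<Longrightarrow> fst b \<in> W \<and> snd b \<in> W \<and> snd b < fst b \<and> fst b \<noteq> k' \<and> snd b \<noteq> k \<and> lpar (k, k') * lpar b = 0"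
    and p: "p \<in> fa g"
  shows "ff k k' * (wd w * p) \<approxeq> wd w * (ff k k' * p)"
proof -
  have "\<exists>c. ff k k' * wd w - const c * (wd w * ff k k') \<in> U_ideal \<and> ((\<forall>b\<in>set w. lpar (k, k') * lpar b = 0) \<longrightarrow> c = 1)"
    by (rule ff_pass[OF k]) (use w in blast)
  then have "ff k k' * wd w - wd w * ff k k' \<in> U_ideal" using w by auto
  from U_ideal_mult_right[OF this p] show ?thesis by (intro ceq_U) (simp add: algebra_simps)
qed

text \<open>\<open>nx x\<close> is the index that follows \<open>x\<close>, as 0 is not an index.\<close>

definition nx :: "int \<Rightarrow> int" where
  "nx x = (if x = -1 then 1 else x + 1)"

text \<open>Minus the super sign between \<open>(k, nx k)\<close> and a letter ending at
  \<open>k\<close>, hence the coefficient of the second term of their bracket. The step from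
  \<open>-1\<close> to \<open>1\<close> is the only odd one.\<close>

definition eta :: "int \<Rightarrow> complex" where
  "eta k = (if k = -1 then 1 else -1)"

lemma nx_gt: "k < nx k"
  by (simp add: nx_def)

lemma not_between_nx: "x \<in> W \<Longrightarrow> k < x \<Longrightarrow> nx k \<le> x"
  by (auto simp: nx_def W_def)

text \<open>If the raising letter is odd, then \<open>k = -1\<close> and the letters above it join
  positive indices, so they are even.\<close>

lemma lpar_nx_pos: "k \<in> W \<Longrightarrow> nx k \<le> x \<Longrightarrow> nx k \<le> y \<Longrightarrow> lpar (k, nx k) * lpar (x, y) = 0"
  by (auto simp: lpar_def nx_def par_def W_def split: if_splits)

lemma sgn2_nx: "k \<in> W \<Longrightarrow> nx k \<le> x \<Longrightarrow> sgn2 (k, nx k) (x, k) = - eta k"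
  by (auto simp: sgn2_def lpar_def nx_def par_def W_def eta_def split: if_splits)

lemma wtw_pth: "L \<noteq> [] \<Longrightarrow> sorted_wrt (<) L \<Longrightarrow> set L \<subseteq> W \<Longrightarrow> wtw (pth L) = eps (last L) - eps (hd L)"
proof (induction L rule: pth.induct)
  case (1 x y zs)
  have app: "wtw (u @ v) = wtw u + wtw v" for u v by (simp add: wtw_def)
  show ?case using 1 by (auto simp: app wtw_Cons wt_W)
qed auto

section \<open>One raising operator on the four kinds of paths\<close>

context
  fixes k as bs
  assumes k: "k \<in> W" and k': "nx k \<in> W"
    and as: "sorted_wrt (<) as" "set as \<subseteq> W" "\<And>a. a \<in> set as \<Longrightarrow> a < k"
    and bs: "sorted_wrt (<) bs" "set bs \<subseteq> W" "\<And>b. b \<in> set bs \<Longrightarrow> nx k < b"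
begin

text \<open>The path with the step between \<open>k\<close> and \<open>nx k\<close> taken out.
  Whichever of these two vertices a path contains, raising leads to a multiple of this word.\<close>

definition Zw :: "(int \<times> int) list" where
  "Zw = pth (nx k # bs) @ pth (as @ [k])"

lemma asbs_sorted: "sorted_wrt (<) (as @ [k])" "sorted_wrt (<) (as @ [nx k])" "sorted_wrt (<) (nx k # bs)"
    "sorted_wrt (<) (k # bs)"
  using as bs nx_gt[of k] by (fastforce simp: sorted_wrt_append)+

lemma low_pass: 
  "b \<in> set (pth (as @ [k])) \<Longrightarrow> fst b \<in> W \<and> snd b \<in> W \<and> snd b < fst b \<and> fst b \<noteq> nx k \<and> snd b \<noteq> k"
proof -
  assume b: "b \<in> set (pth (as @ [k]))"
  have "fst b \<in> set (as @ [k])" "snd b \<in> set (as @ [k])" "snd b < fst b" using pth_in[OF b asbs_sorted(1)] by auto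
  moreover have "x \<le> k" if "x \<in> set (as @ [k])" for x using as(3)[of x] that by auto
  ultimately show ?thesis using as(2) k nx_gt[of k] by fastforce
qed

lemma low_pass_as: 
  "b \<in> set (pth as) \<Longrightarrow> fst b \<in> W \<and> snd b \<in> W \<and> snd b < fst b \<and> fst b \<noteq> nx k \<and> snd b \<noteq> k"
proof -
  assume b: "b \<in> set (pth as)"
  have "fst b \<in> set as" "snd b \<in> set as" "snd b < fst b" using pth_in[OF b as(1)] by auto
  then show ?thesis using as(2,3) nx_gt[of k] by fastforce
qed

lemma high_pass: 
  "b \<in> set (pth (nx k # bs)) \<Longrightarrow> fst b \<in> W \<and> snd b \<in> W \<and> snd b < fst b \<and> fst b \<noteq> nx k \<and> snd b \<noteq> k
    \<and> lpar (k, nx k) * lpar b = 0"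
proof -
  assume b: "b \<in> set (pth (nx k # bs))"
  have 1: "fst b \<in> set (nx k # bs)" "snd b \<in> set (nx k # bs)" "snd b < fst b" using pth_in[OF b asbs_sorted(3)] by auto
  have 2: "nx k \<le> x" if "x \<in> set (nx k # bs)" for x using bs(3)[of x] that by auto
  have "lpar (k, nx k) * lpar (fst b, snd b) = 0" using lpar_nx_pos[OF k 2[OF 1(1)] 2[OF 1(2)]] .
  then show ?thesis using 1 2[OF 1(2)] 2[OF 1(1)] bs(2) k' nx_gt[of k] by auto
qed

lemma high_pass_bs: 
  "b \<in> set (pth bs) \<Longrightarrow> fst b \<in> W \<and> snd b \<in> W \<and> snd b < fst b \<and> fst b \<noteq> nx k \<and> snd b \<noteq> k
    \<and> lpar (k, nx k) * lpar b = 0"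
  by (rule high_pass) (cases bs, auto)

lemma pth_negl': "set (pth (as @ [k])) \<subseteq> negl" "set (pth as) \<subseteq> negl" "set (pth (nx k # bs)) \<subseteq> negl" "set (pth bs) \<subseteq> negl"
  using pth_negl[OF asbs_sorted(1)] pth_negl[OF as(1,2)] pth_negl[OF asbs_sorted(3)] pth_negl[OF bs(1,2)] as(2) bs(2) k k'
  by auto

lemma wd_pth_fa: "wd (pth (as @ [k])) \<in> fa g" "wd (pth as) \<in> fa g" "wd (pth (nx k # bs)) \<in> fa g" "wd (pth bs) \<in> fa g"
  using pth_negl' negl_lets by (auto intro!: wd_fa)

text \<open>The bracket of the step with its raising operator is
  \<open>F (k, k) + eta k * F (nx k, nx k)\<close>, acting on the lower part of the path. That part
  ends at \<open>k\<close>, so unless it is trivial it adds 1 to the coordinate at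
  \<open>k\<close>.\<close>

lemma raise_both:
  "ff k (nx k) * wd (pth (as @ [k, nx k] @ bs)) \<approxeq>
    const (lam k + (if as = [] then 0 else 1) + eta k * lam (nx k)) * wd Zw"
proof -
  let ?Q = "wd (pth (nx k # bs))" and ?P = "wd (pth (as @ [k]))"
  let ?R = "ff k (nx k)"
  have nek: "k \<noteq> nx k" using nx_gt[of k] by simp
  have e: "wd (pth (as @ [k, nx k] @ bs)) = ?Q * (ff (nx k) k * ?P)"
    using pth_append[of as k "nx k # bs"] nek by (simp add: wd_append wd_Cons lt_ff mult.assoc)
  have RP: "?R * ?P \<in> K" by (rule ff_pass_K[OF k k' nx_gt]) (use low_pass in blast)
  have s: "sgn2 (k, nx k) (nx k, k) = - eta k" by (rule sgn2_nx[OF k order_refl])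
  have "?R * ff (nx k) k - (const (- eta k) * (ff (nx k) k * ?R) + ff k k + const (eta k) * ff (nx k) (nx k)) \<in> U_ideal"
    using ff_comm[OF k k' k' k] by (simp add: s const_uminus)
  from U_ideal_mult_right[OF this wd_pth_fa(1)]
  have "?R * (ff (nx k) k * ?P) \<approxeq> const (- eta k) * (ff (nx k) k * (?R * ?P)) + ff k k * ?P + const (eta k) * (ff (nx k) (nx k) * ?P)"
    by (intro ceq_U) (simp add: algebra_simps)
  also have "\<dots> \<approxeq> 0 + const (lam k + wtw (pth (as @ [k])) k) * ?P + const (eta k) * (const (lam (nx k) + wtw (pth (as @ [k])) (nx k)) * ?P)"
    by (intro ceq_add ceq_scale ff_diag_wd k k' pth_negl') (simp only: ceq_0, intro K_scale K_mult RP ff_fa k k')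
  also have "\<dots> = const (lam k + (if as = [] then 0 else 1) + eta k * lam (nx k)) * ?P"
  proof -
    have w: "wtw (pth (as @ [k])) = eps k - eps (hd (as @ [k]))"
      using wtw_pth[OF _ asbs_sorted(1)] as(2) k by simp
    have "wtw (pth (as @ [k])) k = (if as = [] then 0 else 1) \<and> wtw (pth (as @ [k])) (nx k) = 0"
    proof (cases "as = []")
      case False
      then have "hd (as @ [k]) < k" using as(3)[of "hd as"] by simp
      then show ?thesis unfolding w using False nx_gt[of k] by (simp add: eps_def)
    qed (simp add: w)
    then have w: "wtw (pth (as @ [k])) k = (if as = [] then 0 else 1)" "wtw (pth (as @ [k])) (nx k) = 0"
      by blast+
    show ?thesis unfolding w by (simp only: const_add const_mult distrib_right mult.assoc add_0_right add_0_left)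
  qed
  finally have 1: "?R * (ff (nx k) k * ?P) \<approxeq> \<dots>" .
  have "?R * wd (pth (as @ [k, nx k] @ bs)) \<approxeq> ?Q * (?R * (ff (nx k) k * ?P))"
    unfolding e by (rule ff_pass_even[OF k k']) (use high_pass in blast, intro fa_mult ff_fa k k' wd_pth_fa)
  also have "\<dots> \<approxeq> ?Q * (const (lam k + (if as = [] then 0 else 1) + eta k * lam (nx k)) * ?P)"
    by (rule ceq_mult[OF 1 wd_pth_fa(3)])
  finally show ?thesis by (simp add: Zw_def wd_append const_left_commute)
qed

text \<open>The bracket turns the step from the last vertex of \<open>as\<close> to
  \<open>nx k\<close> into a step to \<open>k\<close>.\<close>

lemma raise_upper:
  assumes ne: "as \<noteq> []"
  shows "ff k (nx k) * wd (pth (as @ [nx k] @ bs)) \<approxeq> wd Zw"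
proof -
  obtain as' a where asa: "as = as' @ [a]" using ne by (cases as rule: rev_cases) auto
  let ?Q = "wd (pth (nx k # bs))" and ?P = "wd (pth as)"
  let ?R = "ff k (nx k)"
  have a: "a \<in> W" "a < k" using as asa by auto
  have e: "wd (pth (as @ [nx k] @ bs)) = ?Q * (ff (nx k) a * ?P)"
    using pth_append[of as "nx k" bs] pth_snoc[of as' a "nx k"] a nx_gt[of k] by (simp add: wd_append wd_Cons lt_ff asa)
  have z: "ff k a * ?P = wd (pth (as @ [k]))"
    using pth_snoc[of as' a k] a by (simp add: asa wd_Cons lt_ff)
  have RP: "?R * ?P \<in> K" by (rule ff_pass_K[OF k k' nx_gt]) (use low_pass_as in blast)
  have "?R * ff (nx k) a - (const (sgn2 (k, nx k) (nx k, a)) * (ff (nx k) a * ?R) + ff k a) \<in> U_ideal"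
    using ff_comm[OF k k' k' a(1)] a by simp
  from U_ideal_mult_right[OF this wd_pth_fa(2)]
  have "?R * (ff (nx k) a * ?P) \<approxeq> const (sgn2 (k, nx k) (nx k, a)) * (ff (nx k) a * (?R * ?P)) + wd (pth (as @ [k]))"
    by (intro ceq_U) (simp add: algebra_simps flip: z)
  also have "\<dots> \<approxeq> 0 + wd (pth (as @ [k]))"
    by (intro ceq_add ceq_refl) (simp only: ceq_0, intro K_scale K_mult RP ff_fa a k')
  finally have 1: "?R * (ff (nx k) a * ?P) \<approxeq> wd (pth (as @ [k]))" by simp
  have "?R * wd (pth (as @ [nx k] @ bs)) \<approxeq> ?Q * (?R * (ff (nx k) a * ?P))"
    unfolding e by (rule ff_pass_even[OF k k']) (use high_pass in blast, intro fa_mult ff_fa a k' wd_pth_fa)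
  also have "\<dots> \<approxeq> ?Q * wd (pth (as @ [k]))" by (rule ceq_mult[OF 1 wd_pth_fa(3)])
  finally show ?thesis by (simp add: Zw_def wd_append)
qed

text \<open>The bracket turns the step that leaves \<open>k\<close> into one that leaves
  \<open>nx k\<close>; it is the second term of \<open>bracket_F\<close>, whence the factor
  \<open>eta k\<close>.\<close>

lemma raise_lower:
  assumes ne: "bs \<noteq> []"
  shows "ff k (nx k) * wd (pth (as @ [k] @ bs)) \<approxeq> const (eta k) * wd Zw"
proof -
  obtain b bs' where bsb: "bs = b # bs'" using ne by (cases bs) auto
  let ?Q = "wd (pth bs)" and ?P = "wd (pth (as @ [k]))"
  let ?R = "ff k (nx k)"
  have b: "b \<in> W" "nx k < b" "k < b" using bs nx_gt[of k] bsb by (auto intro: less_trans)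
  have e: "wd (pth (as @ [k] @ bs)) = ?Q * (ff b k * ?P)"
    using pth_append[of as k bs] b by (simp add: bsb wd_append wd_Cons lt_ff mult.assoc)
  have z: "?Q * (ff b (nx k) * ?P) = wd Zw"
    unfolding Zw_def using b by (simp add: bsb wd_append wd_Cons lt_ff mult.assoc)
  have RP: "?R * ?P \<in> K" by (rule ff_pass_K[OF k k' nx_gt]) (use low_pass in blast)
  have s: "sgn2 (k, nx k) (b, k) = - eta k" by (rule sgn2_nx[OF k]) (use b in simp)
  have "?R * ff b k - (const (- eta k) * (ff b k * ?R) + const (eta k) * ff b (nx k)) \<in> U_ideal"
    using ff_comm[OF k k' b(1) k] b by (simp add: s const_uminus)
  from U_ideal_mult_right[OF this wd_pth_fa(1)]
  have "?R * (ff b k * ?P) \<approxeq> const (- eta k) * (ff b k * (?R * ?P)) + const (eta k) * (ff b (nx k) * ?P)"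
    by (intro ceq_U) (simp add: algebra_simps)
  also have "\<dots> \<approxeq> 0 + const (eta k) * (ff b (nx k) * ?P)"
    by (intro ceq_add ceq_refl) (simp only: ceq_0, intro K_scale K_mult RP ff_fa b k)
  finally have 1: "?R * (ff b k * ?P) \<approxeq> const (eta k) * (ff b (nx k) * ?P)" by simp
  have "?R * wd (pth (as @ [k] @ bs)) \<approxeq> ?Q * (?R * (ff b k * ?P))"
    unfolding e by (rule ff_pass_even[OF k k']) (use high_pass_bs in blast, intro fa_mult ff_fa b k wd_pth_fa)
  also have "\<dots> \<approxeq> ?Q * (const (eta k) * (ff b (nx k) * ?P))" by (rule ceq_mult[OF 1 wd_pth_fa(4)])
  also have "\<dots> = const (eta k) * wd Zw" by (simp add: const_left_commute flip: z)
  finally show ?thesis .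
qed

lemma raise_none: "ff k (nx k) * wd (pth (as @ bs)) \<in> K"
proof (rule ff_pass_K[OF k k' nx_gt])
  fix b assume b: "b \<in> set (pth (as @ bs))"
  have "sorted_wrt (<) (as @ bs)" using as bs nx_gt[of k] by (fastforce simp: sorted_wrt_append)
  note pth_in[OF b this]
  moreover have "k \<notin> set (as @ bs)" "nx k \<notin> set (as @ bs)"
    using as(3)[of k] as(3)[of "nx k"] bs(3)[of k] bs(3)[of "nx k"] nx_gt[of k] by auto
  ultimately show "fst b \<in> W \<and> snd b \<in> W \<and> snd b < fst b \<and> fst b \<noteq> nx k \<and> snd b \<noteq> k"
    using as(2) bs(2) by auto
qed

lemma Zw_normal: "normal Zw" "set Zw \<subseteq> negl"
proof -
  show n: "set Zw \<subseteq> negl" using pth_negl' by (simp add: Zw_def)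
  have "fst c < fst b" if b: "b \<in> set (pth (nx k # bs))" and c: "c \<in> set (pth (as @ [k]))" for b c
  proof -
    have "nx k < fst b" using pth_fst_gt[OF asbs_sorted(3) b] .
    moreover have "fst c \<le> k" using pth_in(1)[OF c asbs_sorted(1)] as(3) by fastforce
    ultimately show ?thesis using nx_gt[of k] by simp
  qed
  then have "sorted_wrt (\<lambda>b c. fst c < fst b) Zw"
    using pth_sorted[OF asbs_sorted(3)] pth_sorted[OF asbs_sorted(1)] by (auto simp: Zw_def sorted_wrt_append)
  then show "normal Zw" using n by (rule normal_if_desc)
qed

text \<open>Recovers the vertices from the word, for injectivity. \<open>k\<close> and
  \<open>nx k\<close> are discarded because they occur in the word only when \<open>as\<close>,
  respectively \<open>bs\<close>, is nonempty.\<close>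

lemma Zw_coords: "(fst ` set Zw \<union> snd ` set Zw) - {k, nx k} = set as \<union> set bs"
proof -
  have un: "(a \<union> b) \<union> (c \<union> d) - S = Y \<union> X" if "(a \<union> c) - S = X" "(b \<union> d) - S = Y" for a b c d X Y S :: "int set"
    using that by blast
  have "(fst ` set (pth (nx k # bs)) \<union> snd ` set (pth (nx k # bs))) - {k, nx k} = set bs"
  proof (cases bs)
    case (Cons b bs')
    then have "fst ` set (pth (nx k # bs)) \<union> snd ` set (pth (nx k # bs)) = set (nx k # bs)"
      by (intro pth_coords) simp
    moreover have "k \<notin> set bs" "nx k \<notin> set bs" using bs(3)[of k] bs(3)[of "nx k"] nx_gt[of k] by auto
    ultimately show ?thesis by auto
  qed simp
  moreover have "(fst ` set (pth (as @ [k])) \<union> snd ` set (pth (as @ [k]))) - {k, nx k} = set as"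
  proof (cases as)
    case (Cons a as')
    then have "fst ` set (pth (as @ [k])) \<union> snd ` set (pth (as @ [k])) = set (as @ [k])"
      by (intro pth_coords) simp
    moreover have "k \<notin> set as" "nx k \<notin> set as" using as(3)[of k] as(3)[of "nx k"] nx_gt[of k] by auto
    ultimately show ?thesis by auto
  qed simp
  ultimately show ?thesis unfolding Zw_def set_append image_Un by (intro un)
qed

end

end

section \<open>The singular vector\<close>

lemma sum_Pow_insert:
  assumes "finite X" "a \<notin> X"
  shows "(\<Sum>I\<in>Pow (insert a X). f I) = (\<Sum>I\<in>Pow X. f I + f (insert a I))"
proof -
  have "(\<Sum>I\<in>Pow (insert a X). f I) = (\<Sum>I\<in>Pow X. f I) + (\<Sum>I\<in>insert a ` Pow X. f I)"
    unfolding Pow_insert using assms by (intro sum.union_disjoint) auto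
  also have "(\<Sum>I\<in>insert a ` Pow X. f I) = (\<Sum>I\<in>Pow X. f (insert a I))"
    using assms by (subst sum.reindex) (auto simp: inj_on_def)
  finally show ?thesis by (simp add: sum.distrib)
qed

context osp_weight
begin

lemma verma_independent_inj:
  assumes A: "finite A" and f: "inj_on f A" "\<And>i. i \<in> A \<Longrightarrow> set (f i) \<subseteq> negl \<and> normal (f i)"
    and K: "(\<Sum>i\<in>A. const (x i) * wd (f i)) \<in> K" and i: "i \<in> A"
  shows "x i = 0"
proof -
  have "(\<Sum>u\<in>f ` A. const (x (the_inv_into A f u)) * wd u) = (\<Sum>i\<in>A. const (x i) * wd (f i))"
    by (subst sum.reindex[OF f(1)], rule sum.cong) (simp_all add: the_inv_into_f_f[OF f(1)])
  then have "\<forall>u\<in>f ` A. x (the_inv_into A f u) = 0"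
    using A f(2) K by (intro verma_independent) auto
  then show ?thesis using i the_inv_into_f_f[OF f(1)] by auto
qed

section \<open>Functionals that bound the weights of words\<close>

definition tot :: "weight \<Rightarrow> real" where
  "tot \<mu> = Re (\<Sum>d\<in>W. \<mu> d)"

text \<open>For every \<open>c\<close> this is at most 0 on \<open>eps x - eps y\<close> with
  \<open>y < x\<close>. The bounds for varying \<open>c\<close> confine the weights of words in
  \<open>W\<close>.\<close>

definition psum :: "int \<Rightarrow> weight \<Rightarrow> real" where
  "psum c \<mu> = Re (\<Sum>d\<in>{d \<in> W. d \<le> c}. \<mu> d)"

lemma tot_add: "tot (\<mu> + \<nu>) = tot \<mu> + tot \<nu>" and tot_diff: "tot (\<mu> - \<nu>) = tot \<mu> - tot \<nu>"
  and tot_uminus: "tot (- \<mu>) = - tot \<mu>" and tot_0: "tot 0 = 0"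
  by (simp_all add: tot_def sum.distrib sum_subtractf sum_negf)

lemma psum_add: "psum c (\<mu> + \<nu>) = psum c \<mu> + psum c \<nu>" and psum_diff: "psum c (\<mu> - \<nu>) = psum c \<mu> - psum c \<nu>"
  and psum_0: "psum c 0 = 0"
  by (simp_all add: psum_def sum.distrib sum_subtractf)

lemma sum_eps_arg: "finite Q \<Longrightarrow> (\<Sum>d\<in>Q. eps x d) = of_bool (x \<in> Q)"
  by (simp add: eps_def of_bool_def sum.delta)

lemma tot_eps: "x \<in> W \<Longrightarrow> tot (eps x) = 1"
  unfolding tot_def by (subst sum_eps_arg) auto

lemma psum_eps: "x \<in> W \<Longrightarrow> psum c (eps x) = of_bool (x \<le> c)"
  unfolding psum_def by (subst sum_eps_arg) auto

lemma tot_wt: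
  assumes "x \<in> inds"
  shows "tot (wt x) \<le> 1 \<and> (tot (wt x) = 1 \<longrightarrow> x \<in> W)"
  by (rule inds_cases[OF assms]) (use assms in \<open>auto simp: wt_W wt_st_W tot_eps tot_uminus wt_mid tot_0\<close>)

text \<open>A negative letter has its second coordinate in \<open>W\<close>, which contributes -1,
  while its first coordinate contributes at most 1, with equality only in \<open>W\<close>.\<close>

lemma tot_wtw:
  assumes "set u \<subseteq> negl"
  shows "tot (wtw u) \<le> 0 \<and> (tot (wtw u) = 0 \<longrightarrow> (\<forall>b\<in>set u. fst b \<in> W \<and> snd b \<in> W \<and> snd b < fst b))"
  using assms
proof (induction u)
  case (Cons b u)
  have b: "b \<in> lets" "ht (fst b) < ht (snd b)" using Cons.prems by (auto simp: negl_def)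
  have i: "fst b \<in> inds" "snd b \<in> inds" using lets_inds[OF b(1)] by auto
  have "ht (snd b) > 0" using b by (cases b) (auto simp: lets_def)
  then have s: "snd b \<in> W" using ht_pos_iff i by blast
  have "tot (wtw (b # u)) = (tot (wt (fst b)) - 1) + tot (wtw u)"
    using s by (simp add: wtw_Cons tot_add tot_diff wt_W tot_eps)
  moreover have "snd b < fst b" if "fst b \<in> W" using that s b(2) ht_W_less by blast
  ultimately show ?case using Cons tot_wt[OF i(1)] s by auto
qed (simp add: tot_0)

lemma psum_wtw:
  assumes "\<forall>b\<in>set u. fst b \<in> W \<and> snd b \<in> W \<and> snd b < fst b"
  shows "psum c (wtw u) \<le> 0"
  using assms by (induction u) (auto simp: psum_0 wtw_Cons psum_add psum_diff wt_W psum_eps)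

lemma tot_cong: "(\<And>c. c \<in> W \<Longrightarrow> \<mu> c = \<nu> c) \<Longrightarrow> tot \<mu> = tot \<nu>"
  by (simp add: tot_def)

lemma psum_cong: "(\<And>c. c \<in> W \<Longrightarrow> \<mu> c = \<nu> c) \<Longrightarrow> psum d \<mu> = psum d \<nu>"
  by (simp add: psum_def)

text \<open>
  The first letter of a normal word has the largest first coordinate, which therefore is not
  cancelled in the weight; hence it is the end of the path.
\<close>

lemma path_word:
  assumes "normal u" "\<forall>b\<in>set u. fst b \<in> W \<and> snd b \<in> W \<and> snd b < fst b"
    and "\<forall>c\<in>W. wtw u c = eps z c - eps a c" "z \<in> W" "a \<in> W"
  shows "\<exists>L. L \<noteq> [] \<and> sorted_wrt (<) L \<and> set L \<subseteq> W \<and> hd L = a \<and> last L = z \<and> u = pth L"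
  using assms
proof (induction u arbitrary: z)
  case Nil
  then have "eps z z - eps a z = 0" by simp
  then have "z = a" by (auto simp: eps_def split: if_splits)
  then show ?case using Nil by (intro exI[of _ "[a]"]) auto
next
  case (Cons b u)
  obtain x y where b: "b = (x, y)" by (cases b)
  have xy: "x \<in> W" "y \<in> W" "y < x" using Cons.prems(2) by (auto simp: b)
  have u: "\<forall>b\<in>set u. fst b \<in> W \<and> snd b \<in> W \<and> snd b < fst b" "normal u"
    using Cons.prems by (auto simp: normal_Cons)
  have le: "fst c \<le> x" if "c \<in> set u" for c
  proof -
    have "RR b c" using Cons.prems(1) that by (auto simp: normal_Cons)
    moreover have "b \<in> negl" "c \<in> negl" using neg_letters[of "b # u"] Cons.prems(2) that by auto
    ultimately show ?thesis by (auto simp: RR_def key_def b negl_def split: if_splits)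
  qed
  \<comment> \<open>No letter subtracts \<open>eps x\<close>: first coordinates are at most
    \<open>x\<close>, and second coordinates lie strictly below them.\<close>
  have "Re (wtw v x) \<ge> 0" if "\<forall>b\<in>set v. fst b \<in> W \<and> snd b \<in> W \<and> snd b < fst b" "\<forall>c\<in>set v. fst c \<le> x" for v
    using that by (induction v) (auto simp: wtw_Cons wt_W eps_def)
  then have "Re (wtw u x) \<ge> 0" using u le by blast
  then have "Re (wtw (b # u) x) \<ge> 1" using xy by (simp add: wtw_Cons b wt_W eps_def)
  then have "Re (eps z x - eps a x) \<ge> 1" using Cons.prems(3) xy(1) by simp
  then have zx: "z = x" by (auto simp: eps_def of_bool_def split: if_splits)
  have "\<forall>c\<in>W. wtw u c = eps y c - eps a c"
  proof
    fix c assume "c \<in> W"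
    then have "wtw (b # u) c = eps x c - eps a c" using Cons.prems(3) zx by simp
    then show "wtw u c = eps y c - eps a c" using xy by (simp add: wtw_Cons b wt_W algebra_simps)
  qed
  from Cons.IH[OF u(2,1) this xy(2) Cons.prems(5)]
  obtain L where L: "L \<noteq> []" "sorted_wrt (<) L" "set L \<subseteq> W" "hd L = a" "last L = y" "u = pth L"
    by blast
  obtain L' where L': "L = L' @ [y]" using L(1,5) by (metis append_butlast_last_id)
  have "pth (L @ [x]) = b # u" using pth_snoc[of L' y x] by (simp add: L' L(6) b)
  moreover have "sorted_wrt (<) (L @ [x])" using L(2) xy(3) by (fastforce simp: L' sorted_wrt_append)
  ultimately show ?case using L xy zx by (intro exI[of _ "L @ [x]"]) auto
qed

end

section \<open>Paths from \<open>- s\<close> to \<open>t\<close> and the equations for their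
  coefficients\<close>

locale osp_beta = osp_weight m n ex lam for m n :: nat and ex :: bool and lam :: weight +
  fixes s t :: nat
  assumes s: "1 \<le> s" "s \<le> n" and t: "1 \<le> t" "t \<le> m"
begin

abbreviation a0 :: int where "a0 \<equiv> - int s"
abbreviation b0 :: int where "b0 \<equiv> int t"

definition Ix :: "int set" where
  "Ix = {a0 .. b0} - {0}"

definition pw :: "int set \<Rightarrow> (int \<times> int) list" where
  "pw I = pth (sorted_list_of_set I)"

text \<open>The scalar in \<open>raise_both\<close>: the lower part of a path that starts at
  \<open>a0\<close> is trivial exactly for \<open>k = a0\<close>.\<close>

definition hk :: "int \<Rightarrow> complex" where
  "hk k = lam k + (if k = a0 then 0 else 1) + eta k * lam (nx k)"

definition Zww :: "int \<Rightarrow> int set \<Rightarrow> (int \<times> int) list" where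
  "Zww k I = Zw k (sorted_list_of_set {x \<in> I. x < k}) (sorted_list_of_set {x \<in> I. nx k < x})"

definition rk :: "int \<Rightarrow> int set \<Rightarrow> complex" where
  "rk k I = (if k \<in> I \<and> nx k \<in> I then hk k else if nx k \<in> I then 1 else if k \<in> I then eta k else 0)"

lemma Ix_W: "Ix \<subseteq> W"
  using s t by (auto simp: Ix_def W_def)

lemma finite_Ix: "finite Ix"
  by (simp add: Ix_def)

lemma ab_Ix: "a0 \<in> Ix" "b0 \<in> Ix" "a0 < b0"
  using s t by (auto simp: Ix_def)

lemma nx_Ix: "k \<in> Ix \<Longrightarrow> k < b0 \<Longrightarrow> nx k \<in> Ix"
  using t by (auto simp: Ix_def nx_def)

lemma sorted_sub: "I \<subseteq> Ix \<Longrightarrow> set (sorted_list_of_set I) = I \<and> sorted_wrt (<) (sorted_list_of_set I)"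
  using finite_subset[OF _ finite_Ix] by simp

text \<open>No index lies strictly between \<open>k\<close> and \<open>nx k\<close>, so the four
  cases are complete. The end points in \<open>I\<close> keep the lower or upper part nonempty where
  a neighbour is needed.\<close>

lemma raise_path:
  assumes I: "I \<subseteq> Ix" "a0 \<in> I" "b0 \<in> I" and k: "k \<in> Ix" "k < b0"
  shows "ff k (nx k) * wd (pw I) \<approxeq> const (rk k I) * wd (Zww k (I - {k, nx k}))"
proof -
  let ?as = "sorted_list_of_set {x \<in> I. x < k}" and ?bs = "sorted_list_of_set {x \<in> I. nx k < x}"
  have kW: "k \<in> W" "nx k \<in> W" using k nx_Ix Ix_W by auto
  have fin: "finite I" using I finite_Ix finite_subset by blast
  have as: "sorted_wrt (<) ?as" "set ?as \<subseteq> W" "\<And>a. a \<in> set ?as \<Longrightarrow> a < k"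
    and bs: "sorted_wrt (<) ?bs" "set ?bs \<subseteq> W" "\<And>b. b \<in> set ?bs \<Longrightarrow> nx k < b"
    using fin I Ix_W by auto
  have sets: "set ?as = {x \<in> I. x < k}" "set ?bs = {x \<in> I. nx k < x}" using fin by auto
  have Z: "Zww k (I - {k, nx k}) = Zw k ?as ?bs"
  proof -
    have "{x \<in> I - {k, nx k}. x < k} = {x \<in> I. x < k}" "{x \<in> I - {k, nx k}. nx k < x} = {x \<in> I. nx k < x}"
      using nx_gt[of k] by auto
    then show ?thesis by (simp add: Zww_def)
  qed
  have part: "x < k \<or> x = k \<or> x = nx k \<or> nx k < x" if "x \<in> I" for x
    using that I Ix_W not_between_nx[of x k] by fastforce
  have srt: "sorted_wrt (<) (?as @ mid @ ?bs)" if mid: "mid \<in> {[], [k], [nx k], [k, nx k]}" for mid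
  proof -
    have "sorted_wrt (<) mid" using mid nx_gt[of k] by auto
    moreover have m: "k \<le> x \<and> x \<le> nx k" if "x \<in> set mid" for x using mid that nx_gt[of k] by auto
    have "x < y" if "x \<in> set ?as" "y \<in> set (mid @ ?bs)" for x y
    proof -
      have "y \<in> set mid \<or> y \<in> set ?bs" using that(2) by simp
      then have "k \<le> y" using m[of y] bs(3)[of y] nx_gt[of k] by linarith
      then show ?thesis using as(3)[OF that(1)] by simp
    qed
    moreover have "x < y" if "x \<in> set mid" "y \<in> set ?bs" for x y
      using m[OF that(1)] bs(3)[OF that(2)] by simp
    ultimately show ?thesis using as(1) bs(1) by (simp only: sorted_wrt_append) blast
  qed
  have L: "sorted_list_of_set I = ?as @ mid @ ?bs" if "mid \<in> {[], [k], [nx k], [k, nx k]}" "set mid = I \<inter> {k, nx k}" for mid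
    using part that(2) by (intro sorted_list_of_set_eqI srt that(1)) (auto simp: sets)
  note facts = kW as bs
  consider "k \<in> I" "nx k \<in> I" | "k \<notin> I" "nx k \<in> I" | "k \<in> I" "nx k \<notin> I" | "k \<notin> I" "nx k \<notin> I" by blast
  then show ?thesis
  proof cases
    case 1
    then have L': "sorted_list_of_set I = ?as @ [k, nx k] @ ?bs" by (intro L) auto
    have "?as = [] \<longleftrightarrow> k = a0"
    proof
      assume "?as = []"
      then have "\<not> a0 < k" using sets(1) I(2) by auto
      then show "k = a0" using k by (auto simp: Ix_def)
    next
      assume "k = a0"
      then have "{x \<in> I. x < k} = {}" using I(1) by (auto simp: Ix_def)
      then show "?as = []" by (simp only: sorted_list_of_set.sorted_key_list_of_set_empty)
    qed
    then show ?thesis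
      using raise_both[OF facts] 1 by (simp only: pw_def L' Z rk_def hk_def) simp
  next
    case 2
    then have L': "sorted_list_of_set I = ?as @ [nx k] @ ?bs" by (intro L) auto
    have "a0 < k" using I(2) 2 k by (cases "k = a0") (auto simp: Ix_def)
    then have "?as \<noteq> []" using sets(1) I(2) by fastforce
    then show ?thesis
      using raise_upper[OF facts] 2 by (simp only: pw_def L' Z rk_def) simp
  next
    case 3
    then have L': "sorted_list_of_set I = ?as @ [k] @ ?bs" by (intro L) auto
    have "nx k < b0" using I(3) 3 k ab_Ix Ix_W not_between_nx[of b0 k] by (cases "nx k = b0") auto
    then have "?bs \<noteq> []" using sets(2) I(3) by fastforce
    then show ?thesis
      using raise_lower[OF facts] 3 by (simp only: pw_def L' Z rk_def) simp
  next
    case 4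
    then have L': "sorted_list_of_set I = ?as @ [] @ ?bs" by (intro L) auto
    then show ?thesis
      using raise_none[OF facts] 4 by (simp add: pw_def rk_def ceq_0)
  qed
qed

text \<open>The coefficient of \<open>Zww k I\<close> after applying the raising operator from \<open>nx k\<close> to \<open>k\<close>.\<close>

definition eqn :: "(int set \<Rightarrow> complex) \<Rightarrow> int \<Rightarrow> int set \<Rightarrow> complex" where
  "eqn y k I = hk k * y (insert k (insert (nx k) I)) + y (insert (nx k) I) + eta k * y (insert k I)"

lemma pw_negl: "I \<subseteq> Ix \<Longrightarrow> set (pw I) \<subseteq> negl"
  and pw_normal: "I \<subseteq> Ix \<Longrightarrow> normal (pw I)"
proof -
  assume I: "I \<subseteq> Ix"
  have L: "set (sorted_list_of_set I) = I" "sorted_wrt (<) (sorted_list_of_set I)" using sorted_sub[OF I] by auto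
  show n: "set (pw I) \<subseteq> negl" unfolding pw_def using pth_negl[OF L(2)] L(1) I Ix_W by auto
  show "normal (pw I)" using pth_sorted[OF L(2)] n unfolding pw_def by (rule normal_if_desc)
qed

lemma pw_coords:
  assumes I: "I \<subseteq> Ix" "a0 \<in> I" "b0 \<in> I"
  shows "fst ` set (pw I) \<union> snd ` set (pw I) = I"
proof -
  have fin: "finite I" using I finite_Ix finite_subset by auto
  have "a0 \<noteq> b0" using ab_Ix(3) by linarith
  then have "card {a0, b0} = 2" unfolding card_2_iff by blast
  moreover have "card {a0, b0} \<le> card I" using I fin by (intro card_mono) auto
  ultimately have "2 \<le> length (sorted_list_of_set I)" by simp
  then show ?thesis unfolding pw_def using pth_coords fin by simp
qed

lemma pw_inj: "inj_on pw {I \<in> Pow Ix. a0 \<in> I \<and> b0 \<in> I}"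
proof (rule inj_onI)
  fix I J assume I: "I \<in> {I \<in> Pow Ix. a0 \<in> I \<and> b0 \<in> I}" and J: "J \<in> {I \<in> Pow Ix. a0 \<in> I \<and> b0 \<in> I}" and e: "pw I = pw J"
  have "fst ` set (pw I) \<union> snd ` set (pw I) = I" by (rule pw_coords) (use I in auto)
  moreover have "fst ` set (pw J) \<union> snd ` set (pw J) = J" by (rule pw_coords) (use J in auto)
  ultimately show "I = J" unfolding e by (rule subst)
qed

lemma pw_fa: "I \<subseteq> Ix \<Longrightarrow> wd (pw I) \<in> fa g"
  using pw_negl negl_lets by (intro wd_fa) blast

text \<open>The four subsets that agree outside \<open>k\<close> and \<open>nx k\<close> lead to the
  same word, so their contributions are collected in \<open>eqn\<close>. Summing over all subsets,
  with \<open>y\<close> zero when an end is missing, keeps this grouping uniform even when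
  \<open>k\<close> or \<open>nx k\<close> is an end.\<close>

lemma raise_sum:
  assumes y: "\<And>I. a0 \<notin> I \<or> b0 \<notin> I \<Longrightarrow> y I = 0" and k: "k \<in> Ix" "k < b0"
  shows "ff k (nx k) * (\<Sum>I\<in>Pow Ix. const (y I) * wd (pw I)) \<approxeq>
    (\<Sum>I\<in>Pow (Ix - {k, nx k}). const (eqn y k I) * wd (Zww k I))"
proof -
  let ?X = "Ix - {k, nx k}"
  let ?f = "\<lambda>I. const (y I * rk k I) * wd (Zww k (I - {k, nx k}))"
  have nek: "k \<noteq> nx k" using nx_gt[of k] by simp
  have Ix: "Ix = insert k (insert (nx k) ?X)" using k nx_Ix by auto
  have fin: "finite ?X" using finite_Ix by simp
  have "ff k (nx k) * (\<Sum>I\<in>Pow Ix. const (y I) * wd (pw I)) = (\<Sum>I\<in>Pow Ix. const (y I) * (ff k (nx k) * wd (pw I)))"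
    by (simp only: sum_distrib_left const_left_commute)
  also have "\<dots> \<approxeq> (\<Sum>I\<in>Pow Ix. ?f I)"
  proof (rule ceq_sum)
    fix I assume I: "I \<in> Pow Ix"
    show "const (y I) * (ff k (nx k) * wd (pw I)) \<approxeq> ?f I"
    proof (cases "a0 \<in> I \<and> b0 \<in> I")
      case True
      have "ff k (nx k) * wd (pw I) \<approxeq> const (rk k I) * wd (Zww k (I - {k, nx k}))"
        by (rule raise_path) (use True I k in auto)
      from ceq_scale[OF this, of "y I"] show ?thesis by (simp only: const_mult mult.assoc)
    qed (simp add: y ceq_refl)
  qed
  also have "(\<Sum>I\<in>Pow Ix. ?f I) = (\<Sum>I\<in>Pow ?X. ?f I + ?f (insert (nx k) I) + (?f (insert k I) + ?f (insert k (insert (nx k) I))))"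
  proof -
    have "(\<Sum>I\<in>Pow Ix. ?f I) = (\<Sum>I\<in>Pow (insert (nx k) ?X). ?f I + ?f (insert k I))"
      by (subst Ix, subst sum_Pow_insert) (use fin nek in auto)
    also have "\<dots> = (\<Sum>I\<in>Pow ?X. ?f I + ?f (insert k I) + (?f (insert (nx k) I) + ?f (insert k (insert (nx k) I))))"
      by (subst sum_Pow_insert) (use fin in auto)
    finally show ?thesis by (simp only: add_ac)
  qed
  also have "\<dots> = (\<Sum>I\<in>Pow ?X. const (eqn y k I) * wd (Zww k I))"
  proof (intro sum.cong refl)
    fix I assume "I \<in> Pow ?X"
    then have I: "k \<notin> I" "nx k \<notin> I" by auto
    then have d: "I - {k, nx k} = I" "insert (nx k) I - {k, nx k} = I" "insert k I - {k, nx k} = I"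
      "insert k (insert (nx k) I) - {k, nx k} = I" by auto
    have r: "rk k I = 0" "rk k (insert (nx k) I) = 1" "rk k (insert k I) = eta k" "rk k (insert k (insert (nx k) I)) = hk k"
      using I nek by (auto simp: rk_def)
    show "?f I + ?f (insert (nx k) I) + (?f (insert k I) + ?f (insert k (insert (nx k) I))) = const (eqn y k I) * wd (Zww k I)"
      unfolding d r by (simp add: eqn_def const_add distrib_right mult.commute[of "eta k"] mult.commute[of "hk k"])
  qed
  finally show ?thesis .
qed

lemma Zww_facts:
  assumes "I \<subseteq> Ix - {k, nx k}" and k: "k \<in> Ix" "k < b0"
  shows "normal (Zww k I)" "set (Zww k I) \<subseteq> negl" "(fst ` set (Zww k I) \<union> snd ` set (Zww k I)) - {k, nx k} = I"
proof -
  let ?as = "sorted_list_of_set {x \<in> I. x < k}" and ?bs = "sorted_list_of_set {x \<in> I. nx k < x}"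
  have kW: "k \<in> W" "nx k \<in> W" using k nx_Ix Ix_W by auto
  have fin: "finite I" using assms(1) finite_Ix finite_subset by blast
  have as: "sorted_wrt (<) ?as" "set ?as \<subseteq> W" "\<And>a. a \<in> set ?as \<Longrightarrow> a < k"
    and bs: "sorted_wrt (<) ?bs" "set ?bs \<subseteq> W" "\<And>b. b \<in> set ?bs \<Longrightarrow> nx k < b"
    using fin assms(1) Ix_W by auto
  note facts = kW as bs
  show "normal (Zww k I)" "set (Zww k I) \<subseteq> negl"
    using Zw_normal[OF facts] by (auto simp: Zww_def)
  have "x < k \<or> nx k < x" if "x \<in> I" for x
    using that assms(1) Ix_W not_between_nx[of x k] by fastforce
  then have "set ?as \<union> set ?bs = I" using fin by auto
  then show "(fst ` set (Zww k I) \<union> snd ` set (Zww k I)) - {k, nx k} = I"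
    unfolding Zww_def using Zw_coords[OF facts] by simp
qed

text \<open>The words \<open>Zww k I\<close> are normal and distinct, so independence gives one
  equation for each \<open>I\<close>.\<close>

lemma raise_sum_zero_iff:
  assumes y: "\<And>I. a0 \<notin> I \<or> b0 \<notin> I \<Longrightarrow> y I = 0" and k: "k \<in> Ix" "k < b0"
  shows "ff k (nx k) * (\<Sum>I\<in>Pow Ix. const (y I) * wd (pw I)) \<in> K \<longleftrightarrow> (\<forall>I\<in>Pow (Ix - {k, nx k}). eqn y k I = 0)"
proof -
  have K_iff: "ff k (nx k) * (\<Sum>I\<in>Pow Ix. const (y I) * wd (pw I)) \<in> K \<longleftrightarrow>
      (\<Sum>I\<in>Pow (Ix - {k, nx k}). const (eqn y k I) * wd (Zww k I)) \<in> K"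
    by (rule ceq_K[OF raise_sum[OF y k]])
  show ?thesis
    unfolding K_iff
  proof
    assume K: "(\<Sum>I\<in>Pow (Ix - {k, nx k}). const (eqn y k I) * wd (Zww k I)) \<in> K"
    have inj: "inj_on (Zww k) (Pow (Ix - {k, nx k}))"
    proof (rule inj_onI)
      fix I J assume IJ: "I \<in> Pow (Ix - {k, nx k})" "J \<in> Pow (Ix - {k, nx k})" "Zww k I = Zww k J"
      show "I = J"
        by (rule subst[OF Zww_facts(3)[OF PowD[OF IJ(1)] k, unfolded IJ(3)]]) (rule Zww_facts(3)[OF PowD[OF IJ(2)] k])
    qed
    show "\<forall>I\<in>Pow (Ix - {k, nx k}). eqn y k I = 0"
    proof
      fix I assume "I \<in> Pow (Ix - {k, nx k})"
      then show "eqn y k I = 0"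
        by (rule verma_independent_inj[OF _ inj _ K, rotated 2])
          (use finite_Ix Zww_facts(1,2)[OF _ k] in auto)
    qed
  qed (simp add: K_0)
qed

text \<open>With the coefficient at \<open>- s\<close> set to 0, \<open>yd I\<close> vanishes unless \<open>I\<close> contains both \<open>- s\<close> and \<open>t\<close>.\<close>

definition ct :: "int \<Rightarrow> complex" where
  "ct j = (if j = a0 then 0 else c_coeff s t lam j)"

definition yd :: "int set \<Rightarrow> complex" where
  "yd I = (\<Prod>j\<in>Ix - I. ct j)"

definition S1 :: "endo free_alg" where
  "S1 = (\<Sum>I\<in>Pow Ix. const (yd I) * wd (pw I))"

lemma ct_ends: "ct a0 = 0" "ct b0 = 0"
  by (simp_all add: ct_def c_coeff_def)

lemma yd_0: "a0 \<notin> I \<or> b0 \<notin> I \<Longrightarrow> yd I = 0"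
  unfolding yd_def using ct_ends ab_Ix finite_Ix by (auto intro: prod_zero)

text \<open>On either side of 0 this is an identity in \<open>lam\<close>; at \<open>k = -1\<close>
  the two normalisations meet and the identity becomes the atypicality condition. At
  \<open>k = a0\<close> the missing 1 in \<open>hk\<close> is matched by \<open>ct a0\<close> being
  0, where \<open>c_coeff\<close> would give -1.\<close>

lemma coef_rec:
  assumes at: "lam a0 + lam b0 + of_nat s - of_nat t = 0" and k: "k \<in> Ix" "k < b0"
  shows "hk k + ct k + eta k * ct (nx k) = 0"
proof -
  have lt': "lam b0 = of_nat t - of_nat s - lam a0" using at by (simp add: algebra_simps)
  consider "k = -1" | "k < -1" | "k > 0" using k by (auto simp: Ix_def) linarith
  then show ?thesis
  proof cases
    case 1
    then show ?thesis
      using s t by (auto simp: hk_def ct_def c_coeff_def eta_def nx_def lt')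
  next
    case 2
    then have "nx k = k + 1" "k + 1 < 0" "nx k \<noteq> a0" using k by (auto simp: nx_def Ix_def)
    then show ?thesis
      using 2 by (auto simp: hk_def ct_def c_coeff_def eta_def)
  next
    case 3
    then have "nx k = k + 1" "k \<noteq> a0" "nx k \<noteq> a0" using s by (auto simp: nx_def)
    then show ?thesis
      using 3 by (auto simp: hk_def ct_def c_coeff_def eta_def)
  qed
qed

text \<open>Removing an index from the set adds one factor to \<open>yd\<close>, so a common product
  can be taken out and \<open>coef_rec\<close> remains.\<close>

lemma eqn_yd:
  assumes at: "lam a0 + lam b0 + of_nat s - of_nat t = 0" and k: "k \<in> Ix" "k < b0" and I: "I \<in> Pow (Ix - {k, nx k})"
  shows "eqn yd k I = 0"
proof -
  let ?Y = "Ix - insert k (insert (nx k) I)"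
  have nek: "k \<noteq> nx k" using nx_gt[of k] by simp
  have e: "Ix - insert (nx k) I = insert k ?Y" "Ix - insert k I = insert (nx k) ?Y" using k nx_Ix I nek by auto
  have "yd (insert (nx k) I) = ct k * yd (insert k (insert (nx k) I))"
    unfolding yd_def e(1) by (rule prod.insert) (use finite_Ix in auto)
  moreover have "yd (insert k I) = ct (nx k) * yd (insert k (insert (nx k) I))"
    unfolding yd_def e(2) by (rule prod.insert) (use finite_Ix in auto)
  ultimately have "eqn yd k I = (hk k + ct k + eta k * ct (nx k)) * yd (insert k (insert (nx k) I))"
    by (simp add: eqn_def algebra_simps)
  then show ?thesis using coef_rec[OF at k] by simp
qed

text \<open>The rule \<open>y I = ct k * y (insert k I)\<close> holds at \<open>a0\<close> because
  both sides vanish, and the equation for a step carries it to the next index. This needs division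
  by \<open>eta\<close> only; the \<open>ct\<close> may vanish.\<close>

lemma unique_solution:
  assumes at: "lam a0 + lam b0 + of_nat s - of_nat t = 0"
    and y: "\<And>I. a0 \<notin> I \<or> b0 \<notin> I \<Longrightarrow> y I = 0"
    and e: "\<And>k I. k \<in> Ix \<Longrightarrow> k < b0 \<Longrightarrow> I \<in> Pow (Ix - {k, nx k}) \<Longrightarrow> eqn y k I = 0"
    and I: "I \<subseteq> Ix"
  shows "y I = yd I * y Ix"
proof -
  have step: "\<forall>I\<subseteq>Ix. k \<notin> I \<longrightarrow> y I = ct k * y (insert k I)" if k: "k \<in> Ix" for k
    using k
  proof (induction "nat (k - a0)" arbitrary: k rule: less_induct)
    case less
    show ?case
    proof (cases "k = a0")
      case True
      then show ?thesis using y by (auto simp: ct_ends)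
    next
      case False
      define j where "j = (if k = 1 then -1 else k - 1)"
      have j: "j \<in> Ix" "j < b0" "nx j = k" "nat (j - a0) < nat (k - a0)"
        using less.prems False s by (auto simp: j_def Ix_def nx_def)
      have IH: "\<And>I. I \<subseteq> Ix \<Longrightarrow> j \<notin> I \<Longrightarrow> y I = ct j * y (insert j I)"
        using less.hyps[OF j(4,1)] by blast
      have jk: "j \<noteq> k" using nx_gt[of j] j(3) by simp
      have c: "hk j = - (ct j + eta j * ct k)"
        using coef_rec[OF at j(1,2)] by (simp only: eq_neg_iff_add_eq_0 add.assoc j(3))
      have eta0: "eta j \<noteq> 0" by (simp add: eta_def)
      show ?thesis
      proof (intro allI impI)
        fix I assume I: "I \<subseteq> Ix" "k \<notin> I"
        \<comment> \<open>The equation for the step from \<open>j\<close> to \<open>k\<close>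
          involves three values of \<open>y\<close>. The rule at \<open>j\<close> expresses one of
          them by another, and the recursion for \<open>hk j\<close> leaves a multiple of
          \<open>eta j\<close>.\<close>
        have main: "y (insert j I') = ct k * y (insert k (insert j I'))" if I': "I' \<subseteq> Ix" "k \<notin> I'" "j \<notin> I'" for I'
        proof -
          have "eqn y j I' = 0" using I' j by (intro e) auto
          moreover have "y (insert k I') = ct j * y (insert j (insert k I'))" using I' less.prems jk by (intro IH) auto
          ultimately have "eta j * (y (insert j I') - ct k * y (insert j (insert k I'))) = 0"
            unfolding eqn_def j(3) c by (simp add: algebra_simps)
          then show ?thesis using eta0 by (simp add: insert_commute)
        qed
        show "y I = ct k * y (insert k I)"
        proof (cases "j \<in> I")
          case True
          then have "insert j (I - {j}) = I" by auto
          then show ?thesis using main[of "I - {j}"] I by auto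
        next
          case False
          \<comment> \<open>For sets without \<open>j\<close>, the rule at \<open>j\<close> inserts
            \<open>j\<close> and afterwards removes it again; the factor \<open>ct j\<close> is
            carried along and never cancelled.\<close>
          have "y I = ct j * y (insert j I)" using IH I False by blast
          also have "\<dots> = ct k * (ct j * y (insert j (insert k I)))" using main[OF I False] by (simp add: insert_commute)
          also have "ct j * y (insert j (insert k I)) = y (insert k I)"
            using IH[of "insert k I"] I False jk less.prems by auto
          finally show ?thesis .
        qed
      qed
    qed
  qed
  have "y (Ix - C) = (\<Prod>j\<in>C. ct j) * y Ix" if "finite C" "C \<subseteq> Ix" for C
    using that
  proof (induction C rule: finite_induct)
    case (insert c C)
    have "y (Ix - insert c C) = ct c * y (insert c (Ix - insert c C))"
      using step[of c] insert.prems by auto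
    also have "insert c (Ix - insert c C) = Ix - C" using insert by auto
    finally show ?case using insert by simp
  qed simp
  from this[of "Ix - I"] show ?thesis using finite_Ix I by (simp add: yd_def double_diff)
qed

section \<open>Weight, singularity and uniqueness of the vector\<close>

lemma S1_fa: "S1 \<in> fa g"
  unfolding S1_def using pw_fa by (intro fa_sum fa_mult) auto

lemma simple_kills:
  assumes at: "lam a0 + lam b0 + of_nat s - of_nat t = 0" and k: "k \<in> Ix" "k < b0"
  shows "ff k (nx k) * S1 \<in> K"
  unfolding S1_def using raise_sum_zero_iff[of yd k] yd_0 k eqn_yd[OF at k] by blast

lemma ff_kills:
  assumes at: "lam a0 + lam b0 + of_nat s - of_nat t = 0"
  shows "a \<in> Ix \<Longrightarrow> b \<in> Ix \<Longrightarrow> a < b \<Longrightarrow> ff a b * S1 \<in> K"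
proof (induction "nat (b - a)" arbitrary: b rule: less_induct)
  case less
  define j where "j = (if b = 1 then -1 else b - 1)"
  have j: "j \<in> Ix \<or> b = a0" "j < b0" "nx j = b" "j < b" "a \<le> j"
    using less.prems s by (auto simp: j_def Ix_def nx_def)
  then have jI: "j \<in> Ix" using less.prems by (auto simp: Ix_def)
  show ?case
  proof (cases "a = j")
    case True
    then show ?thesis using simple_kills[OF at jI j(2)] j(3) by simp
  next
    case False
    then have aj: "a < j" using j by simp
    have W: "a \<in> W" "j \<in> W" "b \<in> W" using less.prems jI Ix_W by auto
    have 1: "ff a j * S1 \<in> K" using less.prems j aj jI by (intro less.hyps) auto
    have 2: "ff j b * S1 \<in> K" using simple_kills[OF at jI j(2)] j(3) by simp
    have "ff a j * ff j b - (const (sgn2 (a, j) (j, b)) * (ff j b * ff a j) + ff a b) \<in> U_ideal"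
      using ff_comm[OF W(1,2,2,3)] less.prems(3) by simp
    from U_ideal_mult_right[OF this S1_fa]
    have "ff a b * S1 \<approxeq> ff a j * (ff j b * S1) - const (sgn2 (a, j) (j, b)) * (ff j b * (ff a j * S1))"
      by (intro ceq_sym[OF ceq_U]) (simp add: algebra_simps)
    moreover have "ff a j * (ff j b * S1) - const (sgn2 (a, j) (j, b)) * (ff j b * (ff a j * S1)) \<in> K"
      by (intro K_diff K_scale K_mult 1 2 ff_fa W)
    ultimately show ?thesis using ceq_K by blast
  qed
qed

lemma pw_weight:
  assumes "I \<subseteq> Ix" "a0 \<in> I" "b0 \<in> I"
  shows "wtw (pw I) = eps b0 - eps a0"
proof -
  let ?L = "sorted_list_of_set I"
  have L: "set ?L = I" "sorted_wrt (<) ?L" "?L \<noteq> []" using sorted_sub[OF assms(1)] assms(2) by auto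
  have "hd ?L = a0"
  proof -
    obtain x xs where x: "?L = x # xs" using L(3) by (cases ?L) auto
    then have "x \<in> I" using L(1) by auto
    then have "a0 \<le> x" using assms(1) by (auto simp: Ix_def)
    moreover have "a0 = x \<or> x < a0" using L(1,2) x assms(2) by auto
    ultimately show ?thesis using x by auto
  qed
  moreover have "last ?L = b0"
  proof -
    obtain x xs where x: "?L = xs @ [x]" using L(3) by (cases ?L rule: rev_cases) auto
    then have "x \<in> I" using L(1) by auto
    then have "x \<le> b0" using assms(1) by (auto simp: Ix_def)
    moreover have "b0 = x \<or> b0 < x" using L(1,2) x assms(3) by (auto simp: sorted_wrt_append)
    ultimately show ?thesis using x by auto
  qed
  ultimately show ?thesis unfolding pw_def using wtw_pth[OF L(3,2)] L(1) assms(1) Ix_W by auto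
qed

lemma S1_weight:
  assumes h: "h \<in> cartan"
  shows "gen h * S1 \<approxeq> const (ev (lam - (eps a0 - eps b0)) h) * S1"
proof -
  have hf: "gen h \<in> fa g" using h by (simp add: cartan_eq gen_fa)
  have "gen h * S1 = (\<Sum>I\<in>Pow Ix. const (yd I) * (gen h * wd (pw I)))"
    by (simp only: S1_def sum_distrib_left const_left_commute)
  also have "\<dots> \<approxeq> (\<Sum>I\<in>Pow Ix. const (ev (lam - (eps a0 - eps b0)) h) * (const (yd I) * wd (pw I)))"
  proof (rule ceq_sum)
    fix I assume I: "I \<in> Pow Ix"
    show "const (yd I) * (gen h * wd (pw I)) \<approxeq> const (ev (lam - (eps a0 - eps b0)) h) * (const (yd I) * wd (pw I))"
    proof (cases "a0 \<in> I \<and> b0 \<in> I")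
      case True
      then have eq: "lam + wtw (pw I) = lam - (eps a0 - eps b0)" using pw_weight[of I] I by simp
      have "gen h * wd (pw I) \<approxeq> const (ev (lam + wtw (pw I)) h) * wd (pw I)"
        by (rule weight_wd[OF h pw_negl]) (use I in auto)
      then have "gen h * wd (pw I) \<approxeq> const (ev (lam - (eps a0 - eps b0)) h) * wd (pw I)"
        by (simp only: eq)
      from ceq_scale[OF this, of "yd I"] show ?thesis by (simp only: const_left_commute[of "const (yd I)"])
    qed (simp add: yd_0 ceq_refl)
  qed
  also have "\<dots> = const (ev (lam - (eps a0 - eps b0)) h) * S1"
    by (simp only: S1_def sum_distrib_left)
  finally show ?thesis .
qed

text \<open>\<open>tot\<close> vanishes on \<open>eps b0 - eps a0\<close>, so every letter of a word
  of this weight lies in \<open>W\<close>, and \<open>path_word\<close> identifies the word as a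
  path.\<close>

lemma weight_expand_paths:
  assumes p: "p \<in> fa g" and w: "\<And>h. h \<in> cartan \<Longrightarrow> gen h * p \<approxeq> const (ev (lam - (eps a0 - eps b0)) h) * p"
  shows "\<exists>y. (\<forall>I. a0 \<notin> I \<or> b0 \<notin> I \<longrightarrow> y I = 0) \<and> p \<approxeq> (\<Sum>I\<in>Pow Ix. const (y I) * wd (pw I))"
proof -
  let ?P = "{I \<in> Pow Ix. a0 \<in> I \<and> b0 \<in> I}"
  obtain Us x where Us: "finite Us" "Us \<subseteq> {u. set u \<subseteq> negl \<and> normal u \<and> (\<forall>c\<in>W. wtw u c = (lam - (eps a0 - eps b0)) c - lam c)}"
    "p \<approxeq> (\<Sum>u\<in>Us. const (x u) * wd u)"
    by (rule weight_expand[OF p w])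
  have "Us \<subseteq> pw ` ?P"
  proof
    fix u assume "u \<in> Us"
    then have u: "set u \<subseteq> negl" "normal u" and wu: "\<forall>c\<in>W. wtw u c = eps b0 c - eps a0 c" using Us(2) by auto
    have W: "a0 \<in> W" "b0 \<in> W" using ab_Ix Ix_W by auto
    have "tot (wtw u) = tot (eps b0 - eps a0)" using wu by (intro tot_cong) auto
    then have "tot (wtw u) = 0" using W by (simp add: tot_diff tot_eps)
    then have "\<forall>b\<in>set u. fst b \<in> W \<and> snd b \<in> W \<and> snd b < fst b" using tot_wtw[OF u(1)] by blast
    from path_word[OF u(2) this wu W(2,1)]
    obtain L where L: "L \<noteq> []" "sorted_wrt (<) L" "set L \<subseteq> W" "hd L = a0" "last L = b0" "u = pth L" by blast
    have "set L \<subseteq> Ix"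
    proof
      fix z assume z: "z \<in> set L"
      obtain l L' where l: "L = l # L'" using L(1) by (cases L) auto
      obtain r R where r: "L = R @ [r]" using L(1) by (cases L rule: rev_cases) auto
      have "l \<le> z" using z L(2) unfolding l by auto
      moreover have "z \<le> r" using z L(2) unfolding r by (auto simp: sorted_wrt_append)
      moreover have "l = a0" using L(4) unfolding l by simp
      moreover have "r = b0" using L(5) unfolding r by simp
      ultimately show "z \<in> Ix" using z L(3) by (auto simp: Ix_def W_def)
    qed
    moreover have "a0 \<in> set L" "b0 \<in> set L" using L(1,4,5) hd_in_set last_in_set by metis+
    moreover have "pw (set L) = u" using L(6) sorted_list_of_set_eqI[OF L(2) refl] by (simp add: pw_def)
    ultimately show "u \<in> pw ` ?P" by blast
  qed
  then obtain V where V: "V \<subseteq> ?P" "Us = pw ` V" by (auto simp: subset_image_iff)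
  define y where "y I = (if I \<in> V then x (pw I) else 0)" for I
  have "(\<Sum>u\<in>Us. const (x u) * wd u) = (\<Sum>I\<in>V. const (x (pw I)) * wd (pw I))"
    unfolding V(2) using inj_on_subset[OF pw_inj V(1)] by (simp add: sum.reindex)
  also have "\<dots> = (\<Sum>I\<in>Pow Ix. const (y I) * wd (pw I))"
    using V(1) finite_Ix by (intro sum.mono_neutral_cong_left) (auto simp: y_def)
  finally have "p \<approxeq> (\<Sum>I\<in>Pow Ix. const (y I) * wd (pw I))" using Us(3) by (simp only:)
  moreover have "\<forall>I. a0 \<notin> I \<or> b0 \<notin> I \<longrightarrow> y I = 0" using V(1) by (auto simp: y_def)
  ultimately show ?thesis by blast
qed

text \<open>It is enough to treat letters. If some word has the weight obtained by raising, then
  \<open>tot\<close> and \<open>psum\<close> applied to it force both coordinates of the letter into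
  \<open>Ix\<close>, where \<open>ff_kills\<close> applies.\<close>

lemma n_pos_kills:
  assumes at: "lam a0 + lam b0 + of_nat s - of_nat t = 0" and x: "x \<in> n_pos"
  shows "gen x * S1 \<in> K"
proof -
  have xG: "x \<in> G" using x by (simp add: n_pos_eq)
  have F: "gen (F b) * S1 \<in> K" if b: "b \<in> lets" "ht (fst b) > ht (snd b)" for b
  proof -
    obtain a c where bb: "b = (a, c)" by (cases b)
    have i: "a \<in> inds" "c \<in> inds" using lets_inds[OF b(1)] by (auto simp: bb)
    have "ht a > 0" using b by (auto simp: bb lets_def)
    then have aW: "a \<in> W" using ht_pos_iff i by blast
    have bf: "gen (F b) \<in> fa g" using b(1) by (intro gen_fa F_lets_G)
    let ?\<mu> = "lam - (eps a0 - eps b0) + (wt a - wt c)"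
    have "gen h * (gen (F b) * S1) \<approxeq> const (ev ?\<mu> h) * (gen (F b) * S1)" if h: "h \<in> cartan" for h
    proof -
      have "gen h * (gen (F b) * S1) \<approxeq> gen (F b) * (gen h * S1) + const (ev (wt a - wt c) h) * (gen (F b) * S1)"
        using U_ideal_mult_right[OF cartan_comm[OF h b(1)] S1_fa] by (intro ceq_U) (simp add: bb algebra_simps)
      also have "\<dots> \<approxeq> gen (F b) * (const (ev (lam - (eps a0 - eps b0)) h) * S1) + const (ev (wt a - wt c) h) * (gen (F b) * S1)"
        by (intro ceq_add ceq_refl ceq_mult S1_weight h bf)
      also have "\<dots> = const (ev ?\<mu> h) * (gen (F b) * S1)"
        by (simp only: ev_add[of "lam - (eps a0 - eps b0)"] const_add distrib_right const_left_commute)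
      finally show ?thesis .
    qed
    then obtain Us x where Us: "finite Us" "Us \<subseteq> {u. set u \<subseteq> negl \<and> normal u \<and> (\<forall>c\<in>W. wtw u c = ?\<mu> c - lam c)}"
      "gen (F b) * S1 \<approxeq> (\<Sum>u\<in>Us. const (x u) * wd u)"
      by (rule weight_expand[OF fa_mult[OF bf S1_fa]])
    show ?thesis
    proof (cases "Us = {}")
      case True
      then show ?thesis using Us(3) by (simp add: ceq_0)
    next
      case False
      then obtain u where "u \<in> Us" by blast
      then have u: "set u \<subseteq> negl" and wu: "\<And>d. d \<in> W \<Longrightarrow> wtw u d = (eps b0 - eps a0 + (eps a - wt c)) d"
        using Us(2) aW by (auto simp: wt_W)
      have W: "a0 \<in> W" "b0 \<in> W" using ab_Ix Ix_W by auto
      have tt: "tot (wtw u) = 1 - tot (wt c)"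
        using tot_cong[of "wtw u" "eps b0 - eps a0 + (eps a - wt c)", OF wu] W aW by (simp add: tot_add tot_diff tot_eps)
      \<comment> \<open>\<open>tot\<close> is at most 0 on words in \<open>negl\<close> and at most
        1 on \<open>wt c\<close>, so both bounds are attained.\<close>
      then have "tot (wt c) = 1" using tot_wtw[OF u] tot_wt[OF i(2)] by linarith
      then have cW: "c \<in> W" using tot_wt[OF i(2)] by blast
      have "tot (wtw u) = 0" using tt \<open>tot (wt c) = 1\<close> by simp
      then have ps: "psum d (wtw u) \<le> 0" for d using tot_wtw[OF u] psum_wtw by blast
      have "psum d (wtw u) = of_bool (b0 \<le> d) - of_bool (a0 \<le> d) + (of_bool (a \<le> d) - of_bool (c \<le> d))" for d
        using psum_cong[of "wtw u" "eps b0 - eps a0 + (eps a - wt c)" d, OF wu] W aW cW by (simp add: psum_add psum_diff psum_eps wt_W)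
      with ps have ps': "of_bool (b0 \<le> d) - of_bool (a0 \<le> d) + (of_bool (a \<le> d) - of_bool (c \<le> d)) \<le> (0::real)" for d
        by metis
      have ac: "a < c" using ht_W_less[OF cW aW] b(2) by (simp add: bb)
      \<comment> \<open>At \<open>d = a\<close> the letter contributes 1, which only a start
        \<open>a0\<close> at or below \<open>a\<close> can offset. At \<open>d = c - 1\<close> it
        still does, so \<open>b0\<close> must not be counted yet.\<close>
      have "a0 \<le> a" using ps'[of a] ac by (auto simp: of_bool_def split: if_splits)
      moreover have "c \<le> b0" using ps'[of "c - 1"] ac by (auto simp: of_bool_def split: if_splits)
      ultimately have "a \<in> Ix" "c \<in> Ix" using aW cW ac by (auto simp: Ix_def W_def)
      then show ?thesis using ff_kills[OF at _ _ ac] by (simp add: bb ff_def)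
    qed
  qed
  have "gen x * S1 - (\<Sum>b\<in>lets. const (x (fst b) (snd b) / nu b) * gen (F b)) * S1 \<in> U_ideal"
    using U_ideal_mult_right[OF gen_expand[OF xG] S1_fa] by (simp add: left_diff_distrib)
  then have 1: "gen x * S1 \<approxeq> (\<Sum>b\<in>lets. const (x (fst b) (snd b) / nu b) * gen (F b)) * S1" by (rule ceq_U)
  have "const (x (fst b) (snd b) / nu b) * (gen (F b) * S1) \<in> K" if "b \<in> lets" for b
  proof (cases "x (fst b) (snd b) = 0")
    case False
    then have "ht (fst b) > ht (snd b)" using x by (auto simp: n_pos_eq)
    then show ?thesis using F that K_scale by blast
  qed (simp add: K_0)
  then have "(\<Sum>b\<in>lets. const (x (fst b) (snd b) / nu b) * gen (F b)) * S1 \<in> K"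
    unfolding sum_distrib_right mult.assoc by (rule K_sum)
  then show ?thesis using ceq_K[OF 1] by simp
qed

text \<open>The coefficient of the path through all indices is an empty product, hence 1, whatever
  \<open>lam\<close> is.\<close>

lemma S1_notin_K: "S1 \<notin> K"
proof
  assume K: "S1 \<in> K"
  let ?P = "{I \<in> Pow Ix. a0 \<in> I \<and> b0 \<in> I}"
  have "S1 = (\<Sum>I\<in>?P. const (yd I) * wd (pw I))"
    unfolding S1_def using finite_Ix yd_0 by (intro sum.mono_neutral_right) auto
  then have "yd Ix = 0"
    using verma_independent_inj[OF _ pw_inj, of yd Ix] K finite_Ix ab_Ix pw_negl pw_normal by auto
  then show False by (simp add: yd_def)
qed

text \<open>The vectors of this weight are combinations of paths. The equations of the simple
  raising operators then leave only the value \<open>y Ix\<close> free, and it is nonzero because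
  \<open>p\<close> is not in \<open>K\<close>.\<close>

lemma unique_singular:
  assumes at: "lam a0 + lam b0 + of_nat s - of_nat t = 0"
    and p: "p \<in> fa g" "p \<notin> K" "\<And>x. x \<in> n_pos \<Longrightarrow> gen x * p \<in> K"
    and w: "\<And>h. h \<in> cartan \<Longrightarrow> gen h * p \<approxeq> const (ev (lam - (eps a0 - eps b0)) h) * p"
  shows "\<exists>c. c \<noteq> 0 \<and> p \<approxeq> const c * S1"
proof -
  obtain y where y0: "\<forall>I. a0 \<notin> I \<or> b0 \<notin> I \<longrightarrow> y I = 0" and py: "p \<approxeq> (\<Sum>I\<in>Pow Ix. const (y I) * wd (pw I))" (is "_ \<approxeq> ?q")
    using weight_expand_paths[OF p(1) w] by blast
  have y: "y I = 0" if "a0 \<notin> I \<or> b0 \<notin> I" for I using y0 that by blast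
  have e0: "eqn y k I = 0" if k: "k \<in> Ix" "k < b0" and I: "I \<in> Pow (Ix - {k, nx k})" for k I
  proof -
    have W: "k \<in> W" "nx k \<in> W" using k nx_Ix Ix_W by auto
    have "ff k (nx k) * p \<in> K" unfolding ff_def by (rule p(3)[OF F_pos[OF W nx_gt]])
    then have "ff k (nx k) * ?q \<in> K" using ceq_K[OF ceq_mult[OF py ff_fa[OF W]]] by simp
    moreover have "ff k (nx k) * ?q \<in> K \<longleftrightarrow> (\<forall>I\<in>Pow (Ix - {k, nx k}). eqn y k I = 0)"
      by (rule raise_sum_zero_iff[OF _ k]) (rule y)
    ultimately show ?thesis using I by simp
  qed
  have sol: "y I = y Ix * yd I" if "I \<subseteq> Ix" for I
    by (subst mult.commute, rule unique_solution[OF at y e0 that])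
  have "?q = const (y Ix) * S1"
    unfolding S1_def sum_distrib_left mult.assoc[symmetric] const_mult[symmetric]
  proof (rule sum.cong[OF refl])
    fix I assume "I \<in> Pow Ix"
    then show "const (y I) * wd (pw I) = const (y Ix * yd I) * wd (pw I)" by (subst sol) auto
  qed
  then have e: "p \<approxeq> const (y Ix) * S1" using py by simp
  moreover have "y Ix \<noteq> 0" using p(2) ceq_K[OF e] K_0 by auto
  ultimately show ?thesis by blast
qed

section \<open>Identification with the element \<open>S\<close> of the enveloping
  superalgebra\<close>

lemma between_Ix: "Ix = insert a0 (insert b0 (between s t))" "a0 \<notin> between s t" "b0 \<notin> between s t"
  "finite (between s t)"
  using s t by (auto simp: Ix_def between_def)

text \<open>Subsets of \<open>Ix\<close> are grouped by their inner vertices \<open>J\<close>. Of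
  the four sets in a group, the three that lack an end have \<open>yd\<close> equal to 0.\<close>

lemma S1_eq: "S1 = (\<Sum>J\<in>Pow (between s t). const (d_coeff s t lam J) * mon (chain a0 (sorted_list_of_set J @ [b0])))"
proof -
  let ?f = "\<lambda>I. const (yd I) * wd (pw I)"
  have ne: "a0 \<noteq> b0" using ab_Ix(3) by linarith
  have "S1 = (\<Sum>I\<in>Pow (insert b0 (between s t)). ?f I + ?f (insert a0 I))"
    unfolding S1_def between_Ix(1) by (rule sum_Pow_insert) (use between_Ix ne in auto)
  also have "\<dots> = (\<Sum>J\<in>Pow (between s t). ?f J + ?f (insert a0 J) + (?f (insert b0 J) + ?f (insert a0 (insert b0 J))))"
    by (rule sum_Pow_insert) (use between_Ix in auto)
  also have "\<dots> = (\<Sum>J\<in>Pow (between s t). const (d_coeff s t lam J) * mon (chain a0 (sorted_list_of_set J @ [b0])))"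
  proof (intro sum.cong refl)
    fix J assume J: "J \<in> Pow (between s t)"
    then have nJ: "a0 \<notin> J" "b0 \<notin> J" using between_Ix by auto
    have z: "yd J = 0" "yd (insert a0 J) = 0" "yd (insert b0 J) = 0" using nJ ne by (auto intro!: yd_0)
    have fin: "finite J" using J between_Ix(4) finite_subset by auto
    have e: "Ix - insert a0 (insert b0 J) = between s t - J"
      unfolding between_Ix(1) using between_Ix(2,3) by blast
    have d: "yd (insert a0 (insert b0 J)) = d_coeff s t lam J"
      unfolding yd_def d_coeff_def e
    proof (rule prod.cong[OF refl])
      fix j assume "j \<in> between s t - J"
      then have "j \<noteq> a0" using between_Ix(2) by blast
      then show "ct j = c_coeff s t lam j" by (simp add: ct_def)
    qed
    have srt: "sorted_wrt (<) (a0 # sorted_list_of_set J @ [b0])"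
      using J fin ab_Ix(3) by (auto simp: sorted_wrt_append between_def)
    then have L: "sorted_list_of_set (insert a0 (insert b0 J)) = a0 # sorted_list_of_set J @ [b0]"
      using fin by (intro sorted_list_of_set_eqI) auto
    have sub: "insert a0 (insert b0 J) \<subseteq> Ix" using J between_Ix by auto
    have "mon (map F u) = wd u" if "set u \<subseteq> negl" for u
      using that by (induction u) (auto simp: mon_Cons wd_Cons lt_negl)
    moreover have "set (a0 # sorted_list_of_set J @ [b0]) \<subseteq> W" using sub fin Ix_W by auto
    note chain_eq_pth[OF srt this]
    moreover have "pw (insert a0 (insert b0 J)) = pth (a0 # sorted_list_of_set J @ [b0])" by (simp only: pw_def L)
    ultimately have "mon (chain a0 (sorted_list_of_set J @ [b0])) = wd (pw (insert a0 (insert b0 J)))"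
      using pw_negl[OF sub] by simp
    then show "?f J + ?f (insert a0 J) + (?f (insert b0 J) + ?f (insert a0 (insert b0 J)))
       = const (d_coeff s t lam J) * mon (chain a0 (sorted_list_of_set J @ [b0]))"
      by (simp add: z d)
  qed
  finally show ?thesis .
qed

lemma chain_n_neg:
  assumes "J \<subseteq> between s t"
  shows "set (chain a0 (sorted_list_of_set J @ [b0])) \<subseteq> n_neg"
proof -
  have fin: "finite J" using assms between_Ix(4) finite_subset by auto
  have srt: "sorted_wrt (<) (a0 # sorted_list_of_set J @ [b0])"
    using assms fin ab_Ix(3) by (auto simp: sorted_wrt_append between_def)
  have sub: "set (a0 # sorted_list_of_set J @ [b0]) \<subseteq> W" using assms fin between_Ix Ix_W by auto
  have "F b \<in> n_neg" if "b \<in> negl" for b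
    using F_negl[OF that] F_lets_G[OF subsetD[OF negl_lets that]] by (simp add: n_neg_eq)
  then show ?thesis unfolding chain_eq_pth[OF srt sub] using pth_negl[OF srt sub] by auto
qed

lemma n_neg_G: "n_neg \<subseteq> G"
  by (auto simp: n_neg_eq)

lemma mon_chain_fa: "J \<subseteq> between s t \<Longrightarrow> mon (chain a0 (sorted_list_of_set J @ [b0])) \<in> fa g"
  using chain_n_neg n_neg_G by (intro fa_mon) (auto simp: g_eq_G)

lemma S_elem_eq: "S_elem s t lam = cls S1"
proof -
  have "scalU (d_coeff s t lam J) \<otimes>\<^bsub>U\<^esub> e_elem s t J
     = cls (const (d_coeff s t lam J) * mon (chain a0 (sorted_list_of_set J @ [b0])))" if "J \<in> Pow (between s t)" for J
  proof -
    have J: "J \<subseteq> between s t" using that by simp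
    have "e_elem s t J = cls (mon (chain a0 (sorted_list_of_set J @ [b0])))"
      unfolding e_elem_def by (rule foldr_cls[OF subset_trans[OF chain_n_neg[OF J] n_neg_G]])
    then show ?thesis unfolding scalU_cls using cls_mult[OF fa_const mon_chain_fa[OF J]] by simp
  qed
  then have "S_elem s t lam = (\<Oplus>\<^bsub>U\<^esub>J\<in>Pow (between s t). cls (const (d_coeff s t lam J) * mon (chain a0 (sorted_list_of_set J @ [b0]))))"
    unfolding S_elem_def
    by (intro abelian_monoid.finsum_cong'[OF abelian_group.axioms(1)[OF ring.is_abelian_group[OF ring_U]]])
      (auto intro!: cls_carrier fa_mult mon_chain_fa)
  also have "\<dots> = cls S1"
    unfolding S1_eq using between_Ix(4) by (intro cls_finsum) (auto intro!: fa_mult mon_chain_fa)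
  finally show ?thesis .
qed

lemma S_elem_U_neg: "S_elem s t lam \<in> U_neg"
  unfolding S_elem_eq S1_eq U_neg_def
proof (rule cls_sum_generate)
  show "finite (Pow (between s t))" using between_Ix(4) by simp
  fix J assume J: "J \<in> Pow (between s t)"
  then show "const (d_coeff s t lam J) * mon (chain a0 (sorted_list_of_set J @ [b0])) \<in> fa g"
    by (auto intro!: fa_mult mon_chain_fa)
  have "cls (const (d_coeff s t lam J) * mon (chain a0 (sorted_list_of_set J @ [b0])))
    = scalU (d_coeff s t lam J) \<otimes>\<^bsub>U\<^esub> cls (mon (chain a0 (sorted_list_of_set J @ [b0])))"
    using J by (simp add: scalU_cls cls_mult mon_chain_fa)
  moreover have "cls (mon (chain a0 (sorted_list_of_set J @ [b0]))) \<in> generate_ring U (range scalU \<union> inU ` n_neg)"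
    using chain_n_neg J n_neg_G by (intro cls_gen_ring) auto
  moreover have "scalU (d_coeff s t lam J) \<in> generate_ring U (range scalU \<union> inU ` n_neg)"
    by (rule generate_ring.incl) auto
  ultimately show "cls (const (d_coeff s t lam J) * mon (chain a0 (sorted_list_of_set J @ [b0]))) \<in> generate_ring U (range scalU \<union> inU ` n_neg)"
    by (simp only: generate_ring.eng_mult)
qed

lemma act_S_elem: "act lam (S_elem s t lam) (highest_weight_vector lam) = tau S1"
  by (simp add: S_elem_eq hwv_tau act_tau S1_fa)

lemma S_elem_singular:
  assumes at: "lam a0 + lam b0 + of_nat s - of_nat t = 0"
  shows "singular lam (tau S1)" "weight_vector lam (lam - (eps a0 - eps b0)) (tau S1)"
    and "singular lam w \<Longrightarrow> weight_vector lam (lam - (eps a0 - eps b0)) w \<Longrightarrow>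
      \<exists>c. c \<noteq> 0 \<and> w = act lam (scalU c) (tau S1)"
proof -
  show "singular lam (tau S1)"
    using singular_tau[OF S1_fa] S1_notin_K n_pos_kills[OF at] by blast
  show "weight_vector lam (lam - (eps a0 - eps b0)) (tau S1)"
    using weight_vector_tau[OF S1_fa] S1_weight unfolding ceq_def by blast
  assume w: "singular lam w" "weight_vector lam (lam - (eps a0 - eps b0)) w"
  have "w \<in> carrier (verma lam)" using w(1) by (simp add: singular_def)
  then obtain p where p: "p \<in> fa g" "w = tau p" by (rule tau_surj)
  obtain c where c: "c \<noteq> 0" "p \<approxeq> const c * S1"
    using unique_singular[OF at p(1)] w singular_tau[OF p(1)] weight_vector_tau[OF p(1)]
    unfolding p(2) ceq_def by blast
  have "w = tau (const c * S1)"
    using c(2) p S1_fa tau_cong_iff[of p "const c * S1"] by (simp add: ceq_def fa_mult)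
  then show "\<exists>c. c \<noteq> 0 \<and> w = act lam (scalU c) (tau S1)"
    using c(1) by (auto simp: scalU_cls act_tau S1_fa)
qed

end

text \<open>\<open>verma lam\<close> carries only an additive structure, so a scalar multiple is
  expressed by the action of \<open>scalU c\<close>.\<close>

theorem proposition9:
  fixes m n s t :: nat and ex :: bool and lam \<beta> :: weight
  assumes "m \<ge> 1" and "n \<ge> 1"
    and "1 \<le> s" and "s \<le> n" and "1 \<le> t" and "t \<le> m"
    and "\<beta> = delta (int s) - eps (int t)"
  shows "osp.S_elem m n ex s t lam \<in> osp.U_neg m n ex \<and>
    (osp.atypical m n ex lam \<beta> \<longleftrightarrow> lam (- int s) + lam (int t) + of_nat s - of_nat t = 0) \<and>
    (osp.atypical m n ex lam \<beta> \<longrightarrow>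
      (let v = osp.act m n ex lam (osp.S_elem m n ex s t lam) (osp.highest_weight_vector m n ex lam)
       in osp.singular m n ex lam v \<and> osp.weight_vector m n ex lam (lam - \<beta>) v \<and>
          (\<forall>w. osp.singular m n ex lam w \<and> osp.weight_vector m n ex lam (lam - \<beta>) w \<longrightarrow>
            (\<exists>c. c \<noteq> 0 \<and> w = osp.act m n ex lam (osp.scalU m n ex c) v))))"
proof -
  interpret osp_beta m n ex lam s t
    by standard (use assms in auto)
  have "atypical lam \<beta> \<longleftrightarrow> lam (- int s) + lam (int t) + of_nat s - of_nat t = 0"
    unfolding assms(7) using assms by (intro atypical_iff)
  then show ?thesis
    unfolding Let_def act_S_elem assms(7) using S_elem_U_neg S_elem_singular by blast
qed

end
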